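(* Let $K$ be an infinite field and $\lambda=(\lambda_1\ge\cdots\ge\lambda_n)$ a partition with positive parts. Then the reduction number of the Ferrers ideal $I_\lambda$ is $$r(I_\lambda)=\min\{n-1,\ \lambda_i+i-3\ :\ 2\le i\le n\},$$ and this also equals $r_{J_\lambda}(I_\lambda)$, where $J_\lambda$ is the minimal reduction generated by the diagonals $\sum_{i\ge1,\,k+i\le\lambda_i}x_iy_{k+i}$ ($k=0,\dots,\lambda_1-1$) and $\sum_{i\ge1,\,k+i\le n,\,i\le\lambda_{k+i}}x_{k+i}y_i$ ($k=1,\dots,n-1$).
   Context: The Ferrers ideal is $I_\lambda=(x_iy_j:1\le i\le n,\ 1\le j\le\lambda_i)\subset K[x_1,\dots,x_n,y_1,\dots,y_{\lambda_1}]$. An ideal $J\subset I$ is a reduction of $I$ if $I^{r+1}=JI^r$ for some $r\ge0$; the least such $r$ is $r_J(I)$. A reduction is minimal if no strictly smaller ideal is a reduction of $I$. The reduction number is $r(I)=\min\{r_J(I): J\text{ a minimal reduction of }I\}$. *)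

theory Defs
  imports Main "HOL-Library.Poly_Mapping"
begin

datatype var = X nat | Y nat

type_synonym 'k mpoly = "(var \<Rightarrow>\<^sub>0 nat) \<Rightarrow>\<^sub>0 'k"

definition poly_ring :: "var set \<Rightarrow> ('k::comm_ring_1) mpoly set" where
  "poly_ring V = {p :: 'k mpoly. \<forall>m :: var \<Rightarrow>\<^sub>0 nat. m \<in> Poly_Mapping.keys p \<longrightarrow> Poly_Mapping.keys m \<subseteq> V}"

definition ideal_in :: "'a::comm_ring_1 set \<Rightarrow> 'a set \<Rightarrow> bool" where
  "ideal_in R J \<longleftrightarrow> J \<subseteq> R \<and> 0 \<in> J \<and> (\<forall>a\<in>J. \<forall>b\<in>J. a + b \<in> J)
      \<and> (\<forall>r\<in>R. \<forall>a\<in>J. r * a \<in> J)"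

definition gen_ideal :: "'a::comm_ring_1 set \<Rightarrow> 'a set \<Rightarrow> 'a set" where
  "gen_ideal R S = \<Inter>{J. ideal_in R J \<and> S \<subseteq> J}"

definition ideal_prod :: "'a::comm_ring_1 set \<Rightarrow> 'a set \<Rightarrow> 'a set \<Rightarrow> 'a set" where
  "ideal_prod R I J = gen_ideal R {a * b | a b. a \<in> I \<and> b \<in> J}"

fun ideal_pow :: "'a::comm_ring_1 set \<Rightarrow> 'a set \<Rightarrow> nat \<Rightarrow> 'a set" where
  "ideal_pow R I 0 = R"
| "ideal_pow R I (Suc k) = ideal_prod R (ideal_pow R I k) I"

definition is_reduction :: "'a::comm_ring_1 set \<Rightarrow> 'a set \<Rightarrow> 'a set \<Rightarrow> bool" where
  "is_reduction R J I \<longleftrightarrow> ideal_in R J \<and> J \<subseteq> I \<and>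
     (\<exists>r. ideal_pow R I (Suc r) = ideal_prod R J (ideal_pow R I r))"

definition red_num_wrt :: "'a::comm_ring_1 set \<Rightarrow> 'a set \<Rightarrow> 'a set \<Rightarrow> nat" where
  "red_num_wrt R J I = (LEAST r. ideal_pow R I (Suc r) = ideal_prod R J (ideal_pow R I r))"

definition minimal_reduction :: "'a::comm_ring_1 set \<Rightarrow> 'a set \<Rightarrow> 'a set \<Rightarrow> bool" where
  "minimal_reduction R J I \<longleftrightarrow> is_reduction R J I \<and>
     (\<forall>J'. is_reduction R J' I \<and> J' \<subseteq> J \<longrightarrow> J' = J)"

definition reduction_number :: "'a::comm_ring_1 set \<Rightarrow> 'a set \<Rightarrow> nat" where
  "reduction_number R I = (LEAST n. \<exists>J. minimal_reduction R J I \<and> red_num_wrt R J I = n)"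

text \<open>Ferrers ideal data; lam i = \<lambda>_i for 1 \<le> i \<le> n (1-based).\<close>
definition xy :: "nat \<Rightarrow> nat \<Rightarrow> ('k::comm_ring_1) mpoly" where
  "xy i j = Poly_Mapping.single (Poly_Mapping.single (X i) 1 + Poly_Mapping.single (Y j) 1) 1"

definition ferrers_vars :: "nat \<Rightarrow> (nat \<Rightarrow> nat) \<Rightarrow> var set" where
  "ferrers_vars n lam = {X i | i. 1 \<le> i \<and> i \<le> n} \<union> {Y j | j. 1 \<le> j \<and> j \<le> lam 1}"

definition ferrers_ring :: "nat \<Rightarrow> (nat \<Rightarrow> nat) \<Rightarrow> ('k::comm_ring_1) mpoly set" where
  "ferrers_ring n lam = poly_ring (ferrers_vars n lam)"

definition ferrers_ideal :: "nat \<Rightarrow> (nat \<Rightarrow> nat) \<Rightarrow> ('k::comm_ring_1) mpoly set" where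
  "ferrers_ideal n lam = gen_ideal (ferrers_ring n lam)
      {xy i j | i j. 1 \<le> i \<and> i \<le> n \<and> 1 \<le> j \<and> j \<le> lam i}"

definition diag_upper :: "nat \<Rightarrow> (nat \<Rightarrow> nat) \<Rightarrow> nat \<Rightarrow> ('k::comm_ring_1) mpoly" where
  "diag_upper n lam k = (\<Sum>i \<in> {i. 1 \<le> i \<and> i \<le> n \<and> k + i \<le> lam i}. xy i (k + i))"

definition diag_lower :: "nat \<Rightarrow> (nat \<Rightarrow> nat) \<Rightarrow> nat \<Rightarrow> ('k::comm_ring_1) mpoly" where
  "diag_lower n lam k = (\<Sum>i \<in> {i. 1 \<le> i \<and> k + i \<le> n \<and> i \<le> lam (k + i)}. xy (k + i) i)"

definition diag_reduction :: "nat \<Rightarrow> (nat \<Rightarrow> nat) \<Rightarrow> ('k::comm_ring_1) mpoly set" where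
  "diag_reduction n lam = gen_ideal (ferrers_ring n lam)
      ({diag_upper n lam k | k. k < lam 1} \<union> {diag_lower n lam k | k. 1 \<le> k \<and> k \<le> n - 1})"

end

(*
  Modulo the diagonals, a product of generators straightens to a combination of strict products:
  cells in distinct rows other than the first, with strictly monotone columns. The generating
  function of the strict products is the Hilbert series of the special fibre times
  (1 - X)^(n + lam 1 - 1), so they are as few as possible, and the largest degree s in which one
  exists is the minimum in question. Hence I^(s+1) = J I^s for the diagonal ideal J.

  Conversely, let J be a minimal reduction with I^(r+1) = J I^r. Its space of initial forms has
  dimension at most n + lam 1 - 1: a larger space is algebraically dependent, and a generic
  hyperplane in it is still a reduction. If r < s, a generic combination of the diagonals and these
  initial forms keeps both the straightening in degrees up to s and the generation in degree s,
  and counting dimensions rules out a strict product in degree s.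

  Minimality of the diagonal ideal D must be shown against inhomogeneous ideals too. A smaller
  reduction lies in a maximal proper subideal M of D, and q = {x. x e : M} is a maximal ideal of
  the polynomial ring for any e in D - M. Locally at q, the ideal D is generated by some variables
  and some truncated diagonals which are analytically independent at q. So forms in them can be
  specialized modulo q, sending M to 0 and e to 1, and the determinant trick contradicts the
  integral dependence of e on M.
*)

theory Submission
  imports Defs "HOL-Computational_Algebra.Polynomial" "HOL-Computational_Algebra.Formal_Power_Series"
begin

section \<open>Straightening modulo the diagonals\<close>

definition shape :: "(nat \<Rightarrow> nat) \<Rightarrow> nat \<Rightarrow> nat \<Rightarrow> (nat \<times> nat) set" where
  "shape lam n p = {(i, j). 1 \<le> i \<and> i \<le> n \<and> p \<le> j \<and> j \<le> lam i}"

fun mons :: "(nat \<Rightarrow> nat) \<Rightarrow> nat \<Rightarrow> nat \<Rightarrow> nat \<Rightarrow> ('k::comm_ring_1) mpoly set" where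
  "mons lam n p 0 = {1}"
| "mons lam n p (Suc k) = (\<Union>(i, j) \<in> shape lam n p. (*) (xy i j) ` mons lam n p k)"

definition diag_cells :: "(nat \<Rightarrow> nat) \<Rightarrow> nat \<Rightarrow> nat \<Rightarrow> int \<Rightarrow> (nat \<times> nat) set" where
  "diag_cells lam n p d = {(i, j) \<in> shape lam n p. int j - int i = d}"

definition diag :: "(nat \<Rightarrow> nat) \<Rightarrow> nat \<Rightarrow> nat \<Rightarrow> int \<Rightarrow> ('k::comm_ring_1) mpoly" where
  "diag lam n p d = (\<Sum>(i, j) \<in> diag_cells lam n p d. xy i j)"

text \<open>Products of cells in distinct rows other than the first, with columns beyond \<open>p\<close> that
  strictly increase as the row index drops.\<close>

fun strict_mons :: "(nat \<Rightarrow> nat) \<Rightarrow> nat \<Rightarrow> nat \<Rightarrow> nat \<Rightarrow> ('k::comm_ring_1) mpoly set" where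
  "strict_mons lam 0 p k = (if k = 0 then {1} else {})"
| "strict_mons lam (Suc n) p k = strict_mons lam n p k \<union>
     (if n = 0 \<or> k = 0 then {}
      else \<Union>j \<in> {p<..lam (Suc n)}. (*) (xy (Suc n) j) ` strict_mons lam n j (k - 1))"

lemma finite_shape: "finite (shape lam n p)"
proof -
  have "shape lam n p \<subseteq> (SIGMA i:{1..n}. {p..lam i})" by (auto simp: shape_def)
  then show ?thesis by (rule finite_subset) auto
qed

lemma finite_diag_cells: "finite (diag_cells lam n p d)"
  by (rule finite_subset[OF _ finite_shape[of lam n p]]) (auto simp: diag_cells_def)

lemma shape_mono: "n \<le> n' \<Longrightarrow> p' \<le> p \<Longrightarrow> shape lam n p \<subseteq> shape lam n' p'"
  by (auto simp: shape_def)

lemma mons_mono: "n \<le> n' \<Longrightarrow> p' \<le> p \<Longrightarrow> mons lam n p k \<subseteq> mons lam n' p' k"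
proof (induction k)
  case (Suc k)
  have "shape lam n p \<subseteq> shape lam n' p'" using Suc.prems by (rule shape_mono)
  with Suc show ?case by (fastforce simp: image_iff)
qed auto

lemma mons_monoD: "m \<in> mons lam n p k \<Longrightarrow> n \<le> n' \<Longrightarrow> p' \<le> p \<Longrightarrow> m \<in> mons lam n' p' k"
  using mons_mono by blast

lemma finite_mons: "finite (mons lam n p k)"
  by (induction k) (auto simp: finite_shape)

lemma mons_SucI: "(i, j) \<in> shape lam n p \<Longrightarrow> m \<in> mons lam n p k \<Longrightarrow> xy i j * m \<in> mons lam n p (Suc k)"
  by auto

lemma mons_SucE:
  assumes "m \<in> mons lam n p (Suc k)"
  obtains i j m' where "(i, j) \<in> shape lam n p" "m' \<in> mons lam n p k" "m = xy i j * m'"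
  using assms by auto

lemma mons_mult: "a \<in> mons lam n p j \<Longrightarrow> b \<in> mons lam n p k \<Longrightarrow> a * b \<in> mons lam n p (j + k)"
proof (induction j arbitrary: a)
  case (Suc j)
  then obtain i l a' where *: "(i, l) \<in> shape lam n p" "a' \<in> mons lam n p j" "a = xy i l * a'"
    by (elim mons_SucE)
  have "xy i l * (a' * b) \<in> mons lam n p (Suc (j + k))"
    by (rule mons_SucI) (use * Suc in auto)
  then show ?case using * by (simp add: mult.assoc)
qed auto

lemma mons_addE:
  assumes "m \<in> mons lam n p (j + k)"
  obtains a b where "a \<in> mons lam n p j" "b \<in> mons lam n p k" "m = a * b"
proof -
  have "\<exists>a\<in>mons lam n p j. \<exists>b\<in>mons lam n p k. m = a * b" using assms
  proof (induction j arbitrary: m)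
    case (Suc j)
    then obtain i l m' where *: "(i, l) \<in> shape lam n p" "m' \<in> mons lam n p (j + k)" "m = xy i l * m'"
      by (metis add_Suc mons_SucE)
    obtain a b where "a \<in> mons lam n p j" "b \<in> mons lam n p k" "m' = a * b" using Suc.IH[OF *(2)] by auto
    with * show ?case by (intro bexI[of _ "xy i l * a"] bexI[of _ b]) (auto simp: mult.assoc)
  qed auto
  with that show thesis by blast
qed

lemma xy_exchange: "xy i j * xy k l = xy i l * xy k j"
  by (simp add: xy_def mult_single ac_simps)

lemma mons_row0: "mons lam 0 p k = (if k = 0 then {1} else {})"
  by (cases k) (auto simp: shape_def)

lemma mons_pair_last_row:
  assumes "m \<in> mons lam (Suc n) p k" "p \<le> j" "j \<le> lam (Suc n)"
    and noninc: "\<And>i. 1 \<le> i \<Longrightarrow> i \<le> n \<Longrightarrow> lam (Suc n) \<le> lam i"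
  shows "\<exists>j' m'. p \<le> j' \<and> j' \<le> j \<and> m' \<in> mons lam (Suc n) j' k \<and> xy (Suc n) j * m = xy (Suc n) j' * m'"
  using assms(1)
proof (induction k arbitrary: m)
  case 0
  then show ?case using assms by auto
next
  case (Suc k)
  obtain a b m1 where m: "(a, b) \<in> shape lam (Suc n) p" "m1 \<in> mons lam (Suc n) p k" "m = xy a b * m1"
    using Suc.prems by (elim mons_SucE)
  obtain j' m' where *: "p \<le> j'" "j' \<le> j" "m' \<in> mons lam (Suc n) j' k"
      "xy (Suc n) j * m1 = xy (Suc n) j' * m'"
    using Suc.IH[OF m(2)] by blast
  have eq: "xy (Suc n) j * m = xy (Suc n) j' * (xy a b * m')"
    using * m by (metis mult.left_commute)
  show ?case
  proof (cases "j' \<le> b")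
    case True
    have "xy a b * m' \<in> mons lam (Suc n) j' (Suc k)"
      using True m * by (intro mons_SucI) (auto simp: shape_def)
    then show ?thesis using * eq by blast
  next
    case False
    have "lam (Suc n) \<le> lam a" using noninc[of a] m(1) by (cases "a = Suc n") (auto simp: shape_def)
    then have "(a, j') \<in> shape lam (Suc n) b"
      using m(1) False * assms(3) by (auto simp: shape_def)
    moreover have "m' \<in> mons lam (Suc n) b k" using mons_mono[of "Suc n" "Suc n" b j' lam k] * False by auto
    ultimately have "xy a j' * m' \<in> mons lam (Suc n) b (Suc k)" by (rule mons_SucI)
    moreover have "xy (Suc n) j' * (xy a b * m') = xy (Suc n) b * (xy a j' * m')"
      using xy_exchange[of "Suc n" j' a b] by (metis mult.assoc)
    moreover have "p \<le> b" using m(1) by (auto simp: shape_def)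
    ultimately show ?thesis using eq False * by (intro exI[of _ b] exI[of _ "xy a j' * m'"]) auto
  qed
qed

lemma mons_last_row_cases:
  assumes "m \<in> mons lam (Suc n) p k"
    and noninc: "\<And>i. 1 \<le> i \<Longrightarrow> i \<le> n \<Longrightarrow> lam (Suc n) \<le> lam i"
  shows "m \<in> mons lam n p k \<or> (\<exists>j k' m'. k = Suc k' \<and> p \<le> j \<and> j \<le> lam (Suc n)
           \<and> m' \<in> mons lam (Suc n) j k' \<and> m = xy (Suc n) j * m')"
  using assms(1)
proof (induction k arbitrary: m)
  case (Suc k)
  obtain a b m1 where m: "(a, b) \<in> shape lam (Suc n) p" "m1 \<in> mons lam (Suc n) p k" "m = xy a b * m1"
    using Suc.prems by (elim mons_SucE)
  have last: ?case if "m = xy (Suc n) j * m2" "m2 \<in> mons lam (Suc n) p k" "p \<le> j" "j \<le> lam (Suc n)" for j m2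
    using mons_pair_last_row[OF that(2-4) noninc] that by (metis le_trans)
  show ?case
  proof (cases "a = Suc n")
    case True
    then show ?thesis using last[of b m1] m by (auto simp: shape_def)
  next
    case False
    then have ab: "(a, b) \<in> shape lam n p" using m(1) by (auto simp: shape_def)
    consider "m1 \<in> mons lam n p k" | j k' m' where "k = Suc k'" "p \<le> j" "j \<le> lam (Suc n)"
        "m' \<in> mons lam (Suc n) j k'" "m1 = xy (Suc n) j * m'"
      using Suc.IH[OF m(2)] by blast
    then show ?thesis
    proof cases
      case 1
      then show ?thesis using ab m(3) mons_SucI by blast
    next
      case 2
      have "m' \<in> mons lam (Suc n) p k'" using mons_mono[of "Suc n" "Suc n" p j lam k'] 2 by auto
      then have "xy a b * m' \<in> mons lam (Suc n) p k" using 2 m(1) by (auto intro!: mons_SucI)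
      then show ?thesis using last[of j "xy a b * m'"] m(3) 2 by (simp add: mult.left_commute)
    qed
  qed
qed auto

lemma strict_mons_subset: "strict_mons lam n p k \<subseteq> (mons lam n p k :: 'k::comm_ring_1 mpoly set)"
proof (induction n arbitrary: p k)
  case 0
  then show ?case by (simp add: mons_row0)
next
  case (Suc n)
  have "xy (Suc n) j * b \<in> mons lam (Suc n) p k"
    if "p < j" "j \<le> lam (Suc n)" "b \<in> strict_mons lam n j (k - 1)" "k \<noteq> 0" for j and b :: "'k mpoly"
  proof -
    have "b \<in> mons lam (Suc n) p (k - 1)"
      using Suc.IH[of j "k - 1"] that mons_monoD[of b lam n j "k - 1"] by auto
    then have "xy (Suc n) j * b \<in> mons lam (Suc n) p (Suc (k - 1))"
      using that by (intro mons_SucI) (auto simp: shape_def)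
    then show ?thesis using that by simp
  qed
  moreover have "strict_mons lam n p k \<subseteq> (mons lam (Suc n) p k :: 'k mpoly set)"
    by (rule subset_trans[OF Suc.IH mons_mono]) auto
  ultimately show ?case by auto
qed

lemma finite_strict_mons: "finite (strict_mons lam n p k)"
  using strict_mons_subset finite_mons by (rule finite_subset)

text \<open>A multiple of \<open>xy n j\<close> is pushed to smaller columns
  by subtracting a multiple of the diagonal through the cell \<open>(n, j)\<close>, which ends there.\<close>

lemma mons_straighten:
  assumes noninc: "\<And>i j. 1 \<le> i \<Longrightarrow> i \<le> j \<Longrightarrow> j \<le> n \<Longrightarrow> lam j \<le> lam i"
    and zero: "0 \<in> G" and diff: "\<And>a b. a \<in> G \<Longrightarrow> b \<in> G \<Longrightarrow> a - b \<in> G"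
    and ch: "strict_mons lam n p k \<subseteq> G"
    and dg: "\<And>d m k'. k = Suc k' \<Longrightarrow> m \<in> mons lam n p k' \<Longrightarrow> diag lam n p d * m \<in> G"
  shows "mons lam n p k \<subseteq> (G :: 'k::comm_ring_1 mpoly set)"
  using assms
proof (induction n arbitrary: p k G)
  case 0
  then show ?case by (simp add: mons_row0)
next
  case (Suc n p k G)
  note noninc = Suc.prems(1) and zero = Suc.prems(2) and diff = Suc.prems(3)
    and ch = Suc.prems(4) and dg = Suc.prems(5)
  have ninc: "lam (Suc n) \<le> lam i" if "1 \<le> i" "i \<le> n" for i using noninc that by auto
  have add: "a + b \<in> G" if "a \<in> G" "b \<in> G" for a b
    using diff[OF that(1) diff[OF zero that(2)]] by simp
  have sum: "(\<Sum>(a, b)\<in>A. xy a b) * c \<in> G" if "\<And>a b. (a, b) \<in> A \<Longrightarrow> xy a b * c \<in> G" for A c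
    using that by (induction A rule: infinite_finite_induct) (auto intro: zero add simp: distrib_right)
  have last: "xy (Suc n) j * m \<in> G" if k: "k = Suc k'" and "p \<le> j" "j \<le> lam (Suc n)" "m \<in> mons lam (Suc n) j k'"
    for j m k'
    using that(2-4)
  proof (induction j arbitrary: m rule: less_induct)
    case (less j m)
    have mp: "m \<in> mons lam (Suc n) p k'" using mons_mono[of "Suc n" "Suc n" p j lam k'] less.prems by auto
    have cell_lt: "xy (Suc n) j * (xy a b * m2) \<in> G"
      if "(a, b) \<in> shape lam (Suc n) p" "b < j" "m2 \<in> mons lam (Suc n) j k''" "k' = Suc k''" for a b m2 k''
    proof -
      have "lam (Suc n) \<le> lam a" using ninc[of a] that(1) by (cases "a = Suc n") (auto simp: shape_def)
      then have "(a, j) \<in> shape lam (Suc n) b" using that less.prems by (auto simp: shape_def)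
      moreover have "m2 \<in> mons lam (Suc n) b k''"
        using mons_mono[of "Suc n" "Suc n" b j lam k''] that by auto
      ultimately have "xy a j * m2 \<in> mons lam (Suc n) b (Suc k'')" by (rule mons_SucI)
      then have "xy (Suc n) b * (xy a j * m2) \<in> G"
        using less.IH[of b "xy a j * m2"] that less.prems by (auto simp: shape_def)
      then show ?thesis using xy_exchange[of "Suc n" j a b] by (metis mult.assoc)
    qed
    have double: "xy (Suc n) j * (xy (Suc n) j' * m') \<in> G"
      if "j \<le> j'" "j' \<le> lam (Suc n)" "m' \<in> mons lam (Suc n) j k''" "k' = Suc k''" for j' m' k''
    proof -
      define d where "d = int j - int (Suc n)"
      have jj: "(Suc n, j) \<in> diag_cells lam (Suc n) p d"
        using less.prems by (auto simp: diag_cells_def shape_def d_def)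
      have D: "diag lam (Suc n) p d = xy (Suc n) j + (\<Sum>(a, b)\<in>diag_cells lam (Suc n) p d - {(Suc n, j)}. xy a b)"
        unfolding diag_def using sum.remove[OF finite_diag_cells jj, of "\<lambda>(a, b). xy a b"] by simp
      have "xy (Suc n) j * (xy (Suc n) j' * m') = diag lam (Suc n) p d * (xy (Suc n) j' * m')
          - (\<Sum>(a, b)\<in>diag_cells lam (Suc n) p d - {(Suc n, j)}. xy a b) * (xy (Suc n) j' * m')"
        unfolding D by (simp add: algebra_simps)
      moreover have "diag lam (Suc n) p d * (xy (Suc n) j' * m') \<in> G"
      proof (rule dg[OF k])
        have "m' \<in> mons lam (Suc n) p k''"
          using mons_mono[of "Suc n" "Suc n" p j lam k''] that less.prems by auto
        then show "xy (Suc n) j' * m' \<in> mons lam (Suc n) p k'"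
          unfolding that(4) using that less.prems by (intro mons_SucI) (auto simp: shape_def)
      qed
      moreover have "(\<Sum>(a, b)\<in>diag_cells lam (Suc n) p d - {(Suc n, j)}. xy a b) * (xy (Suc n) j' * m') \<in> G"
      proof (rule sum)
        fix a b assume ab: "(a, b) \<in> diag_cells lam (Suc n) p d - {(Suc n, j)}"
        then have sh: "(a, b) \<in> shape lam (Suc n) p" and bj: "b < j"
          by (auto simp: diag_cells_def shape_def d_def)
        have "lam (Suc n) \<le> lam a" using ninc[of a] sh by (cases "a = Suc n") (auto simp: shape_def)
        then have "(a, j') \<in> shape lam (Suc n) b" using sh that bj by (auto simp: shape_def)
        moreover have "m' \<in> mons lam (Suc n) b k''"
          using mons_mono[of "Suc n" "Suc n" b j lam k''] that bj by auto
        ultimately have "xy a j' * m' \<in> mons lam (Suc n) b (Suc k'')" by (rule mons_SucI)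
        then have "xy (Suc n) b * (xy a j' * m') \<in> G"
          using less.IH[of b "xy a j' * m'"] that bj sh less.prems by (auto simp: shape_def)
        then show "xy a b * (xy (Suc n) j' * m') \<in> G"
          using xy_exchange[of a b "Suc n" j'] by (metis mult.assoc mult.commute)
      qed
      ultimately show ?thesis using diff by simp
    qed
    consider "m \<in> mons lam n j k'" | j' k'' m' where "k' = Suc k''" "j \<le> j'" "j' \<le> lam (Suc n)"
        "m' \<in> mons lam (Suc n) j' k''" "m = xy (Suc n) j' * m'"
      using mons_last_row_cases[OF less.prems(3) ninc] by blast
    then show ?case
    proof cases
      case 2
      then have "m' \<in> mons lam (Suc n) j k''" using mons_mono[of "Suc n" "Suc n" j j' lam k''] by auto
      with 2 double show ?thesis by blast
    next
      case 1
      have single_cell: "(xy (Suc n) j' :: 'k mpoly) = diag lam (Suc n) p (int j' - int (Suc n))"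
        if "j' = p \<or> n = 0" "p \<le> j'" "j' \<le> lam (Suc n)" for j'
      proof -
        have "diag_cells lam (Suc n) p (int j' - int (Suc n)) = {(Suc n, j')}"
          using that by (auto simp: diag_cells_def shape_def)
        then show ?thesis by (simp add: diag_def)
      qed
      show ?thesis
      proof (cases "n = 0")
        case True
        then have "xy (Suc n) j = (diag lam (Suc n) p (int j - int (Suc n)) :: 'k mpoly)"
          using single_cell[of j] less.prems by blast
        then show ?thesis using dg[OF k mp] by metis
      next
        case False
        define G' where "G' = {f. xy (Suc n) j * f \<in> G}"
        have "mons lam n j k' \<subseteq> G'"
        proof (rule Suc.IH)
          show "\<And>i j. \<lbrakk>1 \<le> i; i \<le> j; j \<le> n\<rbrakk> \<Longrightarrow> lam j \<le> lam i" using noninc by auto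
          show "0 \<in> G'" using zero by (simp add: G'_def)
          show "\<And>a b. \<lbrakk>a \<in> G'; b \<in> G'\<rbrakk> \<Longrightarrow> a - b \<in> G'" using diff by (simp add: G'_def right_diff_distrib)
          show "strict_mons lam n j k' \<subseteq> G'"
          proof
            fix b :: "'k mpoly" assume b: "b \<in> strict_mons lam n j k'"
            show "b \<in> G'"
            proof (cases "j = p")
              case True
              have "b \<in> mons lam (Suc n) p k'"
                using b strict_mons_subset[of lam n j k'] mons_mono[of n "Suc n" p j lam k'] True by auto
              then have "diag lam (Suc n) p (int j - int (Suc n)) * b \<in> G" by (rule dg[OF k])
              moreover have "xy (Suc n) j = (diag lam (Suc n) p (int j - int (Suc n)) :: 'k mpoly)"
                using single_cell[of j] True less.prems by blast
              ultimately show ?thesis by (simp add: G'_def)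
            next
              case neq: False
              then have "xy (Suc n) j * b \<in> strict_mons lam (Suc n) p k"
                using k False b less.prems by auto
              then show ?thesis using ch by (auto simp: G'_def)
            qed
          qed
        next
          fix d k'' and m2 :: "'k mpoly" assume k'': "k' = Suc k''" and m2: "m2 \<in> mons lam n j k''"
          have m2': "m2 \<in> mons lam (Suc n) j k''" using m2 mons_mono[of n "Suc n" j j lam k''] by auto
          have sub: "diag_cells lam n j d \<subseteq> diag_cells lam (Suc n) p d"
            using less.prems by (auto simp: diag_cells_def shape_def)
          have D: "diag lam (Suc n) p d = diag lam n j d
              + (\<Sum>(a, b)\<in>diag_cells lam (Suc n) p d - diag_cells lam n j d. xy a b)"
            unfolding diag_def using sum.subset_diff[OF sub finite_diag_cells] by (simp add: add.commute)
          have "xy (Suc n) j * (diag lam n j d * m2) = diag lam (Suc n) p d * (xy (Suc n) j * m2)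
             - (\<Sum>(a, b)\<in>diag_cells lam (Suc n) p d - diag_cells lam n j d. xy a b) * (xy (Suc n) j * m2)"
            unfolding D by (simp add: algebra_simps)
          moreover have "diag lam (Suc n) p d * (xy (Suc n) j * m2) \<in> G"
          proof (rule dg[OF k])
            have "m2 \<in> mons lam (Suc n) p k''"
              using mons_mono[of "Suc n" "Suc n" p j lam k''] m2' less.prems by auto
            then show "xy (Suc n) j * m2 \<in> mons lam (Suc n) p k'"
              unfolding k'' using less.prems by (intro mons_SucI) (auto simp: shape_def)
          qed
          moreover have "(\<Sum>(a, b)\<in>diag_cells lam (Suc n) p d - diag_cells lam n j d. xy a b) * (xy (Suc n) j * m2) \<in> G"
          proof (rule sum)
            fix a b assume ab: "(a, b) \<in> diag_cells lam (Suc n) p d - diag_cells lam n j d"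
            then have sh: "(a, b) \<in> shape lam (Suc n) p" by (auto simp: diag_cells_def)
            have "xy (Suc n) j * (xy a b * m2) \<in> G"
            proof (cases "b < j")
              case True
              with cell_lt sh m2' k'' show ?thesis by blast
            next
              case False
              then have "a = Suc n" using ab by (auto simp: diag_cells_def shape_def)
              then show ?thesis using double[of b m2 k''] False sh m2' k'' by (auto simp: shape_def)
            qed
            then show "xy a b * (xy (Suc n) j * m2) \<in> G" by (simp add: mult.left_commute)
          qed
          ultimately show "diag lam n j d * m2 \<in> G'" unfolding G'_def using diff by simp
        qed
        with 1 show ?thesis by (auto simp: G'_def)
      qed
    qed
  qed
  have "mons lam n p k \<subseteq> G"
  proof (rule Suc.IH)
    show "\<And>i j. \<lbrakk>1 \<le> i; i \<le> j; j \<le> n\<rbrakk> \<Longrightarrow> lam j \<le> lam i" using noninc by auto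
    show "strict_mons lam n p k \<subseteq> G" using ch by auto
    show "0 \<in> G" by (rule zero)
    show "\<And>a b. \<lbrakk>a \<in> G; b \<in> G\<rbrakk> \<Longrightarrow> a - b \<in> G" by (rule diff)
  next
    fix d k' and m2 :: "'k mpoly" assume k': "k = Suc k'" and m2: "m2 \<in> mons lam n p k'"
    have m2': "m2 \<in> mons lam (Suc n) p k'" using m2 mons_mono[of n "Suc n" p p lam k'] by auto
    have sub: "diag_cells lam n p d \<subseteq> diag_cells lam (Suc n) p d"
      by (auto simp: diag_cells_def shape_def)
    have D: "diag lam (Suc n) p d = diag lam n p d
        + (\<Sum>(a, b)\<in>diag_cells lam (Suc n) p d - diag_cells lam n p d. xy a b)"
      unfolding diag_def using sum.subset_diff[OF sub finite_diag_cells] by (simp add: add.commute)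
    have "diag lam n p d * m2 = diag lam (Suc n) p d * m2
       - (\<Sum>(a, b)\<in>diag_cells lam (Suc n) p d - diag_cells lam n p d. xy a b) * m2"
      unfolding D by (simp add: algebra_simps)
    moreover have "(\<Sum>(a, b)\<in>diag_cells lam (Suc n) p d - diag_cells lam n p d. xy a b) * m2 \<in> G"
    proof (rule sum)
      fix a b assume ab: "(a, b) \<in> diag_cells lam (Suc n) p d - diag_cells lam n p d"
      then have a: "a = Suc n" by (auto simp: diag_cells_def shape_def)
      with ab have b: "p \<le> b" "b \<le> lam (Suc n)" by (auto simp: diag_cells_def shape_def)
      obtain j' m' where "p \<le> j'" "j' \<le> b" "m' \<in> mons lam (Suc n) j' k'"
          "xy (Suc n) b * m2 = xy (Suc n) j' * m'"
        using mons_pair_last_row[OF m2' b ninc] by blast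
      then show "xy a b * m2 \<in> G" using last[OF k', of j' m'] a b by simp
    qed
    ultimately show "diag lam n p d * m2 \<in> G" using diff[OF dg[OF k' m2']] by simp
  qed
  moreover have "m \<in> G" if m: "m \<in> mons lam (Suc n) p k" "m \<notin> mons lam n p k" for m :: "'k mpoly"
  proof -
    obtain j k' m' where "k = Suc k'" "p \<le> j" "j \<le> lam (Suc n)" "m' \<in> mons lam (Suc n) j k'"
        "m = xy (Suc n) j * m'"
      using mons_last_row_cases[OF m(1) ninc] m(2) by blast
    then show ?thesis using last[of k' j m'] by simp
  qed
  ultimately show ?case by blast
qed

section \<open>Hilbert series\<close>

abbreviation "lookup \<equiv> Poly_Mapping.lookup"
abbreviation "keys \<equiv> Poly_Mapping.keys"

fun strict_num :: "(nat \<Rightarrow> nat) \<Rightarrow> nat \<Rightarrow> nat \<Rightarrow> nat \<Rightarrow> nat" where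
  "strict_num lam 0 p k = (if k = 0 then 1 else 0)"
| "strict_num lam (Suc n) p k = strict_num lam n p k +
     (if n = 0 \<or> k = 0 then 0 else \<Sum>j \<in> {p<..lam (Suc n)}. strict_num lam n j (k - 1))"

fun mon_num :: "(nat \<Rightarrow> nat) \<Rightarrow> nat \<Rightarrow> nat \<Rightarrow> nat \<Rightarrow> nat" where
  "mon_num lam 0 p k = (if k = 0 then 1 else 0)"
| "mon_num lam (Suc n) p 0 = 1"
| "mon_num lam (Suc n) p (Suc k) = mon_num lam n p (Suc k) +
     (\<Sum>j \<in> {p..lam (Suc n)}. mon_num lam (Suc n) j k)"

fun multiset_num :: "nat \<Rightarrow> nat \<Rightarrow> nat" where
  "multiset_num 0 k = (if k = 0 then 1 else 0)"
| "multiset_num (Suc l) 0 = 1"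
| "multiset_num (Suc l) (Suc k) = multiset_num (Suc l) k + multiset_num l (Suc k)"

lemma multiset_num_0 [simp]: "multiset_num l 0 = 1"
  by (cases l) auto

lemma mon_num_0 [simp]: "mon_num lam n p 0 = 1"
  by (cases n) auto

lemma strict_num_0 [simp]: "strict_num lam n p 0 = 1"
  by (induction n) auto

lemma card_strict_mons_le: "card (strict_mons lam n p k :: 'k::comm_ring_1 mpoly set) \<le> strict_num lam n p k"
proof (induction n arbitrary: p k)
  case (Suc n)
  have "card (\<Union>j \<in> {p<..lam (Suc n)}. (*) (xy (Suc n) j) ` (strict_mons lam n j (k - 1) :: 'k mpoly set))
     \<le> (\<Sum>j \<in> {p<..lam (Suc n)}. card ((*) (xy (Suc n) j) ` (strict_mons lam n j (k - 1) :: 'k mpoly set)))"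
    by (rule card_UN_le) simp
  also have "\<dots> \<le> (\<Sum>j \<in> {p<..lam (Suc n)}. strict_num lam n j (k - 1))"
    by (rule sum_mono, rule order_trans[OF card_image_le Suc.IH]) (rule finite_strict_mons)
  finally have *: "card (\<Union>j \<in> {p<..lam (Suc n)}. (*) (xy (Suc n) j) ` (strict_mons lam n j (k - 1) :: 'k mpoly set))
     \<le> (\<Sum>j \<in> {p<..lam (Suc n)}. strict_num lam n j (k - 1))" .
  show ?case
    using Suc.IH[of p k] * card_Un_le[of "strict_mons lam n p k :: 'k mpoly set"
        "\<Union>j \<in> {p<..lam (Suc n)}. (*) (xy (Suc n) j) ` strict_mons lam n j (k - 1)"]
    by (cases "n = 0 \<or> k = 0") (auto simp del: strict_num.simps(1) strict_mons.simps(1))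
qed auto

lemma mons_single:
  assumes "m \<in> mons lam n p k"
  shows "\<exists>u. m = Poly_Mapping.single u 1 \<and> (\<forall>i>n. lookup u (X i) = 0) \<and> (\<forall>j<p. lookup u (Y j) = 0)"
  using assms
proof (induction k arbitrary: m)
  case 0
  then show ?case by (intro exI[of _ 0]) auto
next
  case (Suc k)
  then obtain i j m' where m: "(i, j) \<in> shape lam n p" "m' \<in> mons lam n p k" "m = xy i j * m'"
    by (elim mons_SucE)
  obtain u where "m' = Poly_Mapping.single u 1" "\<forall>i>n. lookup u (X i) = 0" "\<forall>j<p. lookup u (Y j) = 0"
    using Suc.IH[OF m(2)] by blast
  then show ?case using m
    by (intro exI[of _ "Poly_Mapping.single (X i) 1 + Poly_Mapping.single (Y j) 1 + u"])
       (auto simp: xy_def mult_single lookup_add lookup_single shape_def when_def)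
qed

lemma lookup_single_one_mult: "lookup (Poly_Mapping.single u 1 * h) (u + v) = lookup h v"
  for h :: "('k::comm_ring_1) mpoly"
proof -
  have "lookup (Poly_Mapping.single u 1 * h) (u + v)
      = (\<Sum>l. (1 when u = l) * (\<Sum>q. lookup h q when u + v = l + q))"
    by (simp only: lookup_mult lookup_single)
  also have "\<dots> = (\<Sum>l. (\<Sum>q. lookup h q when u + v = u + q) when l = u)"
    by (rule Sum_any.cong) (auto simp: when_def)
  also have "\<dots> = lookup h v" by simp
  finally show ?thesis .
qed

lemma single_one_mult_cancel:
  fixes f g :: "('k::comm_ring_1) mpoly"
  assumes "Poly_Mapping.single u 1 * f = Poly_Mapping.single u 1 * g"
  shows "f = g"
  by (rule poly_mapping_eqI) (metis assms lookup_single_one_mult)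

lemma xy_mult_cancel: "xy i j * f = xy i j * g \<Longrightarrow> f = (g :: ('k::comm_ring_1) mpoly)"
  unfolding xy_def by (rule single_one_mult_cancel)

lemma card_mons_ge: "mon_num lam n p k \<le> card (mons lam n p k :: 'k::field mpoly set)"
proof (induction lam n p k rule: mon_num.induct)
  case (3 lam n p k)
  define S where "S j = (*) (xy (Suc n) j) ` (mons lam (Suc n) j k :: 'k mpoly set)" for j
  have exps: "\<exists>u. m = Poly_Mapping.single u 1 \<and> lookup u (X (Suc n)) \<noteq> 0 \<and> lookup u (Y j) \<noteq> 0
      \<and> (\<forall>j'<j. lookup u (Y j') = 0)" if mS: "m \<in> S j" for m :: "'k mpoly" and j
  proof -
    obtain m' where "m' \<in> mons lam (Suc n) j k" "m = xy (Suc n) j * m'" using mS by (auto simp: S_def)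
    moreover obtain u where "m' = Poly_Mapping.single u 1" "\<forall>j'<j. lookup u (Y j') = 0"
      using mons_single[OF calculation(1)] by blast
    ultimately show ?thesis
      by (intro exI[of _ "Poly_Mapping.single (X (Suc n)) 1 + Poly_Mapping.single (Y j) 1 + u"])
         (auto simp: xy_def mult_single lookup_add lookup_single when_def)
  qed
  have disj: "S i \<inter> S j = {}" if "i < j" for i j
  proof (rule ccontr)
    assume "S i \<inter> S j \<noteq> {}"
    then obtain m where m: "m \<in> S i" "m \<in> S j" by blast
    obtain u where u: "m = Poly_Mapping.single u 1" "lookup u (Y i) \<noteq> 0" using exps[OF m(1)] by blast
    obtain v where v: "m = Poly_Mapping.single v 1" "\<forall>j'<j. lookup v (Y j') = 0" using exps[OF m(2)] by blast
    have "u = v" using u(1) v(1) by (metis lookup_single_eq lookup_single_not_eq zero_neq_one)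
    with u v that show False by auto
  qed
  then have disj': "S i \<inter> S j = {}" if "i \<noteq> j" for i j
    using that by (metis Int_commute linorder_neqE_nat)
  have disj0: "mons lam n p (Suc k) \<inter> S j = {}" for j
  proof (rule ccontr)
    assume "mons lam n p (Suc k) \<inter> S j \<noteq> {}"
    then obtain m where m: "m \<in> mons lam n p (Suc k)" "m \<in> S j" by blast
    obtain u where u: "m = Poly_Mapping.single u 1" "\<forall>i>n. lookup u (X i) = 0"
      using mons_single[OF m(1)] by blast
    obtain v where v: "m = Poly_Mapping.single v 1" "lookup v (X (Suc n)) \<noteq> 0" using exps[OF m(2)] by blast
    have "u = v" using u(1) v(1) by (metis lookup_single_eq lookup_single_not_eq zero_neq_one)
    with u v show False by auto
  qed
  have sub: "mons lam n p (Suc k) \<union> (\<Union>j\<in>{p..lam (Suc n)}. S j) \<subseteq> mons lam (Suc n) p (Suc k)"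
  proof -
    have "xy (Suc n) j * m \<in> mons lam (Suc n) p (Suc k)"
      if "p \<le> j" "j \<le> lam (Suc n)" "m \<in> mons lam (Suc n) j k" for j and m :: "'k mpoly"
      using that mons_monoD[OF that(3), of "Suc n" p] by (intro mons_SucI) (auto simp: shape_def)
    then show ?thesis using mons_mono[of n "Suc n" p p lam "Suc k"] by (auto simp: S_def simp del: mons.simps)
  qed
  have finS: "finite (S j)" for j by (simp add: S_def finite_mons)
  have "mon_num lam (Suc n) p (Suc k) \<le> card (mons lam n p (Suc k) :: 'k mpoly set) + (\<Sum>j\<in>{p..lam (Suc n)}. card (S j))"
  proof -
    have "card (S j) = card (mons lam (Suc n) j k :: 'k mpoly set)" for j
      unfolding S_def by (rule card_image) (auto intro: inj_onI dest: xy_mult_cancel)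
    then show ?thesis using 3 by (auto intro!: add_mono sum_mono simp del: mons.simps)
  qed
  also have "(\<Sum>j\<in>{p..lam (Suc n)}. card (S j)) = card (\<Union>j\<in>{p..lam (Suc n)}. S j)"
    by (rule card_UN_disjoint[symmetric]) (use finS disj' in auto)
  also have "card (mons lam n p (Suc k) :: 'k mpoly set) + \<dots> = card (mons lam n p (Suc k) \<union> (\<Union>j\<in>{p..lam (Suc n)}. S j))"
    by (rule card_Un_disjoint[symmetric], rule finite_mons) (use finS disj0 in \<open>simp_all add: Int_UN_distrib del: mons.simps\<close>)
  also have "\<dots> \<le> card (mons lam (Suc n) p (Suc k) :: 'k mpoly set)"
    by (rule card_mono[OF finite_mons sub])
  finally show ?case .
qed (auto simp: mons_row0)

abbreviation (input) strict_fps :: "(nat \<Rightarrow> nat) \<Rightarrow> nat \<Rightarrow> nat \<Rightarrow> int fps" where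
  "strict_fps lam n p \<equiv> Abs_fps (\<lambda>k. int (strict_num lam n p k))"

abbreviation (input) mon_fps :: "(nat \<Rightarrow> nat) \<Rightarrow> nat \<Rightarrow> nat \<Rightarrow> int fps" where
  "mon_fps lam n p \<equiv> Abs_fps (\<lambda>k. int (mon_num lam n p k))"

abbreviation (input) multiset_fps :: "nat \<Rightarrow> int fps" where
  "multiset_fps l \<equiv> Abs_fps (\<lambda>k. int (multiset_num l k))"

lemma fps_eq_plus_X_mult:
  fixes F G H :: "int fps"
  assumes "fps_nth F 0 = fps_nth G 0" "\<And>k. fps_nth F (Suc k) = fps_nth G (Suc k) + fps_nth H k"
  shows "F = G + fps_X * H"
proof (rule fps_ext)
  fix k show "fps_nth F k = fps_nth (G + fps_X * H) k"
    using assms by (cases k) auto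
qed

lemma multiset_fps_inverse: "multiset_fps l * (1 - fps_X) ^ l = 1"
proof (induction l)
  case 0
  show ?case by (rule fps_ext) auto
next
  case (Suc l)
  have "multiset_fps (Suc l) = multiset_fps l + fps_X * multiset_fps (Suc l)"
    by (rule fps_eq_plus_X_mult) auto
  then have "multiset_fps (Suc l) * (1 - fps_X) = multiset_fps l" by (simp add: algebra_simps)
  then show ?case using Suc by (metis mult.assoc power_Suc)
qed

lemma mon_fps_rec:
  assumes "p \<le> lam (Suc n)"
  shows "mon_fps lam (Suc n) p * (1 - fps_X) = mon_fps lam (Suc n) (Suc p) + mon_fps lam n p - mon_fps lam n (Suc p)"
proof -
  have "{p..lam (Suc n)} = insert p {Suc p..lam (Suc n)}" using assms by auto
  then have "mon_fps lam (Suc n) p = (mon_fps lam (Suc n) (Suc p) + mon_fps lam n p - mon_fps lam n (Suc p))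
      + fps_X * mon_fps lam (Suc n) p"
    by (intro fps_eq_plus_X_mult) auto
  then show ?thesis by (simp add: algebra_simps)
qed

lemma strict_fps_rec:
  assumes "Suc p \<le> lam (Suc n)" "n \<noteq> 0"
  shows "strict_fps lam (Suc n) p = strict_fps lam (Suc n) (Suc p) + strict_fps lam n p
     - strict_fps lam n (Suc p) * (1 - fps_X)"
proof -
  have "{p<..lam (Suc n)} = insert (Suc p) {Suc p<..lam (Suc n)}" using assms by auto
  then have "strict_fps lam (Suc n) p = (strict_fps lam (Suc n) (Suc p) + strict_fps lam n p
     - strict_fps lam n (Suc p)) + fps_X * strict_fps lam n (Suc p)"
    using assms by (intro fps_eq_plus_X_mult) auto
  then show ?thesis by (simp add: algebra_simps)
qed

lemma mon_fps_eq_strict_fps: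
  assumes "1 \<le> n" "p \<le> lam n" "\<And>i j. 1 \<le> i \<Longrightarrow> i \<le> j \<Longrightarrow> j \<le> n \<Longrightarrow> lam j \<le> lam i"
  shows "mon_fps lam n p * (1 - fps_X) ^ (n + lam 1 - p) = strict_fps lam n p"
  using assms
proof (induction n arbitrary: p)
  case (Suc n)
  note IHn = Suc.IH and noninc = Suc.prems(3)
  show ?case using Suc.prems(2)
  proof (induction "lam (Suc n) - p" arbitrary: p)
    case 0
    then have p: "p = lam (Suc n)" by simp
    have "mon_fps lam (Suc n) (Suc p) = mon_fps lam n (Suc p)"
      by (rule fps_ext, rename_tac k, case_tac k) (auto simp: p)
    then have 1: "mon_fps lam (Suc n) p * (1 - fps_X) = mon_fps lam n p" using mon_fps_rec[of p lam n] p by simp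
    show ?case
    proof (cases "n = 0")
      case True
      then show ?thesis using 1 p by (auto intro!: fps_ext)
    next
      case False
      have "p \<le> lam n" "p \<le> lam 1" using Suc.prems(3)[of n "Suc n"] Suc.prems(3)[of 1 "Suc n"] False p by auto
      then have "mon_fps lam n p * (1 - fps_X) ^ (n + lam 1 - p) = strict_fps lam n p"
        using Suc.IH[of p] Suc.prems False by auto
      moreover have "strict_fps lam (Suc n) p = strict_fps lam n p" by (rule fps_ext) (auto simp: p)
      moreover have "Suc n + lam 1 - p = Suc (n + lam 1 - p)" using \<open>p \<le> lam 1\<close> by simp
      ultimately show ?thesis using 1 by (simp add: mult.assoc[symmetric])
    qed
  next
    case (Suc x)
    have p: "Suc p \<le> lam (Suc n)" using Suc.hyps(2) by auto
    have lam1: "lam (Suc n) \<le> lam 1" using noninc[of 1 "Suc n"] by auto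
    have IH: "mon_fps lam (Suc n) (Suc p) * (1 - fps_X) ^ (Suc n + lam 1 - Suc p) = strict_fps lam (Suc n) (Suc p)"
      using Suc.hyps(1)[of "Suc p"] Suc.hyps(2) p by auto
    define e where "e = n + lam 1 - Suc p"
    have e: "Suc n + lam 1 - p = Suc (Suc e)" "Suc n + lam 1 - Suc p = Suc e" using p lam1 by (auto simp: e_def)
    have split: "mon_fps lam (Suc n) p * (1 - fps_X) ^ Suc (Suc e) =
      mon_fps lam (Suc n) (Suc p) * (1 - fps_X) ^ Suc e + mon_fps lam n p * (1 - fps_X) ^ Suc e
      - mon_fps lam n (Suc p) * (1 - fps_X) ^ e * (1 - fps_X)"
    proof -
      have "mon_fps lam (Suc n) p * (1 - fps_X) ^ Suc (Suc e) = (mon_fps lam (Suc n) p * (1 - fps_X)) * (1 - fps_X) ^ Suc e"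
        by (simp add: ac_simps)
      also have "\<dots> = (mon_fps lam (Suc n) (Suc p) + mon_fps lam n p - mon_fps lam n (Suc p)) * (1 - fps_X) ^ Suc e"
        using p by (subst mon_fps_rec) auto
      finally show ?thesis by (simp add: algebra_simps)
    qed
    show ?case
    proof (cases "n = 0")
      case True
      have 1: "mon_fps lam n p = 1" "mon_fps lam n (Suc p) = 1" "strict_fps lam (Suc n) p = 1"
        "strict_fps lam (Suc n) (Suc p) = 1" using True by (auto intro!: fps_ext)
      show ?thesis unfolding e(1) split IH[unfolded e(2)] 1 by simp
    next
      case False
      have le: "lam (Suc n) \<le> lam n" using noninc[of n "Suc n"] False by auto
      have "mon_fps lam n p * (1 - fps_X) ^ (n + lam 1 - p) = strict_fps lam n p"
        "mon_fps lam n (Suc p) * (1 - fps_X) ^ (n + lam 1 - Suc p) = strict_fps lam n (Suc p)"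
        using IHn[of p] IHn[of "Suc p"] noninc le p False by auto
      moreover have "n + lam 1 - p = Suc e" using p lam1 by (auto simp: e_def)
      ultimately show ?thesis using split IH e strict_fps_rec[of p lam n] p False by (simp add: e_def)
    qed
  qed
qed auto

lemma mon_num_eq:
  assumes "1 \<le> n" "p \<le> lam n" "\<And>i j. 1 \<le> i \<Longrightarrow> i \<le> j \<Longrightarrow> j \<le> n \<Longrightarrow> lam j \<le> lam i"
  shows "mon_num lam n p k = (\<Sum>i=0..k. strict_num lam n p i * multiset_num (n + lam 1 - p) (k - i))"
proof -
  let ?e = "n + lam 1 - p"
  have "mon_fps lam n p = mon_fps lam n p * (multiset_fps ?e * (1 - fps_X) ^ ?e)"
    by (simp add: multiset_fps_inverse)
  also have "\<dots> = (mon_fps lam n p * (1 - fps_X) ^ ?e) * multiset_fps ?e"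
    by (simp only: ac_simps)
  also have "mon_fps lam n p * (1 - fps_X) ^ ?e = strict_fps lam n p"
    by (rule mon_fps_eq_strict_fps) (use assms in auto)
  finally have "fps_nth (mon_fps lam n p) k = fps_nth (strict_fps lam n p * multiset_fps ?e) k" by simp
  then have "int (mon_num lam n p k) = int (\<Sum>i=0..k. strict_num lam n p i * multiset_num ?e (k - i))"
    by (simp add: fps_mult_nth)
  then show ?thesis by linarith
qed

lemma strict_num_pos_iff:
  assumes "1 \<le> n" "\<And>i j. 1 \<le> i \<Longrightarrow> i \<le> j \<Longrightarrow> j \<le> n \<Longrightarrow> lam j \<le> lam i"
  shows "strict_num lam n p k > 0 \<longleftrightarrow> k < n \<and> (\<forall>i. 2 \<le> i \<and> i \<le> n \<longrightarrow> k + 3 \<le> i + max 1 (lam i + 1 - p))"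
  using assms
proof (induction n arbitrary: p k rule: dec_induct)
  case base
  then show ?case by auto
next
  case (step n p k)
  have IH: "strict_num lam n p k > 0 \<longleftrightarrow> k < n \<and> (\<forall>i. 2 \<le> i \<and> i \<le> n \<longrightarrow> k + 3 \<le> i + max 1 (lam i + 1 - p))"
    for p k using step.IH step.prems by auto
  have le: "lam (Suc n) \<le> lam i" if "1 \<le> i" "i \<le> n" for i using step.prems that by auto
  have "strict_num lam (Suc n) p k > 0 \<longleftrightarrow> strict_num lam n p k > 0 \<or> (k \<noteq> 0 \<and> (\<exists>j\<in>{p<..lam (Suc n)}. strict_num lam n j (k - 1) > 0))"
    using step.hyps by auto
  also have "(\<exists>j\<in>{p<..lam (Suc n)}. strict_num lam n j (k - 1) > 0) \<longleftrightarrow> p < lam (Suc n) \<and> strict_num lam n (Suc p) (k - 1) > 0"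
  proof
    assume "\<exists>j\<in>{p<..lam (Suc n)}. strict_num lam n j (k - 1) > 0"
    then obtain j where j: "p < j" "j \<le> lam (Suc n)" "strict_num lam n j (k - 1) > 0" by auto
    have "k - 1 + 3 \<le> i + max 1 (lam i + 1 - Suc p)" if "2 \<le> i" "i \<le> n" for i
    proof -
      have "k - 1 + 3 \<le> i + max 1 (lam i + 1 - j)" using j(3) that unfolding IH by auto
      also have "\<dots> \<le> i + max 1 (lam i + 1 - Suc p)" using j by auto
      finally show ?thesis .
    qed
    then show "p < lam (Suc n) \<and> strict_num lam n (Suc p) (k - 1) > 0" using j unfolding IH by auto
  qed auto
  also have "strict_num lam n p k > 0 \<or> (k \<noteq> 0 \<and> p < lam (Suc n) \<and> strict_num lam n (Suc p) (k - 1) > 0)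
     \<longleftrightarrow> k < Suc n \<and> (\<forall>i. 2 \<le> i \<and> i \<le> Suc n \<longrightarrow> k + 3 \<le> i + max 1 (lam i + 1 - p))"
    (is "?L \<longleftrightarrow> ?R")
  proof (cases "p < lam (Suc n)")
    case True
    have eq: "max 1 (lam i + 1 - p) = Suc (max 1 (lam i + 1 - Suc p))" if "1 \<le> i" "i \<le> n" for i
      using le[OF that] True by auto
    show ?thesis
    proof
      assume ?L
      then show ?R
      proof
        assume "strict_num lam n p k > 0"
        then have *: "k < n" "\<And>i. 2 \<le> i \<Longrightarrow> i \<le> n \<Longrightarrow> k + 3 \<le> i + max 1 (lam i + 1 - p)" unfolding IH by auto
        then show ?R using True by (auto simp: le_Suc_eq)
      next
        assume "k \<noteq> 0 \<and> p < lam (Suc n) \<and> strict_num lam n (Suc p) (k - 1) > 0"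
        then have *: "k \<noteq> 0" "k - 1 < n" "\<And>i. 2 \<le> i \<Longrightarrow> i \<le> n \<Longrightarrow> k - 1 + 3 \<le> i + max 1 (lam i + 1 - Suc p)"
          unfolding IH by auto
        have "k + 3 \<le> i + max 1 (lam i + 1 - p)" if "2 \<le> i" "i \<le> Suc n" for i
        proof (cases "i = Suc n")
          case True
          then show ?thesis using * \<open>p < lam (Suc n)\<close> by auto
        next
          case False
          then show ?thesis using *(1) *(3)[of i] eq[of i] that by linarith
        qed
        then show ?R using * by auto
      qed
    next
      assume R: ?R
      show ?L
      proof (cases "k = 0")
        case True
        then show ?thesis by simp
      next
        case False
        have "k - 1 + 3 \<le> i + max 1 (lam i + 1 - Suc p)" if "2 \<le> i" "i \<le> n" for i
        proof -
          have "k + 3 \<le> i + max 1 (lam i + 1 - p)" using R that by auto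
          then show ?thesis using eq[of i] that False by linarith
        qed
        then show ?thesis using R False True unfolding IH by auto
      qed
    qed
  next
    case False
    then have "k + 3 \<le> Suc n + max 1 (lam (Suc n) + 1 - p) \<longleftrightarrow> k < n" by auto
    moreover have "(\<forall>i. 2 \<le> i \<and> i \<le> Suc n \<longrightarrow> P i) \<longleftrightarrow> P (Suc n) \<and> (\<forall>i. 2 \<le> i \<and> i \<le> n \<longrightarrow> P i)" for P
    proof (intro iffI conjI allI impI)
      assume *: "\<forall>i. 2 \<le> i \<and> i \<le> Suc n \<longrightarrow> P i"
      from *[rule_format, of "Suc n"] show "P (Suc n)" using step.hyps by simp
      from * show "2 \<le> i \<and> i \<le> n \<Longrightarrow> P i" for i by simp
    qed (auto simp: le_Suc_eq)
    ultimately show ?thesis using False unfolding IH by auto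
  qed
  finally show ?case .
qed

section \<open>Generic rank\<close>

text \<open>Fraction-free Gaussian elimination: \<open>E\<close>, \<open>D\<close> and \<open>G\<close> prescribe the entries on, below and above
  the diagonal. Pivots multiply instead of dividing, so the degree \<open>N\<close> doubles at every step.\<close>

lemma triangular_quasi_inverse:
  fixes A :: "nat \<Rightarrow> nat \<Rightarrow> 'a::comm_ring_1" and E D G :: "nat \<Rightarrow> 'a set"
  assumes "e0 \<in> E N0"
    and EE: "\<And>e f M N. e \<in> E M \<Longrightarrow> f \<in> E N \<Longrightarrow> e * f \<in> E (M + N)"
    and diagE: "\<And>e f g d N. e \<in> E N \<Longrightarrow> f \<in> E N \<Longrightarrow> g \<in> G N \<Longrightarrow> d \<in> D N \<Longrightarrow> e * f - g * d \<in> E (N + N)"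
    and lowD: "\<And>e f g d N. e \<in> E N \<Longrightarrow> f \<in> D N \<Longrightarrow> g \<in> G N \<Longrightarrow> d \<in> D N \<Longrightarrow> e * f - g * d \<in> D (N + N)"
    and upG: "\<And>e f g d N. e \<in> E N \<Longrightarrow> f \<in> G N \<Longrightarrow> g \<in> G N \<Longrightarrow> d \<in> D N \<Longrightarrow> e * f - g * d \<in> G (N + N)"
    and C: "0 \<in> C" "\<And>a b. a \<in> C \<Longrightarrow> b \<in> C \<Longrightarrow> a - b \<in> C" "\<And>a b. a \<in> C \<Longrightarrow> b \<in> C \<Longrightarrow> a * b \<in> C"
      "\<And>N. E N \<subseteq> C" "\<And>N. D N \<subseteq> C" "\<And>N. G N \<subseteq> C"
    and "\<And>i. i < t \<Longrightarrow> A i i \<in> E N" "\<And>i j. j < i \<Longrightarrow> i < t \<Longrightarrow> A i j \<in> D N" "\<And>i j. i < j \<Longrightarrow> j < t \<Longrightarrow> A i j \<in> G N"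
  shows "\<exists>M z r. z \<in> E M \<and> (\<forall>l<t. \<forall>i<t. r l i \<in> C) \<and>
    (\<forall>l<t. \<forall>j<t. (\<Sum>i<t. r l i * A i j) = (if l = j then z else 0))"
  using assms(12-14)
proof (induction t arbitrary: A N)
  case 0
  then show ?case using assms(1) by auto
next
  case (Suc t)
  define A' where "A' i j = A t t * A i j - A i t * A t j" for i j
  have "\<exists>M z r. z \<in> E M \<and> (\<forall>l<t. \<forall>i<t. r l i \<in> C) \<and>
    (\<forall>l<t. \<forall>j<t. (\<Sum>i<t. r l i * A' i j) = (if l = j then z else 0))"
    by (rule Suc.IH[of A' "N + N"]; unfold A'_def; intro diagE lowD upG) (use Suc.prems in auto)
  then obtain M z r where z: "z \<in> E M" and rC: "\<And>l i. l < t \<Longrightarrow> i < t \<Longrightarrow> r l i \<in> C"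
    and r: "\<And>l j. l < t \<Longrightarrow> j < t \<Longrightarrow> (\<Sum>i<t. r l i * A' i j) = (if l = j then z else 0)" by blast
  have AC: "A i j \<in> C" if "i \<le> t" "j \<le> t" for i j
  proof (cases i j rule: linorder_cases)
    case less
    then show ?thesis using Suc.prems(3)[of i j] C(6) that by auto
  next
    case equal
    then show ?thesis using Suc.prems(1)[of i] C(4) that by auto
  next
    case greater
    then show ?thesis using Suc.prems(2)[of j i] C(5) that by auto
  qed
  have Cadd: "a + b \<in> C" if "a \<in> C" "b \<in> C" for a b using C(2)[OF that(1) C(2)[OF C(1) that(2)]] by simp
  have Cneg: "- a \<in> C" if "a \<in> C" for a using C(2)[OF C(1) that] by simp
  have Csum: "(\<Sum>i<t. f i) \<in> C" if "\<And>i. i < t \<Longrightarrow> f i \<in> C" for f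
    using that by (induction t) (auto intro: C Cadd)
  define s where "s l i = (if i < t then r l i * A t t else 0 - (\<Sum>i'<t. r l i' * A i' t))" for l i
  have sC: "s l i \<in> C" if "l < t" "i \<le> t" for l i
    using that unfolding s_def by (auto simp del: diff_0 intro!: C Csum AC rC)
  have s: "(\<Sum>i<Suc t. s l i * A i j) = (if l = j then z else 0)" if "l < t" "j \<le> t" for l j
  proof -
    have "(\<Sum>i<Suc t. s l i * A i j) = (\<Sum>i<t. r l i * A t t * A i j) - (\<Sum>i<t. r l i * A i t) * A t j"
      by (simp add: s_def)
    also have "\<dots> = (\<Sum>i<t. r l i * A' i j)"
      unfolding sum_distrib_right sum_subtractf[symmetric]
      by (rule sum.cong) (auto simp: A'_def algebra_simps)
    also have "\<dots> = (if l = j then z else 0)"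
    proof (cases "j = t")
      case True
      then show ?thesis using that by (simp add: A'_def mult.commute)
    qed (use r that in auto)
    finally show ?thesis .
  qed
  define q where "q l i = (if l < t then A t t * s l i else (if i = t then z else 0) - (\<Sum>l'<t. A t l' * s l' i))" for l i
  have "z * A t t \<in> E (M + N)" using EE z Suc.prems(1) by auto
  moreover have "q l i \<in> C" if "l < Suc t" "i < Suc t" for l i
    using that unfolding q_def using C(4) z by (auto intro!: C(1-3) Cneg Csum AC sC)
  moreover have "(\<Sum>i<Suc t. q l i * A i j) = (if l = j then z * A t t else 0)" if "l < Suc t" "j < Suc t" for l j
  proof (cases "l < t")
    case True
    have "(\<Sum>i<Suc t. q l i * A i j) = A t t * (\<Sum>i<Suc t. s l i * A i j)"
      unfolding sum_distrib_left using True by (intro sum.cong) (auto simp: q_def mult.assoc)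
    then show ?thesis using s[OF True, of j] that by (auto simp: mult.commute)
  next
    case False
    then have l: "l = t" using that by simp
    have "(\<Sum>i<Suc t. q l i * A i j) = (\<Sum>i<Suc t. (if i = t then z else 0) * A i j) - (\<Sum>i<Suc t. (\<Sum>l'<t. A t l' * s l' i) * A i j)"
      unfolding sum_subtractf[symmetric] by (intro sum.cong) (auto simp: q_def l algebra_simps)
    also have "(\<Sum>i<Suc t. (if i = t then z else 0) * A i j) = z * A t j" by simp
    also have "(\<Sum>i<Suc t. (\<Sum>l'<t. A t l' * s l' i) * A i j) = (\<Sum>l'<t. A t l' * (\<Sum>i<Suc t. s l' i * A i j))"
      unfolding sum_distrib_left sum_distrib_right by (subst sum.swap) (simp add: mult.assoc)
    also have "\<dots> = (\<Sum>l'<t. if l' = j then A t l' * z else 0)"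
      using s that by (intro sum.cong) auto
    also have "\<dots> = (if j < t then A t j * z else 0)" by simp
    finally show ?thesis using that l by (auto simp: mult.commute)
  qed
  ultimately show ?case by blast
qed

abbreviation cst :: "'k::comm_ring_1 \<Rightarrow> 'k mpoly" where
  "cst c \<equiv> Poly_Mapping.single 0 c"

lemma lookup_cst_mult [simp]: "lookup (cst c * p) u = c * lookup p u" for p :: "'k::comm_ring_1 mpoly"
proof -
  have "lookup (cst c * p) u = (\<Sum>l. (c when 0 = l) * (\<Sum>q. lookup p q when u = l + q))"
    by (simp only: lookup_mult lookup_single)
  also have "\<dots> = (\<Sum>l. c * (\<Sum>q. lookup p q when u = l + q) when l = 0)"
    by (rule Sum_any.cong) (auto simp: when_def)
  also have "\<dots> = c * lookup p u" by simp
  finally show ?thesis .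
qed

interpretation vs: vector_space "\<lambda>(c::'k::field) (p::'k mpoly). cst c * p"
  by standard (simp_all add: distrib_left distrib_right single_add mult_single mult.assoc[symmetric])

lemma span_mult:
  fixes A B :: "'k::field mpoly set"
  assumes "a \<in> vs.span A" "b \<in> vs.span B"
  shows "a * b \<in> vs.span {x * y | x y. x \<in> A \<and> y \<in> B}" (is "_ \<in> vs.span ?S")
proof -
  have *: "x * b \<in> vs.span ?S" if "x \<in> A" for x
    using assms(2)
  proof (induction rule: vs.span_induct_alt)
    case (step c y z)
    have "x * y \<in> vs.span ?S" using that step by (intro vs.span_base) auto
    then have "cst c * (x * y) + x * z \<in> vs.span ?S" using step by (intro vs.span_add vs.span_scale)
    then show ?case by (simp add: algebra_simps)
  qed (simp add: vs.span_zero)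
  show ?thesis using assms(1)
  proof (induction rule: vs.span_induct_alt)
    case (step c y z)
    have "cst c * (y * b) + z * b \<in> vs.span ?S" using step * by (intro vs.span_add vs.span_scale)
    then show ?case by (simp add: algebra_simps)
  qed (simp add: vs.span_zero)
qed

lemma span_finite_sum:
  fixes f :: "'i \<Rightarrow> 'k::field mpoly"
  assumes "finite I" "x \<in> vs.span (f ` I)"
  shows "\<exists>c. x = (\<Sum>i\<in>I. cst (c i) * f i)"
  using assms(2)
proof (induction rule: vs.span_induct_alt)
  case base
  show ?case by (intro exI[of _ "\<lambda>_. 0"]) simp
next
  case (step a x y)
  then obtain i c where ic: "i \<in> I" "x = f i" "y = (\<Sum>i\<in>I. cst (c i) * f i)" by auto
  have "(\<Sum>j\<in>I. cst (c j + (if j = i then a else 0)) * f j)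
      = y + (\<Sum>j\<in>I. if j = i then cst a * f j else 0)"
    unfolding ic(3) sum.distrib[symmetric] by (rule sum.cong) (auto simp: single_add distrib_right)
  also have "\<dots> = cst a * x + y" using ic assms(1) by (simp add: add.commute)
  finally show ?case by (intro exI[of _ "\<lambda>j. c j + (if j = i then a else 0)"]) (rule sym)
qed

text \<open>The quasi-inverse of the matrix \<open>1 + t \<beta>\<close> over \<open>K[t]\<close>
  has a denominator with constant term 1.\<close>

lemma span_perturb:
  fixes p q :: "'i \<Rightarrow> 'k::field mpoly"
  assumes "finite I" "finite T" and q: "\<And>i. i \<in> I \<Longrightarrow> q i \<in> vs.span T" and T: "T \<subseteq> vs.span (p ` I)"
  shows "\<exists>Z. finite Z \<and> (\<forall>t. t \<notin> Z \<longrightarrow> T \<subseteq> vs.span ((\<lambda>i. p i + cst t * q i) ` I))"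
proof -
  obtain w and m :: nat where w: "T = w ` {..<m}" using assms(2) by (metis finite_imp_nat_seg_image_inj_on lessThan_def)
  have "\<forall>l. \<exists>a. l < m \<longrightarrow> w l = (\<Sum>i\<in>I. cst (a i) * p i)"
    using span_finite_sum[OF assms(1), of _ p] T w by blast
  then obtain a where a: "\<And>l. l < m \<Longrightarrow> w l = (\<Sum>i\<in>I. cst (a l i) * p i)" by metis
  have "\<forall>i. \<exists>b. i \<in> I \<longrightarrow> q i = (\<Sum>j<m. cst (b j) * w j)"
    using span_finite_sum[of "{..<m}" _ w] q w by blast
  then obtain b where b: "\<And>i. i \<in> I \<Longrightarrow> q i = (\<Sum>j<m. cst (b i j) * w j)" by metis
  define \<beta> where "\<beta> l j = (\<Sum>i\<in>I. a l i * b i j)" for l j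
  define W where "W t l = (\<Sum>i\<in>I. cst (a l i) * (p i + cst t * q i))" for t l
  have cst_sum: "(\<Sum>i\<in>A. cst (f i)) = cst (\<Sum>i\<in>A. f i)" for A and f :: "_ \<Rightarrow> 'k"
    by (induction A rule: infinite_finite_induct) (auto simp: single_add)
  have W: "W t l = w l + cst t * (\<Sum>j<m. cst (\<beta> l j) * w j)" if "l < m" for t l
  proof -
    have "(\<Sum>i\<in>I. cst (a l i) * q i) = (\<Sum>i\<in>I. \<Sum>j<m. cst (a l i * b i j) * w j)"
      by (intro sum.cong refl) (simp add: b sum_distrib_left mult.assoc[symmetric] mult_single)
    also have "\<dots> = (\<Sum>j<m. cst (\<beta> l j) * w j)"
      unfolding \<beta>_def cst_sum[symmetric] sum_distrib_right by (rule sum.swap)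
    finally have *: "(\<Sum>i\<in>I. cst (a l i) * q i) = (\<Sum>j<m. cst (\<beta> l j) * w j)" .
    have "W t l = (\<Sum>i\<in>I. cst (a l i) * p i + cst t * (cst (a l i) * q i))"
      unfolding W_def by (rule sum.cong) (auto simp: algebra_simps)
    also have "\<dots> = w l + cst t * (\<Sum>i\<in>I. cst (a l i) * q i)"
      unfolding a[OF that] sum.distrib sum_distrib_left ..
    finally show ?thesis unfolding * .
  qed
  define E where "E = {f :: 'k poly. poly f 0 = 1}"
  define D where "D = {f :: 'k poly. poly f 0 = 0}"
  define A where "A i j = [:if i = j then 1 else 0, \<beta> i j:]" for i j
  have "\<exists>M z r. z \<in> (\<lambda>_::nat. E) M \<and> (\<forall>l<m. \<forall>i<m. r l i \<in> UNIV) \<and>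
      (\<forall>l<m. \<forall>j<m. (\<Sum>i<m. r l i * A i j) = (if l = j then z else 0))"
    by (rule triangular_quasi_inverse[of 1 "\<lambda>_. E" 0 "\<lambda>_. D" "\<lambda>_. D" UNIV m A 0])
       (simp_all add: E_def D_def A_def)
  then obtain z and r :: "nat \<Rightarrow> nat \<Rightarrow> 'k poly" where zE: "z \<in> E"
    and r: "\<forall>l<m. \<forall>j<m. (\<Sum>i<m. r l i * A i j) = (if l = j then z else 0)"
    by meson
  have z: "poly z 0 = 1" using zE by (simp add: E_def)
  have "w l \<in> vs.span ((\<lambda>i. p i + cst t * q i) ` I)" if l: "l < m" and t: "poly z t \<noteq> 0" for l t
  proof -
    let ?S = "vs.span ((\<lambda>i. p i + cst t * q i) ` I)"
    have rt: "(\<Sum>i<m. poly (r l i) t * poly (A i j) t) = (if l = j then poly z t else 0)" if "j < m" for j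
      using arg_cong[OF r[rule_format, OF l that], of "\<lambda>f. poly f t"] by (simp add: poly_sum)
    have WA: "W t i = (\<Sum>j<m. cst (poly (A i j) t) * w j)" if "i < m" for i
    proof -
      have "(\<Sum>j<m. cst (poly (A i j) t) * w j)
          = (\<Sum>j<m. (if j = i then w j else 0) + cst t * (cst (\<beta> i j) * w j))"
        by (rule sum.cong) (auto simp: A_def single_add algebra_simps mult_single)
      also have "\<dots> = W t i" using that by (simp add: W sum.distrib sum_distrib_left)
      finally show ?thesis by simp
    qed
    have "(\<Sum>i<m. cst (poly (r l i) t) * W t i)
       = (\<Sum>i<m. \<Sum>j<m. cst (poly (r l i) t * poly (A i j) t) * w j)"
      by (intro sum.cong refl) (simp add: WA sum_distrib_left mult.assoc[symmetric] mult_single)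
    also have "\<dots> = (\<Sum>j<m. cst (\<Sum>i<m. poly (r l i) t * poly (A i j) t) * w j)"
      unfolding cst_sum[symmetric] sum_distrib_right by (rule sum.swap)
    also have "\<dots> = (\<Sum>j<m. if j = l then cst (poly z t) * w j else 0)"
      by (rule sum.cong) (auto simp: rt)
    also have "\<dots> = cst (poly z t) * w l" using l by simp
    finally have eq: "w l = cst (inverse (poly z t)) * (\<Sum>i<m. cst (poly (r l i) t) * W t i)"
      using t by (simp add: mult.assoc[symmetric] mult_single)
    have "W t i \<in> ?S" for i
      unfolding W_def by (intro vs.span_sum vs.span_scale vs.span_base) auto
    then show ?thesis unfolding eq by (intro vs.span_scale vs.span_sum)
  qed
  moreover have "finite {t. poly z t = 0}" using z by (intro poly_roots_finite) auto
  ultimately show ?thesis using w by (intro exI[of _ "{t. poly z t = 0}"]) auto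
qed

fun power_products :: "(nat \<Rightarrow> 'k::comm_ring_1 mpoly) \<Rightarrow> nat \<Rightarrow> nat \<Rightarrow> 'k mpoly set" where
  "power_products v 0 k = (if k = 0 then {1} else {})"
| "power_products v (Suc l) 0 = {1}"
| "power_products v (Suc l) (Suc k) = (*) (v l) ` power_products v (Suc l) k \<union> power_products v l (Suc k)"

lemma power_products_0 [simp]: "power_products v l 0 = {1}"
  by (cases l) auto

lemma finite_power_products: "finite (power_products v l k)"
  by (induction v l k rule: power_products.induct) auto

lemma card_power_products: "card (power_products v l k) \<le> multiset_num l k"
proof (induction v l k rule: power_products.induct)
  case (3 v l k)
  have "card (power_products v (Suc l) (Suc k)) \<le> card ((*) (v l) ` power_products v (Suc l) k) + card (power_products v l (Suc k))"
    by (simp add: card_Un_le)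
  also have "\<dots> \<le> card (power_products v (Suc l) k) + card (power_products v l (Suc k))"
    by (intro add_right_mono card_image_le finite_power_products)
  finally show ?case using 3 by simp
qed auto

lemma power_products_mult: "i < l \<Longrightarrow> p \<in> power_products v l k \<Longrightarrow> v i * p \<in> power_products v l (Suc k)"
proof (induction v l k arbitrary: p rule: power_products.induct)
  case (2 v l)
  then show ?case
  proof (induction l)
    case (Suc l)
    then show ?case by (cases "i = Suc l") auto
  qed auto
next
  case (3 v l k)
  show ?case
  proof (cases "i = l")
    case True
    then show ?thesis using 3(4) by (simp only: power_products.simps) blast
  next
    case False
    have "p \<in> (*) (v l) ` power_products v (Suc l) k \<or> p \<in> power_products v l (Suc k)" using 3(4) by simp
    then show ?thesis
    proof
      assume "p \<in> (*) (v l) ` power_products v (Suc l) k"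
      then obtain p' where p': "p' \<in> power_products v (Suc l) k" "p = v l * p'" by auto
      have "v i * p' \<in> power_products v (Suc l) (Suc k)" using 3 p' by simp
      then have "v l * (v i * p') \<in> power_products v (Suc l) (Suc (Suc k))"
        by (subst power_products.simps) blast
      then show ?thesis using p' by (simp add: mult.left_commute)
    next
      assume "p \<in> power_products v l (Suc k)"
      then have "v i * p \<in> power_products v l (Suc (Suc k))" using 3 False by simp
      then show ?thesis by (subst power_products.simps) blast
    qed
  qed
qed auto

lemma single_one_inj: "Poly_Mapping.single u (1::'a::zero_neq_one) = Poly_Mapping.single v 1 \<longleftrightarrow> u = v"
  by (metis lookup_single_eq lookup_single_not_eq zero_neq_one)

lemma independent_mons: "vs.independent (mons lam n p k :: 'k::field mpoly set)"
proof (rule vs.independent_if_scalars_zero[OF finite_mons])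
  fix f :: "'k mpoly \<Rightarrow> 'k" and m :: "'k mpoly"
  assume s: "(\<Sum>x\<in>mons lam n p k. cst (f x) * x) = 0" and m: "m \<in> mons lam n p k"
  obtain u where u: "m = Poly_Mapping.single u 1" using mons_single[OF m] by blast
  have "0 = lookup (\<Sum>x\<in>mons lam n p k. cst (f x) * x) u" by (simp add: s)
  also have "\<dots> = (\<Sum>x\<in>mons lam n p k. if x = m then f x else 0)"
    unfolding lookup_sum
  proof (rule sum.cong)
    fix x :: "'k mpoly" assume "x \<in> mons lam n p k"
    then obtain v where "x = Poly_Mapping.single v 1" using mons_single by blast
    then show "lookup (cst (f x) * x) u = (if x = m then f x else 0)"
      using u by (auto simp: lookup_single when_def single_one_inj)
  qed simp
  also have "\<dots> = f m" using m by (simp add: finite_mons)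
  finally show "f m = 0" by simp
qed

lemma card_mons_le:
  fixes B :: "nat \<Rightarrow> 'k::field mpoly set"
  assumes fin: "\<And>j. finite (B j)"
    and B: "\<And>j. j \<le> k \<Longrightarrow> mons lam n p j \<subseteq>
       vs.span (B j \<union> {v i * m | i m j'. i < l \<and> j = Suc j' \<and> m \<in> mons lam n p j'})"
  shows "card (mons lam n p k :: 'k mpoly set) \<le> (\<Sum>j=0..k. card (B j) * multiset_num l (k - j))"
proof -
  define S where "S k = (\<Union>j\<in>{0..k}. (\<lambda>(x, y). x * y) ` (B j \<times> power_products v l (k - j)))" for k
  have fS: "finite (S k)" for k unfolding S_def by (intro finite_UN_I finite_imageI finite_cartesian_product finite_atLeastAtMost fin finite_power_products)
  have vS: "v i * x \<in> vs.span (S (Suc k))" if x: "x \<in> vs.span (S k)" and i: "i < l" for i k x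
    using x
  proof (induction rule: vs.span_induct_alt)
    case (step c y z)
    then obtain j b q where y: "j \<le> k" "b \<in> B j" "q \<in> power_products v l (k - j)" "y = b * q"
      by (auto simp: S_def)
    have "v i * q \<in> power_products v l (Suc k - j)"
      using power_products_mult[OF i y(3)] y(1) by (simp add: Suc_diff_le)
    then have "b * (v i * q) \<in> S (Suc k)" using y by (force simp: S_def)
    then have "v i * y \<in> vs.span (S (Suc k))" using y by (auto intro!: vs.span_base simp: mult.left_commute)
    then have "cst c * (v i * y) + v i * z \<in> vs.span (S (Suc k))"
      using step by (intro vs.span_add vs.span_scale)
    then show ?case by (simp add: algebra_simps)
  qed (simp add: vs.span_zero)
  have "mons lam n p k' \<subseteq> vs.span (S k')" if "k' \<le> k" for k' using that
  proof (induction k')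
    case 0
    have "mons lam n p 0 \<subseteq> vs.span (B 0)" using B[of 0] by simp
    moreover have "B 0 \<subseteq> S 0" by (force simp: S_def)
    ultimately show ?case using vs.span_mono by blast
  next
    case (Suc k')
    have "B (Suc k') \<subseteq> S (Suc k')" by (force simp: S_def)
    moreover have "v i * m \<in> vs.span (S (Suc k'))" if "i < l" "m \<in> mons lam n p k'" for i m
      using vS[of m k' i] Suc that by auto
    ultimately have "B (Suc k') \<union> {v i * m | i m j'. i < l \<and> Suc k' = Suc j' \<and> m \<in> mons lam n p j'}
        \<subseteq> vs.span (S (Suc k'))"
      using vs.span_superset by blast
    then show ?case using B[OF Suc.prems] vs.span_minimal[OF _ vs.subspace_span] by blast
  qed
  then have "mons lam n p k \<subseteq> vs.span (S k)" by simp
  then have "card (mons lam n p k :: 'k mpoly set) \<le> card (S k)"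
    using vs.independent_span_bound[OF fS independent_mons] by blast
  also have "\<dots> \<le> (\<Sum>j=0..k. card ((\<lambda>(x, y). x * y) ` (B j \<times> power_products v l (k - j))))"
    unfolding S_def by (rule card_UN_le) simp
  also have "\<dots> \<le> (\<Sum>j=0..k. card (B j \<times> power_products v l (k - j)))"
    by (rule sum_mono, rule card_image_le) (intro finite_cartesian_product fin finite_power_products)
  also have "\<dots> \<le> (\<Sum>j=0..k. card (B j) * multiset_num l (k - j))"
    by (intro sum_mono) (simp add: card_cartesian_product card_power_products)
  finally show ?thesis .
qed

lemma multiset_num_le: "multiset_num (Suc l) k \<le> (k + 1) ^ l"
proof (induction l arbitrary: k)
  case 0
  show ?case by (induction k) auto
next
  case (Suc l)
  show ?case
  proof (induction k)
    case (Suc k)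
    have "(k + 1) ^ Suc l \<le> (k + 1) * (k + 2) ^ l" unfolding power_Suc
      by (intro mult_le_mono2 power_mono) auto
    then show ?case using Suc \<open>\<And>k. multiset_num (Suc l) k \<le> (k + 1) ^ l\<close>[of "Suc k"] by simp
  qed simp
qed

section \<open>Ideals and homogeneous components\<close>

definition subring :: "'a::comm_ring_1 set \<Rightarrow> bool" where
  "subring R \<longleftrightarrow> 1 \<in> R \<and> (\<forall>a\<in>R. \<forall>b\<in>R. a - b \<in> R \<and> a * b \<in> R)"

lemma subringD:
  assumes "subring R"
  shows "1 \<in> R" "0 \<in> R" "\<And>a b. a \<in> R \<Longrightarrow> b \<in> R \<Longrightarrow> a - b \<in> R" "\<And>a b. a \<in> R \<Longrightarrow> b \<in> R \<Longrightarrow> a * b \<in> R"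
    "\<And>a. a \<in> R \<Longrightarrow> - a \<in> R" "\<And>a b. a \<in> R \<Longrightarrow> b \<in> R \<Longrightarrow> a + b \<in> R"
proof -
  show 1: "1 \<in> R" and d: "\<And>a b. a \<in> R \<Longrightarrow> b \<in> R \<Longrightarrow> a - b \<in> R" and "\<And>a b. a \<in> R \<Longrightarrow> b \<in> R \<Longrightarrow> a * b \<in> R"
    using assms by (auto simp: subring_def)
  show 0: "0 \<in> R" using d[OF 1 1] by simp
  show n: "- a \<in> R" if "a \<in> R" for a using d[OF 0 that] by simp
  show "a + b \<in> R" if "a \<in> R" "b \<in> R" for a b using d[OF that(1) n[OF that(2)]] by simp
qed

inductive_set lin :: "'a::comm_ring_1 set \<Rightarrow> 'a set \<Rightarrow> 'a set" for R S where
  zero: "0 \<in> lin R S"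
| step: "r \<in> R \<Longrightarrow> s \<in> S \<Longrightarrow> x \<in> lin R S \<Longrightarrow> r * s + x \<in> lin R S"

lemma lin_add: "x \<in> lin R S \<Longrightarrow> y \<in> lin R S \<Longrightarrow> x + y \<in> lin R S"
  by (induction rule: lin.induct) (auto simp: add.assoc intro: lin.intros)

lemma lin_scale:
  assumes R: "subring R" and r: "r \<in> R" and x: "x \<in> lin R S"
  shows "r * x \<in> lin R S"
  using x
proof (induction rule: lin.induct)
  case zero
  then show ?case by (simp add: lin.zero)
next
  case (step r' s x)
  have "(r * r') * s + r * x \<in> lin R S" using step R r by (auto intro: lin.step dest: subringD(4))
  then show ?case by (simp add: algebra_simps)
qed

lemma lin_sum: "(\<And>i. i \<in> A \<Longrightarrow> f i \<in> lin R S) \<Longrightarrow> sum f A \<in> lin R S"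
  by (induction A rule: infinite_finite_induct) (simp_all add: lin.zero lin_add)

lemma lin_base: "subring R \<Longrightarrow> s \<in> S \<Longrightarrow> s \<in> lin R S"
  using lin.step[of 1 R s S 0] by (simp add: lin.zero subringD)

lemma lin_diff: "subring R \<Longrightarrow> x \<in> lin R S \<Longrightarrow> y \<in> lin R S \<Longrightarrow> x - y \<in> lin R S"
  using lin_add[of x R S "- 1 * y"] lin_scale[of R "- 1" y S] by (simp add: subringD)

lemma lin_ideal: "subring R \<Longrightarrow> S \<subseteq> R \<Longrightarrow> ideal_in R (lin R S)"
proof -
  assume R: "subring R" and S: "S \<subseteq> R"
  have "x \<in> R" if "x \<in> lin R S" for x
    using that by (induction rule: lin.induct) (use S R in \<open>auto simp: subringD subset_iff\<close>)
  then show "ideal_in R (lin R S)" using R by (auto simp: ideal_in_def lin.zero lin_add lin_scale)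
qed

lemma lin_least:
  assumes "0 \<in> J" "\<And>a b. a \<in> J \<Longrightarrow> b \<in> J \<Longrightarrow> a + b \<in> J" "\<And>r s. r \<in> R \<Longrightarrow> s \<in> S \<Longrightarrow> r * s \<in> J"
  shows "lin R S \<subseteq> J"
proof
  fix x assume "x \<in> lin R S"
  then show "x \<in> J" by induction (use assms in auto)
qed

lemma lin_subset_ideal: "ideal_in R J \<Longrightarrow> S \<subseteq> J \<Longrightarrow> lin R S \<subseteq> J"
  by (rule lin_least) (auto simp: ideal_in_def)

lemma lin_subset_lin:
  assumes R: "subring R" and S: "S \<subseteq> lin R T"
  shows "lin R S \<subseteq> lin R T"
  by (rule lin_least[OF lin.zero lin_add lin_scale[OF R]]) (use S in auto)

lemma gen_ideal_eq_lin: "subring R \<Longrightarrow> S \<subseteq> R \<Longrightarrow> gen_ideal R S = lin R S"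
  unfolding gen_ideal_def
proof (intro equalityI Inter_greatest Inter_lower)
  assume "subring R" "S \<subseteq> R"
  then show "lin R S \<in> {J. ideal_in R J \<and> S \<subseteq> J}" by (auto intro: lin_ideal lin_base)
qed (auto intro: lin_subset_ideal[THEN subsetD])

lemma lin_ideal_self: "subring R \<Longrightarrow> ideal_in R J \<Longrightarrow> lin R J = J"
  by (intro equalityI subsetI lin_base) (auto dest: lin_subset_ideal[OF _ order_refl, THEN subsetD])

lemma lin_mult:
  assumes R: "subring R" and "x \<in> lin R A" "y \<in> lin R B"
  shows "x * y \<in> lin R {a * b | a b. a \<in> A \<and> b \<in> B}" (is "_ \<in> lin R ?S")
proof -
  have *: "a * y \<in> lin R ?S" if "a \<in> A" for a using assms(3)
  proof induction
    case (step r s x)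
    have "r * (a * s) + a * x \<in> lin R ?S" using step that by (intro lin.step) auto
    then show ?case by (simp add: algebra_simps)
  qed (simp add: lin.zero)
  show ?thesis using assms(2)
  proof induction
    case (step r s x)
    have "r * (s * y) + x * y \<in> lin R ?S" 
      by (rule lin_add[OF lin_scale[OF R step.hyps(1) *[OF step.hyps(2)]] step.IH])
    then show ?case by (simp add: algebra_simps)
  qed (simp add: lin.zero)
qed

lemma ideal_prod_lin:
  assumes R: "subring R" "A \<subseteq> R" "B \<subseteq> R"
  shows "ideal_prod R (lin R A) (lin R B) = lin R {a * b | a b. a \<in> A \<and> b \<in> B}"
proof -
  have sub: "lin R A \<subseteq> R" "lin R B \<subseteq> R" using lin_ideal[of R A] lin_ideal[of R B] assms by (auto simp: ideal_in_def)
  then have "ideal_prod R (lin R A) (lin R B) = lin R {a * b | a b. a \<in> lin R A \<and> b \<in> lin R B}"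
    unfolding ideal_prod_def using R by (intro gen_ideal_eq_lin) (auto dest: subringD(4))
  also have "\<dots> = lin R {a * b | a b. a \<in> A \<and> b \<in> B}"
  proof (intro equalityI lin_subset_lin[OF R(1)] subsetI; elim CollectE exE conjE)
    fix x a b assume x: "x = a * b" and ab: "a \<in> lin R A" "b \<in> lin R B"
    show "x \<in> lin R {a * b | a b. a \<in> A \<and> b \<in> B}" unfolding x by (rule lin_mult[OF R(1) ab])
  next
    fix x a b assume "x = a * b" "a \<in> A" "b \<in> B"
    then show "x \<in> lin R {a * b | a b. a \<in> lin R A \<and> b \<in> lin R B}"
      by (intro lin_base[OF R(1)] CollectI exI[of _ a] exI[of _ b] conjI) (simp_all add: lin_base[OF R(1)])
  qed
  finally show ?thesis .
qed

lemma ideal_prod_ideal_lin: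
  assumes R: "subring R" "ideal_in R J" "B \<subseteq> R"
  shows "ideal_prod R J (lin R B) = lin R {a * b | a b. a \<in> J \<and> b \<in> B}"
  using ideal_prod_lin[of R J B] assms lin_ideal_self[of R J] by (auto simp: ideal_in_def)

definition wt :: "(var \<Rightarrow> nat) \<Rightarrow> (var \<Rightarrow>\<^sub>0 nat) \<Rightarrow> nat" where
  "wt w m = (\<Sum>v\<in>keys m. lookup m v * w v)"

lemma wt_superset: "finite A \<Longrightarrow> keys m \<subseteq> A \<Longrightarrow> wt w m = (\<Sum>v\<in>A. lookup m v * w v)"
  unfolding wt_def by (rule sum.mono_neutral_left) (auto simp: in_keys_iff)

lemma wt_add [simp]: "wt w (a + b) = wt w a + wt w b"
proof -
  let ?A = "keys a \<union> keys b"
  have "wt w (a + b) = (\<Sum>v\<in>?A. lookup (a + b) v * w v)"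
    by (rule wt_superset) (use keys_add[of a b] in auto)
  then show ?thesis
    using wt_superset[of ?A a w] wt_superset[of ?A b w]
    by (simp add: lookup_add distrib_right sum.distrib)
qed

lemma wt_zero [simp]: "wt w 0 = 0"
  by (simp add: wt_def)

lemma wt_single [simp]: "wt w (Poly_Mapping.single v c) = c * w v"
  by (simp add: wt_def)

definition var :: "var \<Rightarrow> ('k::comm_ring_1) mpoly" where
  "var v = Poly_Mapping.single (Poly_Mapping.single v 1) 1"

lemma xy_eq_var: "xy i j = var (X i) * var (Y j)"
  by (simp add: xy_def var_def mult_single)

lemma poly_mapping_sum_single: "(\<Sum>m\<in>keys p. Poly_Mapping.single m (lookup p m)) = p"
  by (rule poly_mapping_eqI) (simp add: lookup_sum lookup_single when_def in_keys_iff)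

lemma subring_poly_ring: "subring (poly_ring V :: 'k::comm_ring_1 mpoly set)"
proof -
  have "a * b \<in> poly_ring V" if "a \<in> poly_ring V" "b \<in> poly_ring V" for a b :: "'k mpoly"
    unfolding poly_ring_def
  proof (intro CollectI allI impI)
    fix m assume "m \<in> keys (a * b)"
    then obtain u v where "u \<in> keys a" "v \<in> keys b" "m = u + v" using keys_mult[of a b] by auto
    then show "keys m \<subseteq> V" using that keys_add[of u v] by (fastforce simp: poly_ring_def)
  qed
  moreover have "a - b \<in> poly_ring V" if "a \<in> poly_ring V" "b \<in> poly_ring V" for a b :: "'k mpoly"
  proof -
    have "keys (a - b) \<subseteq> keys a \<union> keys b" by (auto simp: in_keys_iff lookup_minus)
    then show ?thesis using that by (force simp: poly_ring_def)
  qed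
  moreover have "(1 :: 'k mpoly) \<in> poly_ring V" by (simp add: poly_ring_def)
  ultimately show ?thesis unfolding subring_def by blast
qed

lemma single_in_poly_ring: "keys m \<subseteq> V \<Longrightarrow> Poly_Mapping.single m c \<in> poly_ring V"
  by (auto simp: poly_ring_def split: if_splits)

lemma cst_in_poly_ring [simp]: "cst c \<in> poly_ring V"
  by (rule single_in_poly_ring) simp

lemma var_in_poly_ring: "v \<in> V \<Longrightarrow> var v \<in> poly_ring V"
  unfolding var_def by (rule single_in_poly_ring) simp

lemma poly_ring_in_lin:
  fixes p :: "'k::comm_ring_1 mpoly"
  assumes p: "p \<in> poly_ring V" and "\<And>m. m \<in> keys p \<Longrightarrow> \<exists>v\<in>keys m. P v"
  shows "p \<in> lin (poly_ring V) (var ` {v \<in> V. P v})"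
proof -
  have "Poly_Mapping.single m (lookup p m) \<in> lin (poly_ring V) (var ` {v \<in> V. P v})" if m: "m \<in> keys p" for m
  proof -
    obtain v where v: "v \<in> keys m" "P v" using assms(2)[OF m] by auto
    have kV: "keys m \<subseteq> V" using p m by (auto simp: poly_ring_def)
    have m_eq: "(m - Poly_Mapping.single v 1) + Poly_Mapping.single v 1 = m"
      by (rule poly_mapping_eqI) (use v in \<open>auto simp: lookup_add lookup_minus lookup_single when_def in_keys_iff\<close>)
    have "keys (m - Poly_Mapping.single v 1) \<subseteq> V" using kV by (auto simp: in_keys_iff lookup_minus)
    then have "Poly_Mapping.single (m - Poly_Mapping.single v 1) (lookup p m) * var v + 0 \<in> lin (poly_ring V) (var ` {v \<in> V. P v})"
      using v kV by (intro lin.intros single_in_poly_ring) auto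
    moreover have "Poly_Mapping.single (m - Poly_Mapping.single v 1) (lookup p m) * var v + 0 = Poly_Mapping.single m (lookup p m)"
      unfolding var_def mult_single m_eq by simp
    ultimately show ?thesis by metis
  qed
  then have "(\<Sum>m\<in>keys p. Poly_Mapping.single m (lookup p m)) \<in> lin (poly_ring V) (var ` {v \<in> V. P v})"
    by (rule lin_sum)
  then show ?thesis by (simp add: poly_mapping_sum_single)
qed

abbreviation deg :: "(var \<Rightarrow>\<^sub>0 nat) \<Rightarrow> nat" where "deg \<equiv> wt (\<lambda>_. 1)"

definition hcomp :: "nat \<Rightarrow> ('k::comm_ring_1) mpoly \<Rightarrow> 'k mpoly" where
  "hcomp k p = (\<Sum>m\<in>{m\<in>keys p. deg m = k}. Poly_Mapping.single m (lookup p m))"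

lemma lookup_hcomp: "lookup (hcomp k p) m = (if deg m = k then lookup p m else 0)"
proof -
  have "lookup (hcomp k p) m = (\<Sum>u\<in>{u\<in>keys p. deg u = k}. if u = m then lookup p m else 0)"
    unfolding hcomp_def lookup_sum by (rule sum.cong) (auto simp: lookup_single when_def)
  then show ?thesis by (simp add: in_keys_iff)
qed

lemma hcomp_add [simp]: "hcomp k (p + q) = hcomp k p + hcomp k q"
  by (rule poly_mapping_eqI) (simp add: lookup_hcomp lookup_add)

lemma hcomp_zero [simp]: "hcomp k 0 = 0"
  by (rule poly_mapping_eqI) (simp add: lookup_hcomp)

lemma hcomp_scale: "hcomp k (cst c * p) = cst c * hcomp k p"
  by (rule poly_mapping_eqI) (simp add: lookup_hcomp)

definition order_ge :: "nat \<Rightarrow> ('k::comm_ring_1) mpoly \<Rightarrow> bool" where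
  "order_ge k p \<longleftrightarrow> (\<forall>m\<in>keys p. k \<le> deg m)"

lemma order_ge_add: "order_ge k p \<Longrightarrow> order_ge k q \<Longrightarrow> order_ge k (p + q)"
  using keys_add[of p q] by (auto simp: order_ge_def)

lemma order_ge_mult: "order_ge j p \<Longrightarrow> order_ge k q \<Longrightarrow> order_ge (j + k) (p * q)"
  using keys_mult[of p q] by (fastforce simp: order_ge_def intro: add_mono)

lemma order_ge_hcomp: "order_ge k (hcomp k p)"
  by (auto simp: order_ge_def in_keys_iff lookup_hcomp split: if_splits)

lemma order_ge_minus_hcomp: "order_ge k p \<Longrightarrow> order_ge (Suc k) (p - hcomp k p)"
  by (force simp: order_ge_def in_keys_iff lookup_hcomp lookup_minus split: if_splits)

lemma hcomp_eq_0: "order_ge (Suc k) p \<Longrightarrow> hcomp k p = 0"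
  by (rule poly_mapping_eqI) (force simp: order_ge_def lookup_hcomp in_keys_iff)

lemma hcomp_mult:
  assumes "order_ge j p" "order_ge k q"
  shows "hcomp (j + k) (p * q) = hcomp j p * hcomp k q"
proof -
  have eq: "p * q = hcomp j p * hcomp k q + (hcomp j p * (q - hcomp k q) + (p - hcomp j p) * q)"
    by (simp add: algebra_simps)
  have "order_ge (Suc (j + k)) (hcomp j p * (q - hcomp k q))"
    using order_ge_mult[OF order_ge_hcomp order_ge_minus_hcomp[OF assms(2)]] by simp
  moreover have "order_ge (Suc (j + k)) ((p - hcomp j p) * q)"
    using order_ge_mult[OF order_ge_minus_hcomp[OF assms(1)] assms(2)] by simp
  moreover have "hcomp (j + k) (hcomp j p * hcomp k q) = hcomp j p * hcomp k q"
  proof (rule poly_mapping_eqI)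
    fix m
    show "lookup (hcomp (j + k) (hcomp j p * hcomp k q)) m = lookup (hcomp j p * hcomp k q) m"
    proof (cases "m \<in> keys (hcomp j p * hcomp k q)")
      case True
      then obtain u v where "u \<in> keys (hcomp j p)" "v \<in> keys (hcomp k q)" "m = u + v"
        using keys_mult[of "hcomp j p" "hcomp k q"] by auto
      then have "deg m = j + k" by (auto simp: in_keys_iff lookup_hcomp split: if_splits)
      then show ?thesis by (simp add: lookup_hcomp)
    qed (auto simp: lookup_hcomp in_keys_iff)
  qed
  ultimately show ?thesis by (subst eq) (simp only: hcomp_add hcomp_eq_0 add_0_right)
qed

lemma hcomp_0: "hcomp 0 p = cst (lookup p 0)"
proof (rule poly_mapping_eqI)
  fix m :: "var \<Rightarrow>\<^sub>0 nat"
  have "deg m = 0 \<longleftrightarrow> m = 0" by (auto simp: wt_def in_keys_iff poly_mapping_eq_iff fun_eq_iff)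
  then show "lookup (hcomp 0 p) m = lookup (cst (lookup p 0)) m"
    by (auto simp: lookup_hcomp lookup_single when_def)
qed

lemma order_ge_0 [simp]: "order_ge 0 p"
  by (simp add: order_ge_def)

section \<open>Reductions of the Ferrers ideal\<close>

declare One_nat_def [simp del]
declare mons.simps(2) [simp del]

lemma mons_1: "mons lam n p 1 = {xy i j | i j. (i, j) \<in> shape lam n p}"
  by (auto simp: mons.simps One_nat_def)

lemma mons_mult_1: "a \<in> mons lam n p 1 \<Longrightarrow> b \<in> mons lam n p k \<Longrightarrow> a * b \<in> mons lam n p (Suc k)"
  using mons_mult[of a lam n p 1 b k] by (simp only: plus_1_eq_Suc)

lemma lin_mult_const:
  assumes R: "subring R" and "x \<in> lin R S" and S: "\<And>s. s \<in> S \<Longrightarrow> s * c \<in> lin R T"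
  shows "x * c \<in> lin R T"
  using assms(2)
proof induction
  case (step r s x)
  have "r * (s * c) + x * c \<in> lin R T" by (rule lin_add[OF lin_scale[OF R step.hyps(1) S[OF step.hyps(2)]] step.IH])
  then show ?case by (simp add: algebra_simps)
qed (simp add: lin.zero)

lemma lin_mono: "S \<subseteq> T \<Longrightarrow> x \<in> lin R S \<Longrightarrow> x \<in> lin R T"
  by (rotate_tac 1, induction rule: lin.induct) (auto intro: lin.intros)

lemma span_subset_lin:
  assumes "x \<in> vs.span S" "\<And>s. s \<in> S \<Longrightarrow> s \<in> lin (poly_ring V) T"
  shows "x \<in> lin (poly_ring V) T"
  using assms(1)
  by (induction rule: vs.span_induct_alt)
     (simp_all add: lin.zero lin_add lin_scale[OF subring_poly_ring cst_in_poly_ring] assms(2))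

lemma finite_linear_relation:
  fixes f :: "'i \<Rightarrow> 'k::field mpoly"
  assumes I: "finite I" and T: "finite T" and f: "f ` I \<subseteq> vs.span T" and card: "card T < card I"
  shows "\<exists>g. (\<exists>i\<in>I. g i \<noteq> 0) \<and> (\<Sum>i\<in>I. cst (g i) * f i) = 0"
proof (cases "inj_on f I")
  case True
  have "vs.dependent (f ` I)"
  proof (rule ccontr)
    assume "\<not> vs.dependent (f ` I)"
    then have "card (f ` I) \<le> card T" using vs.independent_span_bound[OF T _ f] by blast
    then show False using card card_image[OF True] by simp
  qed
  then obtain u where u: "\<exists>v\<in>f ` I. u v \<noteq> 0" "(\<Sum>v\<in>f ` I. cst (u v) * v) = 0"
    using vs.dependent_finite[of "f ` I"] I by auto
  then show ?thesis
    by (intro exI[of _ "u \<circ> f"]) (auto simp: sum.reindex[OF True])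
next
  case False
  then obtain i j where ij: "i \<in> I" "j \<in> I" "i \<noteq> j" "f i = f j" by (auto simp: inj_on_def)
  define g where "g l = (if l = i then 1 else if l = j then - 1 else 0 :: 'k)" for l
  have "(\<Sum>l\<in>I. cst (g l) * f l) = (\<Sum>l\<in>{i, j}. cst (g l) * f l)"
    by (rule sum.mono_neutral_right) (use I ij in \<open>auto simp: g_def\<close>)
  also have "\<dots> = f i + cst (- 1) * f i" using ij by (simp add: g_def)
  also have "\<dots> = 0" by (simp add: single_uminus[symmetric])
  finally show ?thesis using ij by (intro exI[of _ g]) (auto simp: g_def intro!: bexI[of _ i])
qed

lemma digits_unique:
  fixes f g :: "nat \<Rightarrow> nat"
  assumes "\<And>i. i < q \<Longrightarrow> f i < b" "\<And>i. i < q \<Longrightarrow> g i < b"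
    and "(\<Sum>i<q. f i * b ^ i) = (\<Sum>i<q. g i * b ^ i)" "i < q"
  shows "f i = g i"
  using assms
proof (induction q arbitrary: f g i)
  case (Suc q)
  have shift: "(\<Sum>i<Suc q. f i * b ^ i) = f 0 + b * (\<Sum>i<q. f (Suc i) * b ^ i)" for f
    unfolding sum.lessThan_Suc_shift sum_distrib_left by (simp add: ac_simps)
  have eq: "f 0 + b * (\<Sum>i<q. f (Suc i) * b ^ i) = g 0 + b * (\<Sum>i<q. g (Suc i) * b ^ i)"
    using Suc.prems(3) unfolding shift .
  have b: "f 0 < b" "g 0 < b" using Suc.prems by auto
  have "f 0 = g 0" using arg_cong[OF eq, of "\<lambda>x. x mod b"] b by simp
  moreover have "(\<Sum>i<q. f (Suc i) * b ^ i) = (\<Sum>i<q. g (Suc i) * b ^ i)"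
    using eq b calculation by auto
  then have "f (Suc i) = g (Suc i)" if "i < q" for i
    using Suc.IH[of "\<lambda>i. f (Suc i)" "\<lambda>i. g (Suc i)" i] Suc.prems that by auto
  ultimately show ?case using Suc.prems(4) by (cases i) auto
qed simp

lemma exists_large_power:
  fixes S q l :: nat
  assumes "1 \<le> S" "l < q"
  shows "\<exists>N\<ge>1. S * (q * N + 1) ^ l < (N + 1) ^ q"
proof (intro exI conjI)
  let ?N = "S * q ^ l"
  show "1 \<le> ?N" using assms by (simp add: Suc_le_eq One_nat_def)
  have "S * (q * ?N + 1) ^ l \<le> S * (q * (?N + 1)) ^ l"
    using assms by (intro mult_le_mono2 power_mono) (auto simp: algebra_simps)
  also have "\<dots> = ?N * (?N + 1) ^ l" by (simp only: power_mult_distrib mult.assoc)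
  also have "\<dots> < (?N + 1) * (?N + 1) ^ l" by simp
  also have "\<dots> = (?N + 1) ^ Suc l" by simp
  also have "\<dots> \<le> (?N + 1) ^ q" using assms by (intro power_increasing) auto
  finally show "S * (q * ?N + 1) ^ l < (?N + 1) ^ q" .
qed

locale ferrers =
  fixes n :: nat and lam :: "nat \<Rightarrow> nat"
  assumes n_pos: "1 \<le> n"
    and lam_pos: "\<And>i. 1 \<le> i \<Longrightarrow> i \<le> n \<Longrightarrow> 0 < lam i"
    and noninc: "\<And>i j. 1 \<le> i \<Longrightarrow> i \<le> j \<Longrightarrow> j \<le> n \<Longrightarrow> lam j \<le> lam i"
begin

abbreviation "R \<equiv> ferrers_ring n lam"
abbreviation "V \<equiv> ferrers_vars n lam"
abbreviation "Mon k \<equiv> mons lam n 1 k"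
abbreviation "spread \<equiv> n + lam 1 - 1"

lemma R_subring: "subring (R :: 'k::comm_ring_1 mpoly set)"
  unfolding ferrers_ring_def by (rule subring_poly_ring)

lemma cst_R: "cst c \<in> R"
  unfolding ferrers_ring_def by (rule cst_in_poly_ring)

lemma var_R: "v \<in> V \<Longrightarrow> var v \<in> R"
  unfolding ferrers_ring_def by (rule var_in_poly_ring)

lemma shape_vars: "(i, j) \<in> shape lam n p \<Longrightarrow> 1 \<le> p \<Longrightarrow> X i \<in> V \<and> Y j \<in> V"
  using noninc[of 1 i] by (auto simp: shape_def ferrers_vars_def)

lemma mons_R: "m \<in> Mon k \<Longrightarrow> m \<in> R"
proof (induction k arbitrary: m)
  case (Suc k)
  then obtain i j m' where *: "(i, j) \<in> shape lam n 1" "m' \<in> Mon k" "m = xy i j * m'" by (elim mons_SucE)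
  then have "xy i j \<in> R" unfolding xy_eq_var using shape_vars[of i j 1]
    by (intro subringD(4)[OF R_subring] var_R) auto
  then show ?case using * Suc.IH by (auto intro: subringD(4)[OF R_subring])
qed (simp add: subringD(1)[OF R_subring])

lemma ferrers_ideal_eq: "ferrers_ideal n lam = lin R (Mon 1 :: 'k::comm_ring_1 mpoly set)"
proof -
  have "{xy i j | i j. 1 \<le> i \<and> i \<le> n \<and> 1 \<le> j \<and> j \<le> lam i} = (Mon 1 :: 'k mpoly set)"
    unfolding mons_1 by (auto simp: shape_def)
  moreover have "(Mon 1 :: 'k mpoly set) \<subseteq> R" by (intro subsetI mons_R)
  ultimately show ?thesis unfolding ferrers_ideal_def by (simp only: gen_ideal_eq_lin[OF R_subring])
qed

lemma Mon_Suc_eq: "Mon (Suc k) = {a * b | a b. a \<in> Mon k \<and> b \<in> Mon 1}"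
proof (intro equalityI subsetI)
  fix x :: "'a mpoly" assume "x \<in> Mon (Suc k)"
  then have "x \<in> Mon (k + 1)" by (simp only: Suc_eq_plus1)
  then show "x \<in> {a * b | a b. a \<in> Mon k \<and> b \<in> Mon 1}" by (rule mons_addE) blast
next
  fix x :: "'a mpoly" assume "x \<in> {a * b | a b. a \<in> Mon k \<and> b \<in> Mon 1}"
  then obtain a b where "a \<in> Mon k" "b \<in> Mon 1" "x = a * b" by blast
  then show "x \<in> Mon (Suc k)" using mons_mult_1[of b lam n 1 a k] by (simp add: mult.commute)
qed

lemma ideal_pow_eq: "ideal_pow R (ferrers_ideal n lam) k = lin R (Mon k :: 'k::comm_ring_1 mpoly set)"
proof (induction k)
  case 0
  have "r \<in> lin R {1}" if "r \<in> R" for r :: "'k mpoly" using lin.step[of r R 1 "{1}" 0] that by (simp add: lin.zero)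
  moreover have "lin R {1} \<subseteq> (R :: 'k mpoly set)" 
    using lin_ideal[OF R_subring, of "{1 :: 'k mpoly}"] by (simp add: ideal_in_def subringD(1)[OF R_subring])
  ultimately show ?case by auto
next
  case (Suc k)
  show ?case unfolding ideal_pow.simps Suc Mon_Suc_eq unfolding ferrers_ideal_eq
    by (rule ideal_prod_lin[OF R_subring]) (use mons_R in auto)
qed

definition reduces :: "('k::comm_ring_1) mpoly set \<Rightarrow> nat \<Rightarrow> bool" where
  "reduces J r \<longleftrightarrow> Mon (Suc r) \<subseteq> lin R {a * b | a b. a \<in> J \<and> b \<in> Mon r}"

lemma reduces_iff:
  fixes J :: "'k::comm_ring_1 mpoly set"
  assumes J: "ideal_in R J" "J \<subseteq> ferrers_ideal n lam"
  shows "ideal_pow R (ferrers_ideal n lam) (Suc r) = ideal_prod R J (ideal_pow R (ferrers_ideal n lam) r) \<longleftrightarrow> reduces J r"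
proof -
  let ?S = "{a * b | a b. a \<in> J \<and> b \<in> Mon r}"
  have prod: "ideal_prod R J (ideal_pow R (ferrers_ideal n lam) r) = lin R ?S"
    unfolding ideal_pow_eq by (rule ideal_prod_ideal_lin[OF R_subring J(1)]) (use mons_R in auto)
  have sub: "lin R ?S \<subseteq> lin R (Mon (Suc r))"
  proof (rule lin_subset_lin[OF R_subring], rule subsetI, elim CollectE exE conjE)
    fix x a b assume x: "x = a * b" and a: "a \<in> J" and b: "b \<in> (Mon r :: 'k mpoly set)"
    have "a \<in> lin R (Mon 1)" using J(2) a unfolding ferrers_ideal_eq by blast
    then show "x \<in> lin R (Mon (Suc r))" unfolding x
    proof (rule lin_mult_const[OF R_subring])
      fix s :: "'k mpoly" assume "s \<in> Mon 1"
      then have "s * b \<in> Mon (Suc r)" using b by (rule mons_mult_1)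
      then show "s * b \<in> lin R (Mon (Suc r))" by (intro lin_base[OF R_subring]) simp
    qed
  qed
  have "Mon (Suc r) \<subseteq> lin R ?S" if "lin R (Mon (Suc r)) = lin R ?S"
    unfolding that[symmetric] by (intro subsetI lin_base[OF R_subring])
  moreover have "lin R (Mon (Suc r)) = lin R ?S" if "Mon (Suc r) \<subseteq> lin R ?S"
    using sub by (intro equalityI lin_subset_lin[OF R_subring that])
  ultimately show ?thesis unfolding prod unfolding ideal_pow_eq reduces_def by blast
qed

lemma reduces_add:
  fixes J :: "'k::comm_ring_1 mpoly set"
  assumes "reduces J r"
  shows "reduces J (r + k)"
  unfolding reduces_def
proof
  fix m :: "'k mpoly" assume "m \<in> Mon (Suc (r + k))"
  then have "m \<in> Mon (Suc r + k)" by simp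
  then obtain a b where ab: "a \<in> Mon (Suc r)" "b \<in> Mon k" "m = a * b" by (rule mons_addE)
  have "a \<in> lin R {a * b | a b. a \<in> J \<and> b \<in> Mon r}" using assms ab(1) unfolding reduces_def by blast
  then show "m \<in> lin R {a * b | a b. a \<in> J \<and> b \<in> Mon (r + k)}" unfolding ab(3)
  proof (rule lin_mult_const[OF R_subring])
    fix s assume "s \<in> {a * b | a b. a \<in> J \<and> b \<in> Mon r}"
    then obtain x y where "s = x * y" "x \<in> J" "y \<in> Mon r" by blast
    then show "s * b \<in> lin R {a * b | a b. a \<in> J \<and> b \<in> Mon (r + k)}"
      using mons_mult[OF _ ab(2), of y r]
      by (intro lin_base[OF R_subring] CollectI exI[of _ x] exI[of _ "y * b"]) (simp add: mult.assoc)
  qed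
qed

lemma mons_deg:
  assumes "m \<in> mons lam' n' p k"
  shows "\<exists>u. m = Poly_Mapping.single u 1 \<and> deg u = 2 * k"
  using assms
proof (induction k arbitrary: m)
  case 0
  then show ?case by (intro exI[of _ 0]) auto
next
  case (Suc k)
  then obtain i j m' where m: "m' \<in> mons lam' n' p k" "m = xy i j * m'" by (elim mons_SucE)
  obtain u where "m' = Poly_Mapping.single u 1" "deg u = 2 * k" using Suc.IH[OF m(1)] by blast
  then show ?case using m
    by (intro exI[of _ "Poly_Mapping.single (X i) 1 + Poly_Mapping.single (Y j) 1 + u"])
       (auto simp: xy_def mult_single)
qed

lemma order_ge_mons: "m \<in> mons lam' n' p k \<Longrightarrow> order_ge (2 * k) m"
  using mons_deg[of m lam' n' p k] by (auto simp: order_ge_def)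

lemma hcomp_mons: "m \<in> mons lam' n' p k \<Longrightarrow> hcomp (2 * k) m = m"
proof -
  assume "m \<in> mons lam' n' p k"
  then obtain u where "m = Poly_Mapping.single u 1" "deg u = 2 * k" using mons_deg by blast
  then show ?thesis by (intro poly_mapping_eqI) (auto simp: lookup_hcomp lookup_single when_def)
qed

lemma lin_mons_hcomp:
  fixes f :: "'k::field mpoly"
  assumes "f \<in> lin R (Mon k)"
  shows "order_ge (2 * k) f \<and> hcomp (2 * k) f \<in> vs.span (Mon k) \<and>
    f - hcomp (2 * k) f \<in> lin R {var v * m | v m. v \<in> V \<and> m \<in> Mon k}"
  using assms
proof induction
  case zero
  show ?case by (simp add: order_ge_def vs.span_zero lin.zero)
next
  case (step r m x)
  let ?S = "{var v * m | v m. v \<in> V \<and> m \<in> (Mon k :: 'k mpoly set)}"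
  have om: "order_ge (2 * k) (r * m)"
    using order_ge_mult[OF order_ge_0 order_ge_mons[OF step.hyps(2)], of r] by simp
  have hm: "hcomp (2 * k) (r * m) = cst (lookup r 0) * m"
    using hcomp_mult[OF order_ge_0 order_ge_mons[OF step.hyps(2)], of r]
    by (simp add: hcomp_0 hcomp_mons[OF step.hyps(2)])
  have "r - cst (lookup r 0) \<in> lin R (var ` {v \<in> V. True})" unfolding ferrers_ring_def
  proof (rule poly_ring_in_lin)
    show "r - cst (lookup r 0) \<in> poly_ring V"
      using subringD(3)[OF R_subring step.hyps(1) cst_R] unfolding ferrers_ring_def .
    fix u assume "u \<in> keys (r - cst (lookup r 0))"
    then have "u \<noteq> 0" by (auto simp: in_keys_iff lookup_minus)
    then have "keys u \<noteq> {}" by simp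
    then show "\<exists>v\<in>keys u. True" by blast
  qed
  then have h: "(r - cst (lookup r 0)) * m \<in> lin R ?S"
  proof (rule lin_mult_const[OF R_subring])
    fix s :: "'k mpoly" assume "s \<in> var ` {v \<in> V. True}"
    then show "s * m \<in> lin R ?S" using step.hyps(2) by (intro lin_base[OF R_subring]) auto
  qed
  have eq: "r * m + x - hcomp (2 * k) (r * m + x) = (r - cst (lookup r 0)) * m + (x - hcomp (2 * k) x)"
    unfolding hcomp_add hm by (simp add: algebra_simps)
  have "r * m + x - hcomp (2 * k) (r * m + x) \<in> lin R ?S"
    unfolding eq by (rule lin_add[OF h step.IH[THEN conjunct2, THEN conjunct2]])
  moreover have "hcomp (2 * k) (r * m + x) \<in> vs.span (Mon k)"
    using step by (simp add: hm vs.span_add vs.span_scale vs.span_base)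
  ultimately show ?case using om step.IH order_ge_add by blast
qed

lemma ideal_order_ge: "f \<in> ferrers_ideal n lam \<Longrightarrow> order_ge 2 f" for f :: "'k::field mpoly"
  using lin_mons_hcomp[of f 1] by (simp add: ferrers_ideal_eq)

lemma reduces_initial:
  fixes J :: "'k::field mpoly set"
  assumes J: "J \<subseteq> ferrers_ideal n lam" and red: "reduces J r"
  shows "Mon (Suc r) \<subseteq> vs.span {l * m | l m. l \<in> hcomp 2 ` J \<and> m \<in> Mon r}" (is "_ \<subseteq> vs.span ?T")
proof
  fix m :: "'k mpoly" assume m: "m \<in> Mon (Suc r)"
  have "m \<in> lin R {a * b | a b. a \<in> J \<and> b \<in> Mon r}" using red m unfolding reduces_def by blast
  then have "hcomp (2 * Suc r) m \<in> vs.span ?T"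
  proof induction
    case (step c s x)
    then obtain a b where s: "s = a * b" "a \<in> J" "b \<in> Mon r" by blast
    have oa: "order_ge 2 a" using s J ideal_order_ge by blast
    have "hcomp (2 + 2 * r) (a * b) = hcomp 2 a * b"
      using hcomp_mult[OF oa order_ge_mons[OF s(3)]] hcomp_mons[OF s(3)] by simp
    moreover have "hcomp (0 + (2 + 2 * r)) (c * (a * b)) = hcomp 0 c * hcomp (2 + 2 * r) (a * b)"
      by (rule hcomp_mult[OF order_ge_0 order_ge_mult[OF oa order_ge_mons[OF s(3)]]])
    ultimately have "hcomp (2 * Suc r) (c * s) = cst (lookup c 0) * (hcomp 2 a * b)"
      by (simp add: s(1) hcomp_0)
    moreover have "hcomp 2 a * b \<in> vs.span ?T" using s by (intro vs.span_base) blast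
    ultimately show ?case using step.IH by (simp add: vs.span_add vs.span_scale)
  qed (simp add: vs.span_zero)
  then show "m \<in> vs.span ?T" using hcomp_mons[OF m] by simp
qed

lemma reduces_of_initial:
  fixes J :: "'k::field mpoly set"
  assumes J: "ideal_in R J" "J \<subseteq> ferrers_ideal n lam" and red: "reduces J k"
    and L: "0 \<in> L" "Mon (Suc k) \<subseteq> vs.span {l * m | l m. l \<in> L \<and> m \<in> Mon k}" "L \<subseteq> hcomp 2 ` J"
  shows "reduces {f \<in> J. hcomp 2 f \<in> L} k"
  unfolding reduces_def
proof
  let ?J' = "{f \<in> J. hcomp 2 f \<in> L}"
  let ?T = "{a * b | a b. a \<in> ?J' \<and> b \<in> (Mon k :: 'k mpoly set)}"
  have varJ: "var v * a \<in> ?J'" if "v \<in> V" "a \<in> J" for v a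
  proof -
    have "order_ge 1 (var v)" by (simp add: order_ge_def var_def)
    moreover have "order_ge 2 a" using that J(2) ideal_order_ge by blast
    ultimately have "order_ge (1 + 2) (var v * a)" by (rule order_ge_mult)
    then have "hcomp 2 (var v * a) = 0" by (intro hcomp_eq_0) (simp add: numeral_3_eq_3 numeral_2_eq_2)
    moreover have "var v * a \<in> J"
      using J(1) var_R[OF that(1)] that(2) unfolding ideal_in_def by blast
    ultimately show ?thesis using L(1) by simp
  qed
  have varM: "var v * m \<in> lin R ?T" if v: "v \<in> V" and m: "m \<in> Mon (Suc k)" for v m
  proof -
    have "m \<in> lin R {a * b | a b. a \<in> J \<and> b \<in> Mon k}" using red m unfolding reduces_def by blast
    then have "m * var v \<in> lin R ?T"
    proof (rule lin_mult_const[OF R_subring])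
      fix s assume "s \<in> {a * b | a b. a \<in> J \<and> b \<in> (Mon k :: 'k mpoly set)}"
      then obtain a b where s: "s = a * b" "a \<in> J" "b \<in> (Mon k :: 'k mpoly set)" by blast
      then show "s * var v \<in> lin R ?T" using varJ[OF v s(2)]
        by (intro lin_base[OF R_subring] CollectI exI[of _ "var v * a"] exI[of _ b]) (simp add: ac_simps)
    qed
    then show ?thesis by (simp add: mult.commute)
  qed
  have gen: "l * m \<in> lin R ?T" if l: "l \<in> L" and m: "m \<in> Mon k" for l m
  proof -
    obtain a where a: "a \<in> J" "l = hcomp 2 a" using L(3) l by blast
    have "a \<in> lin R (Mon 1)" using a J(2) unfolding ferrers_ideal_eq by blast
    then have "a - l \<in> lin R {var v * m | v m. v \<in> V \<and> m \<in> (Mon 1 :: 'k mpoly set)}"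
      using lin_mons_hcomp[of a 1] a(2) by simp
    then have 1: "(a - l) * m \<in> lin R ?T"
    proof (rule lin_mult_const[OF R_subring])
      fix s assume "s \<in> {var v * m | v m. v \<in> V \<and> m \<in> (Mon 1 :: 'k mpoly set)}"
      then obtain v m' where s: "s = var v * m'" "v \<in> V" "m' \<in> (Mon 1 :: 'k mpoly set)" by blast
      have "m' * m \<in> Mon (Suc k)" using s(3) m by (rule mons_mult_1)
      then show "s * m \<in> lin R ?T" using varM[OF s(2), of "m' * m"] by (simp add: s(1) mult.assoc)
    qed
    have 2: "a * m \<in> lin R ?T" using a l m by (intro lin_base[OF R_subring]) blast
    show ?thesis using lin_diff[OF R_subring 2 1] by (simp add: algebra_simps)
  qed
  fix M :: "'k mpoly" assume "M \<in> Mon (Suc k)"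
  then have "M \<in> vs.span {l * m | l m. l \<in> L \<and> m \<in> Mon k}" using L(2) by blast
  then show "M \<in> lin R ?T" unfolding ferrers_ring_def
  proof (rule span_subset_lin)
    fix s assume "s \<in> {l * m | l m. l \<in> L \<and> m \<in> (Mon k :: 'k mpoly set)}"
    then obtain l m where "s = l * m" "l \<in> L" "m \<in> (Mon k :: 'k mpoly set)" by blast
    then show "s \<in> lin (poly_ring V) ?T" using gen unfolding ferrers_ring_def by blast
  qed
qed

definition diag_at :: "nat \<Rightarrow> ('k::comm_ring_1) mpoly" where
  "diag_at i = diag lam n 1 (int i - int (n - 1))"

lemma diag_out_of_range: "\<not> (- int (n - 1) \<le> d \<and> d < int (lam 1)) \<Longrightarrow> diag lam n 1 d = 0"
proof -
  assume d: "\<not> (- int (n - 1) \<le> d \<and> d < int (lam 1))"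
  have "diag_cells lam n 1 d = {}"
  proof (rule ccontr)
    assume "diag_cells lam n 1 d \<noteq> {}"
    then obtain i j where "(i, j) \<in> shape lam n 1" "int j - int i = d" by (auto simp: diag_cells_def)
    then show False using d noninc[of 1 i] by (auto simp: shape_def)
  qed
  then show ?thesis by (simp add: diag_def)
qed

lemma diag_cases: "diag lam n 1 d = 0 \<or> (\<exists>i<spread. diag lam n 1 d = diag_at i)"
proof (cases "- int (n - 1) \<le> d \<and> d < int (lam 1)")
  case True
  then have "nat (d + int (n - 1)) < spread" "int (nat (d + int (n - 1))) - int (n - 1) = d" using n_pos by auto
  then show ?thesis unfolding diag_at_def by metis
qed (use diag_out_of_range in blast)

lemma diag_span: "diag lam n p d \<in> vs.span (mons lam n p 1 :: 'k::field mpoly set)"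
  unfolding diag_def
proof (rule vs.span_sum)
  fix c assume "c \<in> diag_cells lam n p d"
  then obtain i j where "c = (i, j)" "(i, j) \<in> shape lam n p" by (auto simp: diag_cells_def)
  then show "(case c of (i, j) \<Rightarrow> xy i j) \<in> vs.span (mons lam n p 1 :: 'k mpoly set)"
    by (intro vs.span_base) (auto simp: mons_1)
qed

abbreviation "diag_ideal \<equiv> lin R (Set.range (diag lam n 1))"

lemma diag_in_R: "diag lam n 1 d \<in> (R :: 'k::field mpoly set)"
proof -
  have "diag lam n 1 d \<in> lin (poly_ring V) (Mon 1 :: 'k mpoly set)"
    by (rule span_subset_lin[OF diag_span]) (rule lin_base[OF subring_poly_ring])
  then show ?thesis
    using lin_ideal[OF R_subring, of "Mon 1 :: 'k mpoly set"] mons_R unfolding ferrers_ring_def ideal_in_def by blast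
qed

lemma diag_ideal_ideal: "ideal_in R (diag_ideal :: 'k::field mpoly set)"
  by (rule lin_ideal[OF R_subring]) (auto intro: diag_in_R)

lemma mons_span_diag:
  "Mon k \<subseteq> vs.span (strict_mons lam n 1 k \<union> {diag_at i * m | i m j'. i < spread \<and> k = Suc j' \<and> m \<in> (Mon j' :: 'k::field mpoly set)})"
  (is "_ \<subseteq> vs.span ?S")
proof (rule mons_straighten)
  show "strict_mons lam n 1 k \<subseteq> vs.span ?S" by (rule order_trans[OF _ vs.span_superset]) simp
  show "diag lam n 1 d * m \<in> vs.span ?S" if "k = Suc k'" "m \<in> Mon k'" for d m k'
    using diag_cases[of d, where 'a = 'k]
  proof
    assume "\<exists>i<spread. diag lam n 1 d = (diag_at i :: 'k mpoly)"
    then obtain i where "i < spread" "diag lam n 1 d = (diag_at i :: 'k mpoly)" by blast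
    then show ?thesis using that by (intro vs.span_base UnI2 CollectI exI[of _ i] exI[of _ m] exI[of _ k']) simp
  qed (simp add: vs.span_zero)
qed (simp_all add: noninc vs.span_zero vs.span_diff)

lemma strict_num_zero: "n \<le> k \<Longrightarrow> strict_num lam n 1 k = 0"
  using strict_num_pos_iff[of n lam 1 k] n_pos noninc by fastforce

lemma strict_num_pos_less: "0 < strict_num lam n 1 k \<Longrightarrow> k < n"
  using strict_num_zero[of k] by (cases "n \<le> k") auto

lemma card_Mon_le_power:
  "card (Mon k :: 'k::field mpoly set) \<le> (\<Sum>j<n. strict_num lam n 1 j) * (k + 1) ^ (spread - 1)"
proof -
  have sp: "spread = Suc (spread - 1)" using n_pos lam_pos[of 1] by simp
  have "card (Mon k :: 'k mpoly set) \<le> (\<Sum>j=0..k. card (strict_mons lam n 1 j :: 'k mpoly set) * multiset_num spread (k - j))"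
    by (rule card_mons_le[OF finite_strict_mons mons_span_diag])
  also have "\<dots> \<le> (\<Sum>j=0..k. strict_num lam n 1 j * (k + 1) ^ (spread - 1))"
  proof (intro sum_mono mult_le_mono card_strict_mons_le)
    fix j
    have "multiset_num spread (k - j) \<le> (k - j + 1) ^ (spread - 1)"
      using multiset_num_le[of "spread - 1" "k - j"] sp by simp
    also have "\<dots> \<le> (k + 1) ^ (spread - 1)" by (rule power_mono) auto
    finally show "multiset_num spread (k - j) \<le> (k + 1) ^ (spread - 1)" .
  qed
  also have "\<dots> = (\<Sum>j=0..k. strict_num lam n 1 j) * (k + 1) ^ (spread - 1)" by (simp add: sum_distrib_right)
  also have "(\<Sum>j=0..k. strict_num lam n 1 j) \<le> (\<Sum>j<n. strict_num lam n 1 j)"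
  proof -
    have "(\<Sum>j=0..k. strict_num lam n 1 j) = (\<Sum>j\<in>{0..k} \<inter> {..<n}. strict_num lam n 1 j)"
      by (rule sum.mono_neutral_right) (auto dest: strict_num_pos_less)
    also have "\<dots> \<le> (\<Sum>j<n. strict_num lam n 1 j)" by (rule sum_mono2) auto
    finally show ?thesis .
  qed
  finally show ?thesis by simp
qed

end

section \<open>The lower bound for minimal reductions\<close>

lemma span_mult_in:
  fixes A B C :: "'k::field mpoly set"
  assumes "a \<in> vs.span A" "b \<in> vs.span B" "\<And>x y. x \<in> A \<Longrightarrow> y \<in> B \<Longrightarrow> x * y \<in> vs.span C"
  shows "a * b \<in> vs.span C"
proof -
  have "{x * y | x y. x \<in> A \<and> y \<in> B} \<subseteq> vs.span C" using assms(3) by blast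
  then have "vs.span {x * y | x y. x \<in> A \<and> y \<in> B} \<subseteq> vs.span C" by (rule vs.span_minimal[OF _ vs.subspace_span])
  then show ?thesis using span_mult[OF assms(1,2)] by blast
qed

context ferrers
begin

lemma span_Mon_mult:
  "a \<in> vs.span (Mon i :: 'k::field mpoly set) \<Longrightarrow> b \<in> vs.span (Mon j) \<Longrightarrow> a * b \<in> vs.span (Mon (i + j))"
  by (rule span_mult_in) (blast intro: vs.span_base mons_mult)+

text \<open>By counting, more than \<open>spread\<close> linear forms satisfy a polynomial relation. After a generic
  change of coordinates it is monic in the last form, which can then be dropped.\<close>

lemma shrink_space:
  fixes L B :: "'k::field mpoly set"
  assumes inf: "infinite (UNIV :: 'k set)"
    and L1: "L \<subseteq> vs.span (Mon 1)"
    and gen: "Mon (Suc r) \<subseteq> vs.span {l * m | l m. l \<in> L \<and> m \<in> Mon r}"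
    and B: "vs.independent B" "finite B" "vs.span B = L" "spread < card B"
  shows "\<exists>L' k. vs.subspace L' \<and> L' \<subset> L \<and> r \<le> k \<and> Mon (Suc k) \<subseteq> vs.span {l * m | l m. l \<in> L' \<and> m \<in> Mon k}"
proof -
  obtain q where q: "card B = Suc q" "spread \<le> q" using B(4) by (cases "card B") auto
  obtain b where b: "bij_betw b {..<Suc q} B"
    using ex_bij_betw_nat_finite[OF B(2)] q(1) by (auto simp: atLeast0LessThan)
  have bB: "b i \<in> B" if "i \<le> q" for i using bij_betwE[OF b] that by simp
  have bL: "b i \<in> L" if "i \<le> q" for i using vs.span_base[OF bB[OF that]] B(3) by simp
  have b1: "b i \<in> vs.span (Mon 1)" if "i \<le> q" for i using bL[OF that] L1 by blast
  define S where "S = (\<Sum>j<n. strict_num lam n 1 j)"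
  have S: "1 \<le> S"
  proof -
    have "strict_num lam n 1 0 \<le> S" unfolding S_def by (rule member_le_sum) (use n_pos in auto)
    then show ?thesis by simp
  qed
  have sp: "1 \<le> spread" using n_pos lam_pos[of 1] by simp
  have spq: "spread - 1 < q" using q(2) sp by linarith
  obtain N where N: "1 \<le> N" "S * (q * N + 1) ^ (spread - 1) < (N + 1) ^ q"
    using exists_large_power[OF S spq] by blast
  define k0 where "k0 = q * N"
  have k0: "1 \<le> k0" using mult_le_mono[of 1 q 1 N] N(1) q(2) sp by (simp add: k0_def)
  define \<Gamma> where "\<Gamma> = ({..<q} \<rightarrow>\<^sub>E {..N})"
  have finG: "finite \<Gamma>" unfolding \<Gamma>_def by (intro finite_PiE) auto
  have cardG: "card \<Gamma> = (N + 1) ^ q" by (simp add: \<Gamma>_def card_PiE Suc_eq_plus1)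
  define f where "f \<gamma> = (\<Prod>i<q. b i ^ \<gamma> i) * b q ^ (k0 - (\<Sum>i<q. \<gamma> i))" for \<gamma>
  have sum_le: "(\<Sum>i<q. \<gamma> i) \<le> k0" if "\<gamma> \<in> \<Gamma>" for \<gamma>
  proof -
    have "(\<Sum>i<q. \<gamma> i) \<le> (\<Sum>i<q. N)" using that by (intro sum_mono) (auto simp: \<Gamma>_def)
    then show ?thesis by (simp add: k0_def)
  qed
  have F_power: "a ^ e \<in> vs.span (Mon e)" if "a \<in> vs.span (Mon 1)" for a :: "'k mpoly" and e
  proof (induction e)
    case (Suc e)
    show ?case using span_Mon_mult[OF that Suc] by (simp only: power_Suc plus_1_eq_Suc)
  qed (simp add: vs.span_base)
  have F_prod: "(\<Prod>i<l. b i ^ \<gamma> i) \<in> vs.span (Mon (\<Sum>i<l. \<gamma> i))" if "l \<le> q" for l \<gamma>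
    using that
  proof (induction l)
    case (Suc l)
    show ?case using span_Mon_mult[OF Suc.IH F_power[OF b1, of l "\<gamma> l"]] Suc.prems by simp
  qed (simp add: vs.span_base)
  have fF: "f \<gamma> \<in> vs.span (Mon k0)" if "\<gamma> \<in> \<Gamma>" for \<gamma>
    using span_Mon_mult[OF F_prod F_power[OF b1], of q q \<gamma> "k0 - (\<Sum>i<q. \<gamma> i)"] sum_le[OF that]
    by (simp add: f_def)
  have "\<exists>g. (\<exists>i\<in>\<Gamma>. g i \<noteq> 0) \<and> (\<Sum>i\<in>\<Gamma>. cst (g i) * f i) = 0"
  proof (rule finite_linear_relation[OF finG finite_mons])
    show "f ` \<Gamma> \<subseteq> vs.span (Mon k0)" using fF by blast
    show "card (Mon k0 :: 'k mpoly set) < card \<Gamma>"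
      using card_Mon_le_power[of k0, where 'k = 'k] N(2) unfolding cardG S_def k0_def by linarith
  qed
  then obtain g where g: "\<exists>\<gamma>\<in>\<Gamma>. g \<gamma> \<noteq> 0" "(\<Sum>\<gamma>\<in>\<Gamma>. cst (g \<gamma>) * f \<gamma>) = 0" by blast
  define e where "e \<gamma> = (\<Sum>i<q. \<gamma> i * (N + 1) ^ i)" for \<gamma> :: "nat \<Rightarrow> nat"
  have e_inj: "\<gamma> = \<delta>" if "\<gamma> \<in> \<Gamma>" "\<delta> \<in> \<Gamma>" "e \<gamma> = e \<delta>" for \<gamma> \<delta>
  proof (rule PiE_ext[of \<gamma> "{..<q}" "\<lambda>_. {..N}"])
    fix i assume "i \<in> {..<q}"
    have "\<gamma> j < N + 1" "\<delta> j < N + 1" if "j < q" for j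
      using PiE_mem[OF \<open>\<gamma> \<in> \<Gamma>\<close>[unfolded \<Gamma>_def], of j] PiE_mem[OF \<open>\<delta> \<in> \<Gamma>\<close>[unfolded \<Gamma>_def], of j] that by auto
    then show "\<gamma> i = \<delta> i" using digits_unique[of q \<gamma> "N + 1" \<delta> i] that(3) \<open>i \<in> {..<q}\<close> by (simp add: e_def)
  qed (use that in \<open>auto simp: \<Gamma>_def\<close>)
  define D where "D = (\<Sum>\<gamma>\<in>\<Gamma>. monom (g \<gamma>) (e \<gamma>))"
  have "D \<noteq> 0"
  proof -
    obtain \<gamma> where \<gamma>: "\<gamma> \<in> \<Gamma>" "g \<gamma> \<noteq> 0" using g(1) by blast
    have "coeff D (e \<gamma>) = (\<Sum>\<delta>\<in>\<Gamma>. if \<delta> = \<gamma> then g \<gamma> else 0)"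
      unfolding D_def coeff_sum by (rule sum.cong) (use e_inj \<gamma> in auto)
    then have "coeff D (e \<gamma>) = g \<gamma>" using \<gamma> finG by simp
    then show ?thesis using \<gamma> by auto
  qed
  then have "finite {t. poly D t = 0}" by (rule poly_roots_finite)
  then obtain t where t: "poly D t \<noteq> 0" using ex_new_if_finite[OF inf] by blast
  define u where "u i = t ^ ((N + 1) ^ i)" for i
  define w where "w = b q"
  define G where "G = (\<lambda>i. b i - cst (u i) * w) ` {..<q}"
  define L' where "L' = vs.span G"
  define Q where "Q j = vs.span {l * m | l m j'. l \<in> L' \<and> m \<in> (Mon j' :: 'k mpoly set) \<and> j = Suc j'}" for j
  have wL: "w \<in> L" and w1: "w \<in> vs.span (Mon 1)" using bL b1 by (simp_all add: w_def)
  have subL: "vs.subspace L" using B(3) vs.subspace_span[of B] by simp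
  have L'L: "L' \<subseteq> L" unfolding L'_def
  proof (rule vs.span_minimal[OF _ subL])
    show "G \<subseteq> L" unfolding G_def using bL wL vs.subspace_diff[OF subL] vs.subspace_scale[OF subL] by auto
  qed
  have "L' \<noteq> L"
  proof
    assume "L' = L"
    then have "B \<subseteq> vs.span G" using vs.span_superset[of B] B(3) by (simp add: L'_def)
    moreover have fG: "finite G" by (simp add: G_def)
    ultimately have "card B \<le> card G" using vs.independent_span_bound[OF fG B(1)] by blast
    also have "\<dots> \<le> q" unfolding G_def by (rule order_trans[OF card_image_le]) auto
    finally show False using q by simp
  qed
  have QF: "x * y \<in> Q (i + j)" if "x \<in> Q i" "y \<in> vs.span (Mon j)" for x y i j
    using that unfolding Q_def
  proof (rule span_mult_in)
    fix x' y' assume "x' \<in> {l * m | l m j'. l \<in> L' \<and> m \<in> (Mon j' :: 'k mpoly set) \<and> i = Suc j'}"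
      and y': "y' \<in> (Mon j :: 'k mpoly set)"
    then obtain l m j' where x': "x' = l * m" "l \<in> L'" "m \<in> (Mon j' :: 'k mpoly set)" "i = Suc j'" by blast
    have "m * y' \<in> Mon (j' + j)" using x'(3) y' by (rule mons_mult)
    then show "x' * y' \<in> vs.span {l * m | l m j'. l \<in> L' \<and> m \<in> (Mon j' :: 'k mpoly set) \<and> i + j = Suc j'}"
      using x' by (intro vs.span_base CollectI exI[of _ l] exI[of _ "m * y'"] exI[of _ "j' + j"]) (simp add: mult.assoc)
  qed
  have Qsub: "vs.subspace (Q j)" for j unfolding Q_def by (rule vs.subspace_span)
  define good where "good j c x \<longleftrightarrow> x \<in> vs.span (Mon j) \<and> x - cst c * w ^ j \<in> Q j" for j c x
  have good_mult: "good (i + j) (c * d) (x * y)" if "good i c x" "good j d y" for i j c d x y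
  proof -
    have "x * y - (a * a') * (v * v') = (x - a * v) * y + a * ((y - a' * v') * v)" for a a' v v' :: "'k mpoly"
      by (simp add: algebra_simps)
    from this[of "cst c" "cst d" "w ^ i" "w ^ j"]
    have eq: "x * y - cst (c * d) * w ^ (i + j) = (x - cst c * w ^ i) * y + cst c * ((y - cst d * w ^ j) * w ^ i)"
      unfolding mult_single power_add by simp
    have 1: "(x - cst c * w ^ i) * y \<in> Q (i + j)" using that QF[of "x - cst c * w ^ i" i y j] unfolding good_def by simp
    have 2: "(y - cst d * w ^ j) * w ^ i \<in> Q (i + j)"
      using that QF[of "y - cst d * w ^ j" j "w ^ i" i] F_power[OF w1] unfolding good_def by (simp add: add.commute)
    have "x * y - cst (c * d) * w ^ (i + j) \<in> Q (i + j)"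
      unfolding eq by (rule vs.subspace_add[OF Qsub 1 vs.subspace_scale[OF Qsub 2]])
    then show ?thesis using that span_Mon_mult[of x i y j] unfolding good_def by simp
  qed
  have good0: "good 0 1 1"
  proof -
    have "(1 :: 'k mpoly) \<in> vs.span (Mon 0)" by (rule vs.span_base) simp
    moreover have "1 - cst 1 * w ^ 0 = 0" by simp
    ultimately show ?thesis unfolding good_def using vs.subspace_0[OF Qsub] by metis
  qed
  have good_power: "good e (c ^ e) (x ^ e)" if "good 1 c x" for c x e
  proof (induction e)
    case (Suc e)
    show ?case using good_mult[OF that Suc] by (simp only: power_Suc plus_1_eq_Suc)
  qed (simp add: good0)
  have GQ: "l \<in> Q 1" if "l \<in> L'" for l unfolding Q_def
    by (rule vs.span_base) (use that in \<open>auto simp: One_nat_def intro!: exI[of _ l] exI[of _ "1 :: 'k mpoly"] exI[of _ "0 :: nat"]\<close>)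
  have good_b: "good 1 (u i) (b i)" if "i < q" for i
  proof -
    have "b i - cst (u i) * w \<in> L'" unfolding L'_def G_def by (rule vs.span_base) (use that in auto)
    then show ?thesis using b1[of i] that GQ unfolding good_def by simp
  qed
  have good_w: "good 1 1 w" unfolding good_def using w1 vs.subspace_0[OF Qsub] by simp
  have good_prod: "good (\<Sum>i<l. \<gamma> i) (\<Prod>i<l. u i ^ \<gamma> i) (\<Prod>i<l. b i ^ \<gamma> i)" if "l \<le> q" for l \<gamma>
    using that
  proof (induction l)
    case (Suc l)
    show ?case using good_mult[OF Suc.IH good_power[OF good_b, of l "\<gamma> l"]] Suc.prems by simp
  qed (simp add: good0)
  have good_f: "good k0 (\<Prod>i<q. u i ^ \<gamma> i) (f \<gamma>)" if "\<gamma> \<in> \<Gamma>" for \<gamma>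
    using good_mult[OF good_prod good_power[OF good_w], of q \<gamma> "k0 - (\<Sum>i<q. \<gamma> i)"] sum_le[OF that]
    by (simp add: f_def w_def)
  have u_prod: "(\<Prod>i<q. u i ^ \<gamma> i) = t ^ e \<gamma>" for \<gamma>
    by (simp add: u_def e_def power_mult[symmetric] power_sum mult.commute)
  have "(\<Sum>\<gamma>\<in>\<Gamma>. cst (g \<gamma>) * (f \<gamma> - cst (t ^ e \<gamma>) * w ^ k0)) \<in> Q k0"
    using good_f unfolding good_def u_prod
    by (intro vs.subspace_sum[OF Qsub] vs.subspace_scale[OF Qsub]) blast
  also have "(\<Sum>\<gamma>\<in>\<Gamma>. cst (g \<gamma>) * (f \<gamma> - cst (t ^ e \<gamma>) * w ^ k0))
      = (\<Sum>\<gamma>\<in>\<Gamma>. cst (g \<gamma>) * f \<gamma>) - (\<Sum>\<gamma>\<in>\<Gamma>. cst (g \<gamma> * t ^ e \<gamma>)) * w ^ k0"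
    by (simp add: sum_distrib_right sum_subtractf right_diff_distrib mult.assoc[symmetric] mult_single)
  also have "(\<Sum>\<gamma>\<in>\<Gamma>. cst (g \<gamma> * t ^ e \<gamma>)) = cst (poly D t)"
  proof -
    have "(\<Sum>\<gamma>\<in>\<Gamma>. cst (h \<gamma>)) = cst (\<Sum>\<gamma>\<in>\<Gamma>. h \<gamma>)" for h :: "_ \<Rightarrow> 'k"
      using finG by (induction \<Gamma> rule: finite_induct) (auto simp: single_add)
    then show ?thesis by (simp add: D_def poly_sum poly_monom)
  qed
  finally have "- (cst (poly D t) * w ^ k0) \<in> Q k0" unfolding g(2) by simp
  then have "cst (- inverse (poly D t)) * - (cst (poly D t) * w ^ k0) \<in> Q k0" by (rule vs.subspace_scale[OF Qsub])
  then have wQ: "w ^ k0 \<in> Q k0"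
    using t by (simp add: mult.assoc[symmetric] mult_single single_uminus[symmetric])
  have L_dec: "\<exists>c. l - cst c * w \<in> L'" if "l \<in> L" for l
  proof -
    have "B \<subseteq> vs.span (insert w G)"
    proof
      fix x assume "x \<in> B"
      then have "x \<in> b ` {..<Suc q}" using bij_betw_imp_surj_on[OF b] by simp
      then obtain i where i: "i < Suc q" "x = b i" by auto
      show "x \<in> vs.span (insert w G)"
      proof (cases "i = q")
        case True
        then show ?thesis using i by (intro vs.span_base) (simp add: w_def)
      next
        case False
        then have "b i - cst (u i) * w \<in> vs.span (insert w G)" using i by (intro vs.span_base) (auto simp: G_def)
        moreover have "cst (u i) * w \<in> vs.span (insert w G)" by (intro vs.span_scale vs.span_base) simp
        ultimately show ?thesis using vs.span_add[of "b i - cst (u i) * w" _ "cst (u i) * w"] i by simp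
      qed
    qed
    then have "vs.span B \<subseteq> vs.span (insert w G)" by (rule vs.span_minimal[OF _ vs.subspace_span])
    then have "l \<in> vs.span (insert w G)" using that B(3) by blast
    then show ?thesis unfolding vs.span_insert L'_def by simp
  qed
  have "Mon (r + j) \<subseteq> vs.span ({w ^ j * m | m. m \<in> Mon r} \<union> Q (r + j))" for j
  proof (induction j)
    case 0
    show ?case by (rule order_trans[OF _ vs.span_superset]) auto
  next
    case (Suc j)
    let ?A = "{w ^ j * m | m. m \<in> Mon r} \<union> Q (r + j)"
    let ?C = "{w ^ Suc j * m | m. m \<in> Mon r} \<union> Q (r + Suc j)"
    have wA: "w * x \<in> vs.span ?C" if x: "x \<in> vs.span ?A" for x
      using x
    proof (induction rule: vs.span_induct_alt)
      case (step c x y)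
      have "w * x \<in> ?C"
      proof (cases "x \<in> Q (r + j)")
        case True
        then show ?thesis using QF[OF True w1] by (simp add: mult.commute Suc_eq_plus1 add.assoc)
      next
        case False
        then obtain m where "x = w ^ j * m" "m \<in> Mon r" using step.hyps by blast
        then show ?thesis by (auto simp: mult.assoc)
      qed
      then have "cst c * (w * x) + w * y \<in> vs.span ?C"
        by (intro vs.span_add[OF vs.span_scale[OF vs.span_base] step.IH])
      then show ?case by (simp add: algebra_simps)
    qed (simp add: vs.span_zero)
    have LA: "l * m \<in> vs.span ?C" if l: "l \<in> L" and m: "m \<in> Mon (r + j)" for l m
    proof -
      obtain c where c: "l - cst c * w \<in> L'" using L_dec[OF l] by blast
      have "(l - cst c * w) * m \<in> Q (1 + (r + j))" by (rule QF[OF GQ[OF c] vs.span_base[OF m]])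
      then have 1: "(l - cst c * w) * m \<in> vs.span ?C" by (intro vs.span_base) (simp add: One_nat_def)
      have "w * m \<in> vs.span ?C" using wA m Suc by blast
      then have "(l - cst c * w) * m + cst c * (w * m) \<in> vs.span ?C" by (intro vs.span_add[OF 1 vs.span_scale])
      then show ?thesis by (simp add: algebra_simps)
    qed
    show ?case
    proof
      fix M :: "'k mpoly" assume "M \<in> Mon (r + Suc j)"
      then have "M \<in> Mon (Suc r + j)" by simp
      then obtain a c where ac: "a \<in> Mon (Suc r)" "c \<in> Mon j" "M = a * c" by (rule mons_addE)
      have "a \<in> vs.span {l * m | l m. l \<in> L \<and> m \<in> Mon r}" using gen ac(1) by blast
      then show "M \<in> vs.span ?C" unfolding ac(3)
      proof (rule span_mult_in[OF _ vs.span_base[of c "{c}"]])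
        fix x y assume "x \<in> {l * m | l m. l \<in> L \<and> m \<in> (Mon r :: 'k mpoly set)}" "y \<in> {c}"
        then obtain l m where lm: "x * y = l * (m * c)" "l \<in> L" "m \<in> (Mon r :: 'k mpoly set)" by (auto simp: mult.assoc)
        show "x * y \<in> vs.span ?C" unfolding lm(1) by (rule LA[OF lm(2) mons_mult[OF lm(3) ac(2)]])
      qed simp
    qed
  qed
  from this[of k0] have "Mon (r + k0) \<subseteq> vs.span (Q (r + k0))"
  proof (rule order_trans)
    have "{w ^ k0 * m | m. m \<in> Mon r} \<subseteq> Q (r + k0)"
    proof clarify
      fix m :: "'k mpoly" assume "m \<in> Mon r"
      then show "w ^ k0 * m \<in> Q (r + k0)" using QF[OF wQ vs.span_base, of m r] by (simp add: add.commute)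
    qed
    then show "vs.span ({w ^ k0 * m | m. m \<in> Mon r} \<union> Q (r + k0)) \<subseteq> vs.span (Q (r + k0))"
      by (intro vs.span_mono) simp
  qed
  then have "Mon (r + k0) \<subseteq> Q (r + k0)" unfolding Q_def vs.span_span .
  then have "Mon (Suc (r + k0 - 1)) \<subseteq> Q (Suc (r + k0 - 1))" using k0 by simp
  moreover have "Q (Suc k) = vs.span {l * m | l m. l \<in> L' \<and> m \<in> Mon k}" for k
    unfolding Q_def by (rule arg_cong[of _ _ vs.span]) auto
  ultimately have "Mon (Suc (r + k0 - 1)) \<subseteq> vs.span {l * m | l m. l \<in> L' \<and> m \<in> Mon (r + k0 - 1)}" by simp
  moreover have "vs.subspace L'" unfolding L'_def by (rule vs.subspace_span)
  ultimately show ?thesis using L'L \<open>L' \<noteq> L\<close> k0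
    by (intro exI[of _ L'] exI[of _ "r + k0 - 1"]) auto
qed

text \<open>For all but finitely many \<open>t\<close>, the forms \<open>diag_at i + t b i\<close> inherit the straightening from the
  diagonals and the generation in degree \<open>k + 1\<close> from \<open>b\<close>.\<close>

lemma strict_num_eq_0_of_span:
  fixes b :: "nat \<Rightarrow> 'k::field mpoly"
  assumes inf: "infinite (UNIV :: 'k set)"
    and b: "\<And>i. i < spread \<Longrightarrow> b i \<in> vs.span (Mon 1)"
    and gen: "Mon (Suc k) \<subseteq> vs.span {b i * m | i m. i < spread \<and> m \<in> Mon k}"
  shows "strict_num lam n 1 (Suc k) = 0"
proof (rule ccontr)
  assume pos: "strict_num lam n 1 (Suc k) \<noteq> 0"
  let ?T = "\<lambda>v j. strict_mons lam n 1 j \<union> {v i * m | i m j'. i < spread \<and> j = Suc j' \<and> m \<in> (Mon j' :: 'k mpoly set)}"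
  have prod_span: "v * m \<in> vs.span (Mon (Suc j))" if "v \<in> vs.span (Mon 1)" "m \<in> Mon j" for v m :: "'k mpoly" and j
    using span_Mon_mult[OF that(1) vs.span_base[OF that(2)]] by (simp only: plus_1_eq_Suc)
  have diag1: "diag_at i \<in> vs.span (Mon 1 :: 'k mpoly set)" for i unfolding diag_at_def by (rule diag_span)
  have exZ: "\<exists>Z. finite Z \<and> (\<forall>t. t \<notin> Z \<longrightarrow> Mon j \<subseteq> vs.span (?T (\<lambda>i. diag_at i + cst t * b i) j))" for j
  proof (cases j)
    case 0
    then show ?thesis using mons_span_diag[of 0, where 'k = 'k] by auto
  next
    case (Suc j')
    define I where "I = Inl ` (strict_mons lam n 1 j :: 'k mpoly set) \<union> Inr ` ({..<spread} \<times> (Mon j' :: 'k mpoly set))"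
    define p where "p = case_sum (\<lambda>x :: 'k mpoly. x) (\<lambda>(i, m). diag_at i * m)"
    define q where "q = case_sum (\<lambda>x :: 'k mpoly. 0) (\<lambda>(i, m). b i * m)"
    have ex: "\<exists>Z. finite Z \<and> (\<forall>t. t \<notin> Z \<longrightarrow> Mon j \<subseteq> vs.span ((\<lambda>i. p i + cst t * q i) ` I))"
    proof (rule span_perturb)
      show "finite I" by (simp add: I_def finite_strict_mons finite_mons)
      show "finite (Mon j :: 'k mpoly set)" by (rule finite_mons)
      show "q i \<in> vs.span (Mon j)" if "i \<in> I" for i
        using that prod_span[OF b] by (auto simp: I_def q_def Suc vs.span_zero)
      have "?T diag_at j \<subseteq> p ` I"
      proof
        fix x assume "x \<in> ?T diag_at j"
        then consider "x \<in> strict_mons lam n 1 j" | i m where "x = diag_at i * m" "i < spread" "m \<in> (Mon j' :: 'k mpoly set)"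
          using Suc by blast
        then show "x \<in> p ` I"
        proof cases
          case 1
          then show ?thesis by (intro image_eqI[of _ _ "Inl x"]) (auto simp: p_def I_def)
        next
          case 2
          then show ?thesis by (intro image_eqI[of _ _ "Inr (i, m)"]) (auto simp: p_def I_def)
        qed
      qed
      then show "Mon j \<subseteq> vs.span (p ` I)" using mons_span_diag[of j, where 'k = 'k] vs.span_mono by blast
    qed
    have sub: "(\<lambda>i. p i + cst t * q i) ` I \<subseteq> ?T (\<lambda>i. diag_at i + cst t * b i) j" for t
    proof (rule image_subsetI)
      fix x assume "x \<in> I"
      then consider y where "x = Inl y" "y \<in> strict_mons lam n 1 j" | i m where "x = Inr (i, m)" "i < spread" "m \<in> Mon j'"
        by (auto simp: I_def)
      then show "p x + cst t * q x \<in> ?T (\<lambda>i. diag_at i + cst t * b i) j"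
      proof cases
        case 1
        then show ?thesis by (simp add: p_def q_def)
      next
        case 2
        have "p x + cst t * q x = (diag_at i + cst t * b i) * m" by (simp add: 2 p_def q_def algebra_simps)
        then show ?thesis using 2 Suc by (intro UnI2 CollectI exI[of _ i] exI[of _ m] exI[of _ j']) simp
      qed
    qed
    obtain Z where Z: "finite Z" "\<And>t. t \<notin> Z \<Longrightarrow> Mon j \<subseteq> vs.span ((\<lambda>i. p i + cst t * q i) ` I)" using ex by blast
    show ?thesis
    proof (intro exI[of _ Z] conjI allI impI Z(1))
      fix t assume "t \<notin> Z"
      show "Mon j \<subseteq> vs.span (?T (\<lambda>i. diag_at i + cst t * b i) j)"
        by (rule order_trans[OF Z(2)[OF \<open>t \<notin> Z\<close>] vs.span_mono[OF sub]])
    qed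
  qed
  define Z where "Z j = (SOME Z. finite Z \<and> (\<forall>t. t \<notin> Z \<longrightarrow> Mon j \<subseteq> vs.span (?T (\<lambda>i. diag_at i + cst t * b i) j)))" for j
  have Z: "finite (Z j)" "t \<notin> Z j \<Longrightarrow> Mon j \<subseteq> vs.span (?T (\<lambda>i. diag_at i + cst t * b i) j)" for j t
    using someI_ex[OF exZ[of j]] unfolding Z_def by simp_all
  define I where "I = {..<spread} \<times> (Mon k :: 'k mpoly set)"
  have "\<exists>Z'. finite Z' \<and> (\<forall>t. t \<notin> Z' \<longrightarrow> Mon (Suc k) \<subseteq>
      vs.span ((\<lambda>x. (case x of (i, m) \<Rightarrow> b i * m) + cst t * (case x of (i, m) \<Rightarrow> diag_at i * m)) ` I))"
  proof (rule span_perturb)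
    show "finite I" by (simp add: I_def finite_mons)
    show "finite (Mon (Suc k) :: 'k mpoly set)" by (rule finite_mons)
    show "(case x of (i, m) \<Rightarrow> diag_at i * m) \<in> vs.span (Mon (Suc k))" if "x \<in> I" for x
      using that prod_span[OF diag1] by (auto simp: I_def)
    have "{b i * m | i m. i < spread \<and> m \<in> Mon k} \<subseteq> (\<lambda>x. case x of (i, m) \<Rightarrow> b i * m) ` I"
    proof clarify
      fix i m assume "i < spread" "m \<in> (Mon k :: 'k mpoly set)"
      then show "b i * m \<in> (\<lambda>x. case x of (i, m) \<Rightarrow> b i * m) ` I"
        by (intro image_eqI[of _ _ "(i, m)"]) (auto simp: I_def)
    qed
    then show "Mon (Suc k) \<subseteq> vs.span ((\<lambda>x. case x of (i, m) \<Rightarrow> b i * m) ` I)"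
      by (rule order_trans[OF gen vs.span_mono])
  qed
  then obtain Z' where Z': "finite Z'" "\<And>t. t \<notin> Z' \<Longrightarrow> Mon (Suc k) \<subseteq>
      vs.span ((\<lambda>x. (case x of (i, m) \<Rightarrow> b i * m) + cst t * (case x of (i, m) \<Rightarrow> diag_at i * m)) ` I)" by blast
  have fin: "finite ({0} \<union> (\<Union>j\<in>{..k}. Z j) \<union> inverse ` Z')" using Z(1) Z'(1) by simp
  obtain t where "t \<notin> {0} \<union> (\<Union>j\<in>{..k}. Z j) \<union> inverse ` Z'"
    using ex_new_if_finite[OF inf fin] by (elim exE) (rule that)
  then have t: "t \<noteq> 0" "\<And>j. j \<le> k \<Longrightarrow> t \<notin> Z j" and "t \<notin> inverse ` Z'" by auto
  have t': "inverse t \<notin> Z'"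
  proof
    assume "inverse t \<in> Z'"
    then have "inverse (inverse t) \<in> inverse ` Z'" by (rule imageI)
    then show False using \<open>t \<notin> inverse ` Z'\<close> by simp
  qed
  define v where "v i = diag_at i + cst t * b i" for i
  define B where "B j = (if j \<le> k then strict_mons lam n 1 j else {} :: 'k mpoly set)" for j
  have "card (Mon (Suc k) :: 'k mpoly set) \<le> (\<Sum>j=0..Suc k. card (B j) * multiset_num spread (Suc k - j))"
  proof (rule card_mons_le)
    show "finite (B j)" for j by (simp add: B_def finite_strict_mons)
    fix j assume "j \<le> Suc k"
    then consider "j \<le> k" | "j = Suc k" by linarith
    then show "Mon j \<subseteq> vs.span (B j \<union> {v i * m | i m j'. i < spread \<and> j = Suc j' \<and> m \<in> Mon j'})"
    proof cases
      case 1
      then show ?thesis using Z(2)[OF t(2)[OF 1]] by (simp add: B_def v_def)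
    next
      case 2
      have "(\<lambda>x. (case x of (i, m) \<Rightarrow> b i * m) + cst (inverse t) * (case x of (i, m) \<Rightarrow> diag_at i * m)) ` I
         \<subseteq> vs.span {v i * m | i m. i < spread \<and> m \<in> Mon k}" (is "_ \<subseteq> vs.span ?W")
      proof (rule image_subsetI, clarify)
        fix i m assume "(i, m) \<in> I"
        then have "cst (inverse t) * (v i * m) \<in> vs.span ?W" by (intro vs.span_scale vs.span_base) (auto simp: I_def)
        moreover have "cst (inverse t) * (v i * m) = b i * m + cst (inverse t) * (diag_at i * m)"
        proof -
          have "v i * m = diag_at i * m + cst t * (b i * m)" by (simp add: v_def distrib_right mult.assoc)
          then have "cst (inverse t) * (v i * m) = cst (inverse t) * (diag_at i * m) + cst (inverse t) * (cst t * (b i * m))"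
            by (simp only: distrib_left)
          also have "cst (inverse t) * (cst t * (b i * m)) = b i * m"
            using t(1) by (simp only: vs.scale_scale left_inverse[OF t(1)] vs.scale_one)
          finally show ?thesis by (simp only: add.commute)
        qed
        ultimately show "b i * m + cst (inverse t) * (diag_at i * m) \<in> vs.span ?W" by (simp only:)
      qed
      then have "Mon (Suc k) \<subseteq> vs.span ?W"
        by (intro order_trans[OF Z'(2)[OF t'] vs.span_minimal[OF _ vs.subspace_span]])
      then show ?thesis by (simp add: 2 B_def)
    qed
  qed
  also have "\<dots> \<le> (\<Sum>j=0..k. strict_num lam n 1 j * multiset_num spread (Suc k - j))"
    by (simp add: B_def) (intro sum_mono mult_le_mono1 card_strict_mons_le)
  also have "\<dots> < mon_num lam n 1 (Suc k)"
    using mon_num_eq[of n 1 lam "Suc k"] n_pos lam_pos[of n] noninc pos by simp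
  also have "\<dots> \<le> card (Mon (Suc k) :: 'k mpoly set)" by (rule card_mons_ge)
  finally show False by simp
qed

lemma minimal_reduction_lower_bound:
  fixes J :: "'k::field mpoly set"
  assumes inf: "infinite (UNIV :: 'k set)"
    and J: "minimal_reduction R J (ferrers_ideal n lam)" and red: "reduces J r"
    and s: "strict_num lam n 1 s \<noteq> 0"
  shows "s \<le> r"
proof (rule ccontr)
  assume "\<not> s \<le> r"
  then obtain k where k: "s = Suc k" "r \<le> k" by (cases s) auto
  have JI: "ideal_in R J" "J \<subseteq> ferrers_ideal n lam"
    and min: "\<And>J'. is_reduction R J' (ferrers_ideal n lam) \<Longrightarrow> J' \<subseteq> J \<Longrightarrow> J' = J"
    using J by (auto simp: minimal_reduction_def is_reduction_def)
  define L where "L = hcomp 2 ` J"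
  have J0: "0 \<in> J" and Jadd: "\<And>a b. a \<in> J \<Longrightarrow> b \<in> J \<Longrightarrow> a + b \<in> J"
    and Jmult: "\<And>r a. r \<in> R \<Longrightarrow> a \<in> J \<Longrightarrow> r * a \<in> J" using JI(1) by (auto simp: ideal_in_def)
  have Lsub: "vs.subspace L"
  proof (rule vs.subspaceI)
    show "0 \<in> L" unfolding L_def using J0 by (intro image_eqI[of _ _ 0]) auto
    show "x + y \<in> L" if xy: "x \<in> L" "y \<in> L" for x y
    proof -
      obtain a b where "a \<in> J" "b \<in> J" "x = hcomp 2 a" "y = hcomp 2 b" using xy unfolding L_def by blast
      then show ?thesis unfolding L_def by (intro image_eqI[of _ _ "a + b"]) (auto intro: Jadd)
    qed
    show "cst c * x \<in> L" if x: "x \<in> L" for c x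
    proof -
      obtain a where "a \<in> J" "x = hcomp 2 a" using x unfolding L_def by blast
      then show ?thesis unfolding L_def by (intro image_eqI[of _ _ "cst c * a"]) (auto intro: Jmult cst_R simp: hcomp_scale)
    qed
  qed
  have L1: "L \<subseteq> vs.span (Mon 1)"
  proof
    fix l assume "l \<in> L"
    then obtain a where "a \<in> J" "l = hcomp 2 a" unfolding L_def by blast
    then show "l \<in> vs.span (Mon 1)" using JI(2) lin_mons_hcomp[of a 1] by (auto simp: ferrers_ideal_eq)
  qed
  obtain B where B: "B \<subseteq> L" "vs.independent B" "L \<subseteq> vs.span B" using vs.maximal_independent_subset by blast
  have spanB: "vs.span B = L" using B vs.span_minimal[OF B(1) Lsub] by blast
  have finB: "finite B"
    using vs.independent_span_bound[OF finite_mons B(2), of lam n 1 1] B(1) L1 by (meson order_trans)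
  have "card B \<le> spread"
  proof (rule ccontr)
    assume "\<not> card B \<le> spread"
    then have "spread < card B" by simp
    from shrink_space[OF inf L1 reduces_initial[OF JI(2) red, folded L_def] B(2) finB spanB this]
    obtain L' k' where L': "vs.subspace L'" "L' \<subset> L" "r \<le> k'"
      "Mon (Suc k') \<subseteq> vs.span {l * m | l m. l \<in> L' \<and> m \<in> Mon k'}" by blast
    have "reduces J k'" using reduces_add[OF red, of "k' - r"] L'(3) by simp
    then have red': "reduces {f \<in> J. hcomp 2 f \<in> L'} k'"
      using L' by (intro reduces_of_initial[OF JI]) (auto simp: L_def vs.subspace_0)
    let ?J' = "{f \<in> J. hcomp 2 f \<in> L'}"
    have "ideal_in R ?J'"
      unfolding ideal_in_def
    proof (intro conjI ballI)
      show "?J' \<subseteq> R" using JI(1) by (auto simp: ideal_in_def)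
      show "0 \<in> ?J'" using J0 L'(1) by (simp add: vs.subspace_0)
      show "a + b \<in> ?J'" if "a \<in> ?J'" "b \<in> ?J'" for a b
        using that Jadd L'(1) by (simp add: vs.subspace_add)
      show "c * a \<in> ?J'" if c: "c \<in> R" and a: "a \<in> ?J'" for c a
      proof -
        have "order_ge 2 a" using a JI(2) ideal_order_ge by blast
        then have "hcomp 2 (c * a) = cst (lookup c 0) * hcomp 2 a"
          using hcomp_mult[OF order_ge_0, of 2 a c] by (simp only: add_0 hcomp_0)
        then show ?thesis using a c Jmult vs.subspace_scale[OF L'(1)] by simp
      qed
    qed
    moreover have "?J' \<subseteq> ferrers_ideal n lam" using JI(2) by blast
    ultimately have "is_reduction R ?J' (ferrers_ideal n lam)"
      using red' reduces_iff unfolding is_reduction_def by blast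
    then have "?J' = J" by (rule min) blast
    then have "L \<subseteq> L'" unfolding L_def by blast
    then show False using L'(2) by blast
  qed
  obtain h where h: "bij_betw h {0..<card B} B" using ex_bij_betw_nat_finite[OF finB] by blast
  define b where "b i = (if i < card B then h i else 0)" for i
  have Bb: "B \<subseteq> b ` {..<spread}"
  proof
    fix x assume "x \<in> B"
    then have "x \<in> h ` {0..<card B}" using bij_betw_imp_surj_on[OF h] by simp
    then obtain i where "i < card B" "x = h i" by auto
    then show "x \<in> b ` {..<spread}" using \<open>card B \<le> spread\<close> by (intro image_eqI[of _ _ i]) (auto simp: b_def)
  qed
  have "strict_num lam n 1 (Suc k) = 0"
  proof (rule strict_num_eq_0_of_span[OF inf])
    show "b i \<in> vs.span (Mon 1)" for i
    proof (cases "i < card B")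
      case True
      then have "b i \<in> B" using bij_betwE[OF h] by (simp add: b_def)
      then show ?thesis using B(1) L1 by blast
    qed (simp add: b_def vs.span_zero)
    have "reduces J k" using reduces_add[OF red, of "k - r"] k by simp
    then have "Mon (Suc k) \<subseteq> vs.span {l * m | l m. l \<in> L \<and> m \<in> Mon k}"
      using reduces_initial[OF JI(2)] by (simp add: L_def)
    also have "\<dots> \<subseteq> vs.span {b i * m | i m. i < spread \<and> m \<in> Mon k}" (is "_ \<subseteq> vs.span ?W")
    proof (rule vs.span_minimal[OF _ vs.subspace_span], clarify)
      fix l m assume l: "l \<in> L" and m: "m \<in> (Mon k :: 'k mpoly set)"
      have "l \<in> vs.span (b ` {..<spread})" using l B(3) vs.span_mono[OF Bb] by blast
      then show "l * m \<in> vs.span ?W"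
        by (rule span_mult_in[OF _ vs.span_base[of m "{m}"]]) (use m in \<open>auto intro!: vs.span_base\<close>)
    qed
    finally show "Mon (Suc k) \<subseteq> vs.span ?W" .
  qed
  then show False using s k by simp
qed

end

section \<open>Analytic independence at a prime\<close>

text \<open>Here \<open>i0\<close> and \<open>j0\<close> are the first row and column whose variable is not in \<open>q\<close> (one past the end if
  there is none), \<open>a\<close> is the length of row \<open>i0\<close> and \<open>b\<close> that of column \<open>j0\<close>. Locally at \<open>q\<close> the
  diagonals generate the same ideal as the first \<open>b\<close> row variables, the first \<open>a\<close> column variables and
  the diagonals restricted to the cells outside those rows and columns.\<close>

locale ferrers_prime = ferrers +
  fixes q :: "'k::field mpoly set" and i0 j0 a b :: nat
  assumes q_ideal: "ideal_in (ferrers_ring n lam) q" and one_notin: "1 \<notin> q"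
    and q_prime: "\<And>x y. x \<in> ferrers_ring n lam \<Longrightarrow> y \<in> ferrers_ring n lam \<Longrightarrow> x * y \<in> q \<Longrightarrow> x \<in> q \<or> y \<in> q"
    and X_in: "\<And>i. 1 \<le> i \<Longrightarrow> i < i0 \<Longrightarrow> var (X i) \<in> q" and Y_in: "\<And>j. 1 \<le> j \<Longrightarrow> j < j0 \<Longrightarrow> var (Y j) \<in> q"
    and X_out: "i0 \<le> n \<Longrightarrow> var (X i0) \<notin> q" and Y_out: "j0 \<le> lam 1 \<Longrightarrow> var (Y j0) \<notin> q"
    and i0: "1 \<le> i0" and j0: "1 \<le> j0" and b_less: "b < i0" and a_less: "a < j0"
    and row_bound: "\<And>i j. (i, j) \<in> shape lam n 1 \<Longrightarrow> i0 \<le> i \<Longrightarrow> j \<le> a"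
    and col_bound: "\<And>i j. (i, j) \<in> shape lam n 1 \<Longrightarrow> j0 \<le> j \<Longrightarrow> i \<le> b"
    and a_row: "\<And>j. 1 \<le> j \<Longrightarrow> j \<le> a \<Longrightarrow> (i0, j) \<in> shape lam n 1"
    and b_col: "\<And>i. 1 \<le> i \<Longrightarrow> i \<le> b \<Longrightarrow> (i, j0) \<in> shape lam n 1"
begin

lemma qD:
  shows "0 \<in> q" "x \<in> q \<Longrightarrow> y \<in> q \<Longrightarrow> x + y \<in> q" "r \<in> R \<Longrightarrow> x \<in> q \<Longrightarrow> r * x \<in> q" "x \<in> q \<Longrightarrow> x \<in> R"
    "x \<in> q \<Longrightarrow> y \<in> q \<Longrightarrow> x - y \<in> q"
proof -
  show 0: "0 \<in> q" and ad: "x \<in> q \<Longrightarrow> y \<in> q \<Longrightarrow> x + y \<in> q" and mu: "r \<in> R \<Longrightarrow> x \<in> q \<Longrightarrow> r * x \<in> q"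
    and "x \<in> q \<Longrightarrow> x \<in> R" for x y r
    using q_ideal unfolding ideal_in_def by blast+
  have "- 1 \<in> R" using subringD(5)[OF R_subring subringD(1)[OF R_subring]] .
  show "x - y \<in> q" if "x \<in> q" "y \<in> q" using ad[OF that(1) mu[OF \<open>- 1 \<in> R\<close> that(2)]] by simp
qed

lemma q_sum: "(\<And>i. i \<in> A \<Longrightarrow> f i \<in> q) \<Longrightarrow> sum f A \<in> q"
  by (induction A rule: infinite_finite_induct) (simp_all add: qD)

definition inner_cells :: "int \<Rightarrow> (nat \<times> nat) set" where
  "inner_cells d = {(i, j) \<in> diag_cells lam n 1 d. b < i \<and> i < i0 \<and> a < j \<and> j < j0}"

definition gens :: "(var + int) set" where
  "gens = Inl ` (X ` {1..b} \<union> Y ` {1..a}) \<union> Inr ` {d. inner_cells d \<noteq> {}}"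

definition gen :: "var + int \<Rightarrow> 'k mpoly" where
  "gen = case_sum var (\<lambda>d. \<Sum>(i, j)\<in>inner_cells d. xy i j)"

text \<open>All generators are homogeneous of degree 2 for \<open>w1\<close>, and all variables occurring in them have positive
  weight and lie in \<open>q\<close>. The leading monomial minimizes \<open>w2\<close>: on a diagonal it is the first cell.\<close>

definition w1 :: "var \<Rightarrow> nat" where
  "w1 v = (case v of X i \<Rightarrow> (if i = 0 then 0 else if i \<le> b then 2 else if i < i0 then 1 else 0)
     | Y j \<Rightarrow> (if j = 0 then 0 else if j \<le> a then 2 else if j < j0 then 1 else 0))"

definition w2 :: "var \<Rightarrow> nat" where
  "w2 v = (case v of X i \<Rightarrow> i | Y j \<Rightarrow> j)"

definition first_row :: "int \<Rightarrow> nat" where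
  "first_row d = (if int a - int b \<le> d then b + 1 else nat (int a + 1 - d))"

definition lead :: "var + int \<Rightarrow> (var \<Rightarrow>\<^sub>0 nat)" where
  "lead = case_sum (\<lambda>v. Poly_Mapping.single v 1)
     (\<lambda>d. Poly_Mapping.single (X (first_row d)) 1 + Poly_Mapping.single (Y (nat (int (first_row d) + d))) 1)"

lemma finite_inner_cells: "finite (inner_cells d)"
  by (rule finite_subset[OF _ finite_diag_cells[of lam n 1 d]]) (auto simp: inner_cells_def)

lemma finite_gens: "finite gens"
proof -
  have "{d. inner_cells d \<noteq> {}} \<subseteq> (\<lambda>(i, j). int j - int i) ` shape lam n 1"
    by (force simp: inner_cells_def diag_cells_def)
  then have "finite {d. inner_cells d \<noteq> {}}" using finite_shape by (rule finite_surj[rotated])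
  then show ?thesis by (simp add: gens_def)
qed

lemma inner_cells_iff: "(i, j) \<in> inner_cells d \<longleftrightarrow>
    i \<le> n \<and> j \<le> lam i \<and> int j - int i = d \<and> b < i \<and> i < i0 \<and> a < j \<and> j < j0"
  by (auto simp: inner_cells_def diag_cells_def shape_def)

lemma first_cell:
  assumes "(i, j) \<in> inner_cells d"
  shows "(first_row d, nat (int (first_row d) + d)) \<in> inner_cells d \<and> first_row d \<le> i"
proof -
  have ij: "i \<le> n" "j \<le> lam i" "int j - int i = d" "b < i" "i < i0" "a < j" "j < j0"
    using assms by (auto simp: inner_cells_iff)
  have "first_row d \<le> i" "1 \<le> first_row d" "b < first_row d" "a < nat (int (first_row d) + d)"
     "nat (int (first_row d) + d) \<le> j" "int (nat (int (first_row d) + d)) = int (first_row d) + d"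
    using ij by (auto simp: first_row_def)
  moreover have "lam i \<le> lam (first_row d)" using calculation ij noninc[of "first_row d" i] by auto
  ultimately show ?thesis using ij by (auto simp: inner_cells_iff)
qed

definition leads :: "'k mpoly \<Rightarrow> (var \<Rightarrow>\<^sub>0 nat) \<Rightarrow> bool" where
  "leads f u \<longleftrightarrow> (\<forall>m\<in>keys (f - Poly_Mapping.single u 1). wt w2 u < wt w2 m)"

definition balanced :: "nat \<Rightarrow> 'k mpoly \<Rightarrow> bool" where
  "balanced N f \<longleftrightarrow> (\<forall>m\<in>keys f. wt w1 m = 2 * N \<and> (\<forall>v\<in>keys m. 0 < w1 v))"

lemma leads_mult:
  assumes "leads f u" "leads g v"
  shows "leads (f * g) (u + v)"
  unfolding leads_def
proof
  let ?f = "f - Poly_Mapping.single u 1" and ?g = "g - Poly_Mapping.single v 1"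
  fix m assume m: "m \<in> keys (f * g - Poly_Mapping.single (u + v) 1)"
  have "f * g - Poly_Mapping.single u 1 * Poly_Mapping.single v 1
      = Poly_Mapping.single u 1 * ?g + (?f * Poly_Mapping.single v 1 + ?f * ?g)"
    by (simp add: algebra_simps)
  then have "f * g - Poly_Mapping.single (u + v) 1
      = Poly_Mapping.single u 1 * ?g + (?f * Poly_Mapping.single v 1 + ?f * ?g)"
    by (simp add: mult_single)
  then have "m \<in> keys (Poly_Mapping.single u 1 * ?g) \<union> (keys (?f * Poly_Mapping.single v 1) \<union> keys (?f * ?g))"
    using m keys_add[of "Poly_Mapping.single u 1 * ?g" "?f * Poly_Mapping.single v 1 + ?f * ?g"]
      keys_add[of "?f * Poly_Mapping.single v 1" "?f * ?g"] by auto
  then consider x where "x \<in> keys ?g" "m = u + x" | x where "x \<in> keys ?f" "m = x + v"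
    | x y where "x \<in> keys ?f" "y \<in> keys ?g" "m = x + y"
    using keys_mult[of "Poly_Mapping.single u 1" ?g] keys_mult[of ?f "Poly_Mapping.single v 1"] keys_mult[of ?f ?g]
    by (auto split: if_splits)
  then show "wt w2 (u + v) < wt w2 m"
    using assms unfolding leads_def by cases (auto intro: add_strict_mono)
qed

lemma balanced_mult: "balanced N f \<Longrightarrow> balanced M g \<Longrightarrow> balanced (N + M) (f * g)"
  unfolding balanced_def
proof
  fix m assume f: "\<forall>m\<in>keys f. wt w1 m = 2 * N \<and> (\<forall>v\<in>keys m. 0 < w1 v)"
    and g: "\<forall>m\<in>keys g. wt w1 m = 2 * M \<and> (\<forall>v\<in>keys m. 0 < w1 v)" and "m \<in> keys (f * g)"
  then obtain x y where "x \<in> keys f" "y \<in> keys g" "m = x + y" using keys_mult[of f g] by auto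
  then show "wt w1 m = 2 * (N + M) \<and> (\<forall>v\<in>keys m. 0 < w1 v)"
    using f g keys_add[of x y] by auto
qed

lemma gen_leads:
  assumes "x \<in> gens"
  shows "leads (gen x) (lead x) \<and> balanced 1 (gen x)"
proof (cases x)
  case (Inl v)
  then have "w1 v = 2" using assms by (auto simp: gens_def w1_def)
  then show ?thesis using Inl by (simp add: leads_def balanced_def gen_def lead_def var_def)
next
  case (Inr d)
  then obtain i j where "(i, j) \<in> inner_cells d" using assms by (auto simp: gens_def)
  let ?i = "first_row d" and ?j = "nat (int (first_row d) + d)"
  have fc: "(?i, ?j) \<in> inner_cells d" using first_cell[OF \<open>(i, j) \<in> _\<close>] by simp
  have xy: "xy i' j' = (Poly_Mapping.single (Poly_Mapping.single (X i') 1 + Poly_Mapping.single (Y j') 1) 1 :: 'k mpoly)" for i' j'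
    by (simp add: xy_def)
  have g: "gen x = xy ?i ?j + (\<Sum>(i, j)\<in>inner_cells d - {(?i, ?j)}. xy i j)"
    using sum.remove[OF finite_inner_cells fc, of "\<lambda>(i, j). xy i j"] Inr by (simp add: gen_def)
  have lx: "Poly_Mapping.single (lead x) 1 = (xy ?i ?j :: 'k mpoly)" by (simp add: Inr lead_def xy)
  have "leads (gen x) (lead x)"
    unfolding leads_def
  proof
    fix m assume "m \<in> keys (gen x - Poly_Mapping.single (lead x) 1)"
    also have "gen x - Poly_Mapping.single (lead x) 1 = (\<Sum>(i, j)\<in>inner_cells d - {(?i, ?j)}. xy i j)"
      unfolding g lx by simp
    finally obtain i' j' where ij: "(i', j') \<in> inner_cells d - {(?i, ?j)}" "m \<in> keys (xy i' j' :: 'k mpoly)"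
      using keys_sum[of "\<lambda>(i, j). xy i j :: 'k mpoly" "inner_cells d - {(?i, ?j)}"] by fastforce
    then have m: "m = Poly_Mapping.single (X i') 1 + Poly_Mapping.single (Y j') 1" by (simp add: xy)
    have "?i \<le> i'" using first_cell[of i' j' d] ij by simp
    moreover have "int j' - int i' = d" "int ?j - int ?i = d" using ij fc by (auto simp: inner_cells_iff)
    moreover have "I < i' \<and> K < j'" if "I \<le> i'" "int j' - int i' = d" "int K - int I = d" "(i', j') \<noteq> (I, K)" for I K
      using that by auto
    ultimately have "?i < i' \<and> ?j < j'" using ij(1) by blast
    then show "wt w2 (lead x) < wt w2 m" by (simp add: Inr lead_def m w2_def)
  qed
  moreover have "balanced 1 (gen x)"
    unfolding balanced_def
  proof
    fix m assume "m \<in> keys (gen x)"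
    then obtain i' j' where ij: "(i', j') \<in> inner_cells d" "m \<in> keys (xy i' j' :: 'k mpoly)"
      using keys_sum[of "\<lambda>(i, j). xy i j :: 'k mpoly" "inner_cells d"] Inr by (fastforce simp: gen_def)
    then have m: "m = Poly_Mapping.single (X i') 1 + Poly_Mapping.single (Y j') 1" by (simp add: xy)
    have "w1 (X i') = 1" "w1 (Y j') = 1" using ij by (auto simp: inner_cells_iff w1_def)
    moreover have "keys m \<subseteq> {X i', Y j'}" using keys_add[of "Poly_Mapping.single (X i') 1" "Poly_Mapping.single (Y j') (1 :: nat)"] by (auto simp: m)
    ultimately show "wt w1 m = 2 * 1 \<and> (\<forall>v\<in>keys m. 0 < w1 v)" by (auto simp: m)
  qed
  ultimately show ?thesis ..
qed

definition gmons :: "nat \<Rightarrow> (var + int) multiset set" where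
  "gmons N = {\<gamma>. size \<gamma> = N \<and> set_mset \<gamma> \<subseteq> gens}"

definition gprod :: "(var + int) multiset \<Rightarrow> 'k mpoly" where
  "gprod \<gamma> = (\<Prod>x\<in>#\<gamma>. gen x)"

definition glead :: "(var + int) multiset \<Rightarrow> (var \<Rightarrow>\<^sub>0 nat)" where
  "glead \<gamma> = (\<Sum>x\<in>#\<gamma>. lead x)"

lemma gprod_leads: "set_mset \<gamma> \<subseteq> gens \<Longrightarrow> leads (gprod \<gamma>) (glead \<gamma>) \<and> balanced (size \<gamma>) (gprod \<gamma>)"
proof (induction \<gamma>)
  case empty
  show ?case by (simp add: gprod_def glead_def leads_def balanced_def)
next
  case (add x \<gamma>)
  then show ?case using leads_mult[of "gen x" "lead x" "gprod \<gamma>" "glead \<gamma>"] balanced_mult[of 1 "gen x" "size \<gamma>" "gprod \<gamma>"] gen_leads[of x]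
    by (simp add: gprod_def glead_def Suc_eq_plus1_left)
qed

lemma lookup_glead: "lookup (glead \<gamma>) v = (\<Sum>x\<in>#\<gamma>. lookup (lead x) v)"
  by (induction \<gamma>) (auto simp: glead_def lookup_add)

lemma count_eq_lookup:
  assumes "set_mset \<gamma> \<subseteq> gens" "\<And>y. y \<in> gens \<Longrightarrow> lookup (lead y) v = (if y = x then 1 else 0)"
  shows "lookup (glead \<gamma>) v = count \<gamma> x"
  using assms(1) unfolding lookup_glead by (induction \<gamma>) (auto simp: assms(2))

lemma glead_inj:
  assumes "\<gamma> \<in> gmons N" "\<delta> \<in> gmons N" "glead \<gamma> = glead \<delta>"
  shows "\<gamma> = \<delta>"
proof -
  let ?c = "Inr (int a - int b) :: var + int"
  have sub: "set_mset \<gamma> \<subseteq> gens" "set_mset \<delta> \<subseteq> gens" using assms by (auto simp: gmons_def)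
  have eq: "count \<gamma> x = count \<delta> x" if v: "\<And>y. y \<in> gens \<Longrightarrow> lookup (lead y) v = (if y = x then 1 else 0)" for x v
    using count_eq_lookup[OF sub(1) v] count_eq_lookup[OF sub(2) v] assms(3) by simp
  have lead_Inr: "b < first_row d \<and> a < nat (int (first_row d) + d)" if d: "Inr d \<in> gens" for d
  proof -
    obtain i j where "(i, j) \<in> inner_cells d" using d by (auto simp: gens_def)
    then show ?thesis using first_cell[of i j d] by (auto simp: inner_cells_iff)
  qed
  have other: "count \<gamma> x = count \<delta> x" if x: "x \<noteq> ?c" for x
  proof (cases "x \<in> gens")
    case False
    then show ?thesis using sub by (metis count_eq_zero_iff subsetD)
  next
    case True
    show ?thesis
    proof (cases x)
      case (Inl v)
      then have v: "(\<exists>i. v = X i \<and> 1 \<le> i \<and> i \<le> b) \<or> (\<exists>j. v = Y j \<and> 1 \<le> j \<and> j \<le> a)"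
        using True by (auto simp: gens_def)
      show ?thesis
      proof (rule eq)
        fix y assume "y \<in> gens"
        then show "lookup (lead y) v = (if y = x then 1 else 0)"
          using v lead_Inr[of "projr y"] Inl
          by (cases y) (auto simp: lead_def lookup_add lookup_single when_def)
      qed
    next
      case (Inr d)
      have d: "d \<noteq> int a - int b" using x Inr by simp
      have ld: "b < first_row d" "a < nat (int (first_row d) + d)" using lead_Inr[of d] True Inr by auto
      define v where "v = (if int a - int b < d then Y (nat (int (first_row d) + d)) else X (first_row d))"
      show ?thesis
      proof (rule eq[of v])
        fix y assume y: "y \<in> gens"
        show "lookup (lead y) v = (if y = x then 1 else 0)"
        proof (cases y)
          case (Inl u)
          then have "(\<exists>i. u = X i \<and> 1 \<le> i \<and> i \<le> b) \<or> (\<exists>j. u = Y j \<and> 1 \<le> j \<and> j \<le> a)"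
            using y by (auto simp: gens_def)
          then show ?thesis using Inl Inr ld by (auto simp: v_def lead_def lookup_single when_def)
        next
          case (Inr d')
          have "b < first_row d'" "a < nat (int (first_row d') + d')" using lead_Inr[of d'] y Inr by auto
          then show ?thesis using Inr \<open>x = Inr d\<close> d ld
            by (auto simp: v_def lead_def lookup_add lookup_single when_def first_row_def split: if_splits)
        qed
      qed
    qed
  qed
  have "filter_mset (\<lambda>x. x \<noteq> ?c) \<gamma> = filter_mset (\<lambda>x. x \<noteq> ?c) \<delta>"
    by (rule multiset_eqI) (use other in auto)
  moreover have "size \<gamma> = size (filter_mset (\<lambda>x. x \<noteq> ?c) \<gamma>) + count \<gamma> ?c" for \<gamma> :: "(var + int) multiset"
    by (induction \<gamma>) auto
  moreover have "size \<gamma> = size \<delta>" using assms by (simp add: gmons_def)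
  ultimately have "count \<gamma> ?c = count \<delta> ?c" by (metis add_left_cancel)
  then show ?thesis using other by (intro multiset_eqI) metis
qed

lemma wt_eq_0: "wt w m = 0 \<Longrightarrow> 0 < w v \<Longrightarrow> lookup m v = 0"
  by (cases "v \<in> keys m") (auto simp: wt_def in_keys_iff)

text \<open>The generators are analytically independent at \<open>q\<close>: compare coefficients at the
  smallest leading monomial whose coefficient is not in \<open>q\<close>.\<close>

lemma gprod_independent:
  assumes fin: "finite (gmons N)" and \<rho>: "\<And>\<gamma>. \<gamma> \<in> gmons N \<Longrightarrow> \<rho> \<gamma> \<in> R"
    and zero: "(\<Sum>\<gamma>\<in>gmons N. \<rho> \<gamma> * gprod \<gamma>) = 0" and "\<delta> \<in> gmons N"
  shows "\<rho> \<delta> \<in> q"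
proof -
  define bad where "bad \<gamma> \<longleftrightarrow> \<gamma> \<in> gmons N \<and> (\<exists>u\<in>keys (\<rho> \<gamma>). wt w1 u = 0)" for \<gamma>
  have not_bad: "\<not> bad \<gamma>" for \<gamma>
  proof
    assume "bad \<gamma>"
    then obtain \<gamma> where \<gamma>: "bad \<gamma>" and min: "\<And>\<delta>. bad \<delta> \<Longrightarrow> wt w2 (glead \<gamma>) \<le> wt w2 (glead \<delta>)"
      using ex_has_least_nat[of bad \<gamma> "\<lambda>\<gamma>. wt w2 (glead \<gamma>)"] by blast
    obtain u where u: "u \<in> keys (\<rho> \<gamma>)" "wt w1 u = 0" and \<gamma>N: "\<gamma> \<in> gmons N" using \<gamma> unfolding bad_def by blast
    let ?k = "glead \<gamma> + u"
    have mon: "leads (gprod \<delta>) (glead \<delta>)" "balanced N (gprod \<delta>)" if "\<delta> \<in> gmons N" for \<delta>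
      using gprod_leads[of \<delta>] that by (auto simp: gmons_def)
    have lead_key: "glead \<delta> \<in> keys (gprod \<delta>)" if "\<delta> \<in> gmons N" for \<delta>
    proof -
      have "glead \<delta> \<notin> keys (gprod \<delta> - Poly_Mapping.single (glead \<delta>) 1)"
        using mon(1)[OF that] by (auto simp: leads_def)
      then show ?thesis by (simp add: in_keys_iff lookup_minus)
    qed
    have split: "m = glead \<gamma> \<and> v = u" if "\<delta> \<in> gmons N" "m \<in> keys (gprod \<delta>)" "m + v = ?k" for \<delta> m v
    proof -
      have bm: "wt w1 m = 2 * N" "\<And>x. x \<in> keys m \<Longrightarrow> 0 < w1 x"
        using mon(2)[OF that(1)] that(2) by (auto simp: balanced_def)
      have bl: "wt w1 (glead \<gamma>) = 2 * N" "\<And>x. x \<in> keys (glead \<gamma>) \<Longrightarrow> 0 < w1 x"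
        using mon(2)[OF \<gamma>N] lead_key[OF \<gamma>N] by (auto simp: balanced_def)
      have "wt w1 (m + v) = wt w1 ?k" using that(3) by simp
      then have v0: "wt w1 v = 0" using bm bl u(2) by simp
      have "m = glead \<gamma>"
      proof (rule poly_mapping_eqI)
        fix x
        show "lookup m x = lookup (glead \<gamma>) x"
        proof (cases "0 < w1 x")
          case True
          have "lookup (m + v) x = lookup ?k x" using that(3) by simp
          then show ?thesis using wt_eq_0[OF v0 True] wt_eq_0[OF u(2) True] by (simp add: lookup_add)
        next
          case False
          then have "x \<notin> keys m \<and> x \<notin> keys (glead \<gamma>)" using bm(2)[of x] bl(2)[of x] by auto
          then show ?thesis by (simp add: in_keys_iff)
        qed
      qed
      then show ?thesis using that(3) by simp
    qed
    have term0: "lookup (\<rho> \<delta> * gprod \<delta>) ?k = 0" if \<delta>: "\<delta> \<in> gmons N" "\<delta> \<noteq> \<gamma>" for \<delta>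
    proof (rule ccontr)
      assume "lookup (\<rho> \<delta> * gprod \<delta>) ?k \<noteq> 0"
      then have "?k \<in> keys (\<rho> \<delta> * gprod \<delta>)" by (simp add: in_keys_iff)
      then obtain v m where vm: "v \<in> keys (\<rho> \<delta>)" "m \<in> keys (gprod \<delta>)" "?k = v + m" using keys_mult[of "\<rho> \<delta>" "gprod \<delta>"] by auto
      then have m: "m = glead \<gamma>" "v = u" using split[OF \<delta>(1) vm(2), of v] by (auto simp: add.commute)
      then have "bad \<delta>" using vm u \<delta> by (auto simp: bad_def)
      then have le: "wt w2 (glead \<gamma>) \<le> wt w2 (glead \<delta>)" by (rule min)
      have "m = glead \<delta>"
      proof (rule ccontr)
        assume "m \<noteq> glead \<delta>"
        then have "m \<in> keys (gprod \<delta> - Poly_Mapping.single (glead \<delta>) 1)"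
          using vm(2) by (simp add: in_keys_iff lookup_minus lookup_single)
        then show False using mon(1)[OF \<delta>(1)] le m by (auto simp: leads_def)
      qed
      then show False using glead_inj[OF \<gamma>N \<delta>(1)] m \<delta>(2) by simp
    qed
    have "lookup (\<rho> \<gamma> * gprod \<gamma>) ?k = lookup (\<rho> \<gamma>) u"
    proof -
      let ?g = "gprod \<gamma> - Poly_Mapping.single (glead \<gamma>) 1"
      have "\<rho> \<gamma> * gprod \<gamma> = Poly_Mapping.single (glead \<gamma>) 1 * \<rho> \<gamma> + \<rho> \<gamma> * ?g" by (simp add: algebra_simps)
      moreover have "lookup (\<rho> \<gamma> * ?g) ?k = 0"
      proof (rule ccontr)
        assume "lookup (\<rho> \<gamma> * ?g) ?k \<noteq> 0"
        then have "?k \<in> keys (\<rho> \<gamma> * ?g)" by (simp add: in_keys_iff)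
        then obtain v m where vm: "v \<in> keys (\<rho> \<gamma>)" "m \<in> keys ?g" "?k = v + m" using keys_mult[of "\<rho> \<gamma>" ?g] by auto
        have lt: "wt w2 (glead \<gamma>) < wt w2 m" using vm(2) mon(1)[OF \<gamma>N] by (auto simp: leads_def)
        then have "m \<noteq> glead \<gamma>" by auto
        then have "m \<in> keys (gprod \<gamma>)" using vm(2) by (simp add: in_keys_iff lookup_minus lookup_single)
        then show False using split[OF \<gamma>N, of m v] vm(3) lt by (simp add: add.commute)
      qed
      ultimately show ?thesis by (simp add: lookup_add lookup_single_one_mult)
    qed
    moreover have "(\<Sum>\<delta>\<in>gmons N. lookup (\<rho> \<delta> * gprod \<delta>) ?k) = lookup (\<rho> \<gamma> * gprod \<gamma>) ?k"
      using sum.remove[OF fin \<gamma>N, of "\<lambda>\<delta>. lookup (\<rho> \<delta> * gprod \<delta>) ?k"] term0 by simp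
    moreover have "(\<Sum>\<delta>\<in>gmons N. lookup (\<rho> \<delta> * gprod \<delta>) ?k) = 0"
      unfolding lookup_sum[symmetric] zero by simp
    ultimately show False using u(1) by (simp add: in_keys_iff)
  qed
  have pos: "0 < wt w1 u" if "u \<in> keys (\<rho> \<delta>)" for u
    using that \<open>\<delta> \<in> gmons N\<close> not_bad[of \<delta>] by (auto simp: bad_def)
  have "\<exists>v\<in>keys u. 0 < w1 v" if "u \<in> keys (\<rho> \<delta>)" for u
  proof (rule ccontr)
    assume "\<not> (\<exists>v\<in>keys u. 0 < w1 v)"
    then have "wt w1 u = 0" by (simp add: wt_def)
    then show False using pos[OF that] by simp
  qed
  then have "\<rho> \<delta> \<in> lin R (var ` {v \<in> V. 0 < w1 v})"
    using poly_ring_in_lin[of "\<rho> \<delta>" V "\<lambda>v. 0 < w1 v"] \<rho>[OF \<open>\<delta> \<in> gmons N\<close>] unfolding ferrers_ring_def by blast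
  moreover have "var ` {v \<in> V. 0 < w1 v} \<subseteq> q"
    using X_in Y_in b_less a_less by (auto simp: w1_def ferrers_vars_def split: if_splits)
  then have "lin R (var ` {v \<in> V. 0 < w1 v}) \<subseteq> q" by (rule lin_subset_ideal[OF q_ideal])
  ultimately show ?thesis by blast
qed

end

lemma finite_lin_sum:
  assumes R: "subring R" and I: "finite I" and x: "x \<in> lin R (g ` I)"
  shows "\<exists>\<rho>. (\<forall>i\<in>I. \<rho> i \<in> R) \<and> x = (\<Sum>i\<in>I. \<rho> i * g i)"
  using x
proof induction
  case zero
  show ?case by (intro exI[of _ "\<lambda>_. 0"]) (simp add: subringD(2)[OF R])
next
  case (step r s x)
  then obtain i \<rho> where i: "i \<in> I" "s = g i" and \<rho>: "\<forall>i\<in>I. \<rho> i \<in> R" "x = (\<Sum>i\<in>I. \<rho> i * g i)" by blast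
  define \<rho>' where "\<rho>' j = \<rho> j + (if j = i then r else 0)" for j
  have "(\<Sum>j\<in>I. \<rho>' j * g j) = (\<Sum>j\<in>I. \<rho> j * g j + (if j = i then r * g i else 0))"
    by (rule sum.cong) (auto simp: \<rho>'_def distrib_right)
  also have "\<dots> = r * s + x" using i \<rho>(2) I by (simp add: sum.distrib add.commute)
  finally have "r * s + x = (\<Sum>j\<in>I. \<rho>' j * g j)" by simp
  moreover have "\<forall>j\<in>I. \<rho>' j \<in> R" using \<rho>(1) step.hyps(1) by (auto simp: \<rho>'_def intro: subringD[OF R])
  ultimately show ?case by blast
qed

lemma finite_lin_prod_sum:
  assumes M: "0 \<in> M" "\<And>a b. a \<in> M \<Longrightarrow> b \<in> M \<Longrightarrow> a + b \<in> M" "\<And>r a. r \<in> R \<Longrightarrow> a \<in> M \<Longrightarrow> r * a \<in> M"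
    and x: "x \<in> lin R {a * b | a b. a \<in> M \<and> b \<in> w ` {..<t :: nat}}"
  shows "\<exists>c. (\<forall>j<t. c j \<in> M) \<and> x = (\<Sum>j<t. c j * w j)"
  using x
proof induction
  case zero
  show ?case by (intro exI[of _ "\<lambda>_. 0"]) (simp add: M(1))
next
  case (step r s x)
  then obtain i a c where i: "i < t" "s = a * w i" "a \<in> M" and c: "\<forall>j<t. c j \<in> M" "x = (\<Sum>j<t. c j * w j)" by blast
  define c' where "c' j = c j + (if j = i then r * a else 0)" for j
  have "(\<Sum>j<t. c' j * w j) = (\<Sum>j<t. c j * w j + (if j = i then r * a * w i else 0))"
    by (rule sum.cong) (auto simp: c'_def distrib_right)
  also have "\<dots> = r * s + x" using i c(2) by (simp add: sum.distrib add.commute mult.assoc)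
  finally have "r * s + x = (\<Sum>j<t. c' j * w j)" by simp
  moreover have "\<forall>j<t. c' j \<in> M" using c(1) i(3) step.hyps(1) M by (auto simp: c'_def)
  ultimately show ?case by blast
qed

context ferrers_prime
begin

lemma finite_gmons: "finite (gmons N)"
proof (rule finite_subset)
  show "gmons N \<subseteq> mset ` {xs. set xs \<subseteq> gens \<and> length xs = N}"
  proof
    fix \<gamma> assume "\<gamma> \<in> gmons N"
    moreover obtain xs where "mset xs = \<gamma>" using ex_mset by blast
    ultimately show "\<gamma> \<in> mset ` {xs. set xs \<subseteq> gens \<and> length xs = N}" by (auto simp: gmons_def)
  qed
  show "finite (mset ` {xs. set xs \<subseteq> gens \<and> length xs = N})"
    by (intro finite_imageI finite_lists_length_eq finite_gens)
qed

context
  fixes \<tau> :: "var + int \<Rightarrow> 'k mpoly"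
  assumes \<tau>R: "\<And>x. x \<in> gens \<Longrightarrow> \<tau> x \<in> R"
begin

text \<open>A relation rather than a function, because the value \<open>v\<close> at \<open>\<tau>\<close> of a form with value \<open>f\<close> at the
  generators is determined by \<open>f\<close> only modulo \<open>q\<close>.\<close>

definition specializes :: "nat \<Rightarrow> 'k mpoly \<Rightarrow> 'k mpoly \<Rightarrow> bool" where
  "specializes N f v \<longleftrightarrow> (\<exists>\<rho>. (\<forall>\<gamma>\<in>gmons N. \<rho> \<gamma> \<in> R) \<and> f = (\<Sum>\<gamma>\<in>gmons N. \<rho> \<gamma> * gprod \<gamma>)
     \<and> v = (\<Sum>\<gamma>\<in>gmons N. \<rho> \<gamma> * (\<Prod>x\<in>#\<gamma>. \<tau> x)))"

lemma specializes_zero: "specializes N 0 0"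
  unfolding specializes_def by (intro exI[of _ "\<lambda>_. 0"]) (simp add: subringD(2)[OF R_subring])

lemma specializes_add:
  assumes "specializes N f v" "specializes N g w"
  shows "specializes N (f + g) (v + w)"
proof -
  obtain \<rho> \<sigma> where "\<forall>\<gamma>\<in>gmons N. \<rho> \<gamma> \<in> R" "f = (\<Sum>\<gamma>\<in>gmons N. \<rho> \<gamma> * gprod \<gamma>)"
      "v = (\<Sum>\<gamma>\<in>gmons N. \<rho> \<gamma> * (\<Prod>x\<in>#\<gamma>. \<tau> x))" "\<forall>\<gamma>\<in>gmons N. \<sigma> \<gamma> \<in> R"
      "g = (\<Sum>\<gamma>\<in>gmons N. \<sigma> \<gamma> * gprod \<gamma>)" "w = (\<Sum>\<gamma>\<in>gmons N. \<sigma> \<gamma> * (\<Prod>x\<in>#\<gamma>. \<tau> x))"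
    using assms unfolding specializes_def by blast
  then show ?thesis unfolding specializes_def
    by (intro exI[of _ "\<lambda>\<gamma>. \<rho> \<gamma> + \<sigma> \<gamma>"]) (simp add: sum.distrib distrib_right subringD(6)[OF R_subring])
qed

lemma specializes_scale:
  assumes "r \<in> R" "specializes N f v"
  shows "specializes N (r * f) (r * v)"
proof -
  obtain \<rho> where "\<forall>\<gamma>\<in>gmons N. \<rho> \<gamma> \<in> R" "f = (\<Sum>\<gamma>\<in>gmons N. \<rho> \<gamma> * gprod \<gamma>)"
      "v = (\<Sum>\<gamma>\<in>gmons N. \<rho> \<gamma> * (\<Prod>x\<in>#\<gamma>. \<tau> x))"
    using assms unfolding specializes_def by blast
  then show ?thesis unfolding specializes_def using assms(1)
    by (intro exI[of _ "\<lambda>\<gamma>. r * \<rho> \<gamma>"]) (simp add: sum_distrib_left mult.assoc subringD(4)[OF R_subring])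
qed

lemma specializes_diff: "specializes N f v \<Longrightarrow> specializes N g w \<Longrightarrow> specializes N (f - g) (v - w)"
  using specializes_add[of N f v "- 1 * g" "- 1 * w"]
    specializes_scale[OF subringD(5)[OF R_subring subringD(1)[OF R_subring]], of N g w] by simp

lemma specializes_sum: "(\<And>i. i \<in> A \<Longrightarrow> specializes N (f i) (v i)) \<Longrightarrow> specializes N (sum f A) (sum v A)"
  by (induction A rule: infinite_finite_induct) (simp_all add: specializes_zero specializes_add)

lemma specializes_one: "specializes 0 1 1"
proof -
  have "gmons 0 = {{#}}" by (auto simp: gmons_def)
  then show ?thesis unfolding specializes_def
    by (intro exI[of _ "\<lambda>_. 1"]) (simp add: gprod_def subringD(1)[OF R_subring])
qed

lemma specializes_gen:
  assumes x: "x \<in> gens" and "specializes N f v"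
  shows "specializes (Suc N) (gen x * f) (\<tau> x * v)"
proof -
  obtain \<rho> where \<rho>: "\<forall>\<gamma>\<in>gmons N. \<rho> \<gamma> \<in> R" "f = (\<Sum>\<gamma>\<in>gmons N. \<rho> \<gamma> * gprod \<gamma>)"
      "v = (\<Sum>\<gamma>\<in>gmons N. \<rho> \<gamma> * (\<Prod>x\<in>#\<gamma>. \<tau> x))"
    using assms unfolding specializes_def by blast
  define \<rho>' where "\<rho>' \<delta> = (if x \<in># \<delta> then \<rho> (\<delta> - {#x#}) else 0)" for \<delta>
  have img: "add_mset x ` gmons N \<subseteq> gmons (Suc N)" using x by (auto simp: gmons_def)
  have notimg: "x \<notin># \<delta>" if "\<delta> \<in> gmons (Suc N) - add_mset x ` gmons N" for \<delta>
  proof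
    assume "x \<in># \<delta>"
    then obtain \<gamma> where "\<delta> = add_mset x \<gamma>" by (metis insert_DiffM)
    then show False using that by (auto simp: gmons_def)
  qed
  have key: "(\<Sum>\<delta>\<in>gmons (Suc N). \<rho>' \<delta> * h \<delta>) = (\<Sum>\<gamma>\<in>gmons N. \<rho> \<gamma> * h (add_mset x \<gamma>))" for h :: "_ \<Rightarrow> 'k mpoly"
  proof -
    have "(\<Sum>\<delta>\<in>gmons (Suc N). \<rho>' \<delta> * h \<delta>) = (\<Sum>\<delta>\<in>add_mset x ` gmons N. \<rho>' \<delta> * h \<delta>)"
      by (rule sum.mono_neutral_right[OF finite_gmons img]) (use notimg in \<open>auto simp: \<rho>'_def\<close>)
    also have "\<dots> = (\<Sum>\<gamma>\<in>gmons N. \<rho> \<gamma> * h (add_mset x \<gamma>))"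
      by (subst sum.reindex) (auto simp: inj_on_def \<rho>'_def)
    finally show ?thesis .
  qed
  have "\<forall>\<delta>\<in>gmons (Suc N). \<rho>' \<delta> \<in> R"
  proof
    fix \<delta> assume \<delta>: "\<delta> \<in> gmons (Suc N)"
    show "\<rho>' \<delta> \<in> R"
    proof (cases "x \<in># \<delta>")
      case True
      then have "\<delta> - {#x#} \<in> gmons N" using \<delta> by (auto simp: gmons_def size_Diff_singleton dest: in_diffD)
      then show ?thesis using \<rho>(1) True by (simp add: \<rho>'_def)
    qed (simp add: \<rho>'_def subringD(2)[OF R_subring])
  qed
  moreover have "gen x * f = (\<Sum>\<delta>\<in>gmons (Suc N). \<rho>' \<delta> * gprod \<delta>)"
    unfolding key \<rho>(2) sum_distrib_left by (rule sum.cong) (auto simp: gprod_def mult.left_commute)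
  moreover have "\<tau> x * v = (\<Sum>\<delta>\<in>gmons (Suc N). \<rho>' \<delta> * (\<Prod>x\<in>#\<delta>. \<tau> x))"
    unfolding key \<rho>(3) sum_distrib_left by (rule sum.cong) (auto simp: mult.left_commute)
  ultimately show ?thesis unfolding specializes_def by blast
qed

lemma specializes_mult:
  assumes f: "specializes N f v" and g: "specializes M g w"
  shows "specializes (N + M) (f * g) (v * w)"
proof -
  have *: "specializes (size \<gamma> + M) (gprod \<gamma> * g) ((\<Prod>x\<in>#\<gamma>. \<tau> x) * w)" if "set_mset \<gamma> \<subseteq> gens" for \<gamma>
    using that
  proof (induction \<gamma>)
    case empty
    show ?case using g by (simp add: gprod_def)
  next
    case (add x \<gamma>)
    then show ?case using specializes_gen[of x "size \<gamma> + M" "gprod \<gamma> * g"] by (simp add: gprod_def mult.assoc)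
  qed
  obtain \<rho> where \<rho>: "\<forall>\<gamma>\<in>gmons N. \<rho> \<gamma> \<in> R" "f = (\<Sum>\<gamma>\<in>gmons N. \<rho> \<gamma> * gprod \<gamma>)"
      "v = (\<Sum>\<gamma>\<in>gmons N. \<rho> \<gamma> * (\<Prod>x\<in>#\<gamma>. \<tau> x))"
    using f unfolding specializes_def by blast
  have "specializes (N + M) (\<Sum>\<gamma>\<in>gmons N. \<rho> \<gamma> * (gprod \<gamma> * g)) (\<Sum>\<gamma>\<in>gmons N. \<rho> \<gamma> * ((\<Prod>x\<in>#\<gamma>. \<tau> x) * w))"
  proof (rule specializes_sum)
    fix \<gamma> assume \<gamma>: "\<gamma> \<in> gmons N"
    then show "specializes (N + M) (\<rho> \<gamma> * (gprod \<gamma> * g)) (\<rho> \<gamma> * ((\<Prod>x\<in>#\<gamma>. \<tau> x) * w))"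
      using *[of \<gamma>] \<rho>(1) by (intro specializes_scale) (auto simp: gmons_def)
  qed
  then show ?thesis unfolding \<rho>(2,3) by (simp add: sum_distrib_right mult.assoc)
qed

lemma specializes_lin:
  assumes "\<And>x. x \<in> gens \<Longrightarrow> \<rho> x \<in> R"
  shows "specializes 1 (\<Sum>x\<in>gens. \<rho> x * gen x) (\<Sum>x\<in>gens. \<rho> x * \<tau> x)"
proof (rule specializes_sum, rule specializes_scale)
  fix x assume "x \<in> gens"
  then show "specializes 1 (gen x) (\<tau> x)" using specializes_gen[OF _ specializes_one, of x] by (simp add: One_nat_def)
qed (use assms in auto)

lemma specializes_zero_in_q:
  assumes "specializes N 0 v"
  shows "v \<in> q"
proof -
  obtain \<rho> where \<rho>: "\<forall>\<gamma>\<in>gmons N. \<rho> \<gamma> \<in> R" "0 = (\<Sum>\<gamma>\<in>gmons N. \<rho> \<gamma> * gprod \<gamma>)"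
      "v = (\<Sum>\<gamma>\<in>gmons N. \<rho> \<gamma> * (\<Prod>x\<in>#\<gamma>. \<tau> x))"
    using assms unfolding specializes_def by blast
  show ?thesis unfolding \<rho>(3)
  proof (rule q_sum)
    fix \<gamma> assume \<gamma>: "\<gamma> \<in> gmons N"
    have "\<rho> \<gamma> \<in> q" by (rule gprod_independent[OF finite_gmons _ _ \<gamma>]) (use \<rho> in auto)
    moreover have "(\<Prod>x\<in>#\<gamma>. \<tau> x) \<in> R" if "set_mset \<gamma> \<subseteq> gens" for \<gamma>
      using that by (induction \<gamma>) (auto intro: subringD[OF R_subring] \<tau>R)
    then have "(\<Prod>x\<in>#\<gamma>. \<tau> x) \<in> R" using \<gamma> by (simp add: gmons_def)
    ultimately have "(\<Prod>x\<in>#\<gamma>. \<tau> x) * \<rho> \<gamma> \<in> q" by (intro qD(3))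
    then show "\<rho> \<gamma> * (\<Prod>x\<in>#\<gamma>. \<tau> x) \<in> q" by (simp only: mult.commute)
  qed
qed

lemma no_reduction:
  assumes M: "ideal_in R M" and red: "reduces M r"
    and M_val: "\<And>f. f \<in> M \<Longrightarrow> \<exists>v\<in>q. specializes 1 f v"
    and e: "e \<in> ferrers_ideal n lam" and e_val: "\<exists>v. v - 1 \<in> q \<and> specializes 1 e v"
  shows False
proof -
  have q1: "v \<in> R" if "v - 1 \<in> q" for v
    using subringD(6)[OF R_subring qD(4)[OF that] subringD(1)[OF R_subring]] by simp
  define E where "E N = {x. \<exists>v. v - 1 \<in> q \<and> specializes N x v}" for N
  define D where "D N = {x. \<exists>v\<in>q. specializes N x v}" for N
  have "finite (Mon r :: 'k mpoly set)" by (rule finite_mons)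
  then obtain w and t :: nat where w: "(Mon r :: 'k mpoly set) = w ` {..<t}"
    by (metis finite_imp_nat_seg_image_inj_on lessThan_def)
  have "\<exists>c. \<forall>i<t. (\<forall>j<t. c i j \<in> M) \<and> e * w i = (\<Sum>j<t. c i j * w j)"
  proof -
    have "\<exists>c. (\<forall>j<t. c j \<in> M) \<and> e * w i = (\<Sum>j<t. c j * w j)" if i: "i < t" for i
    proof (rule finite_lin_prod_sum)
      show "0 \<in> M" "\<And>a b. a \<in> M \<Longrightarrow> b \<in> M \<Longrightarrow> a + b \<in> M" "\<And>r a. r \<in> R \<Longrightarrow> a \<in> M \<Longrightarrow> r * a \<in> M"
        using M by (auto simp: ideal_in_def)
      have wi: "w i \<in> Mon r" using i w by auto
      have "e \<in> lin R (Mon 1)" using e by (simp add: ferrers_ideal_eq)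
      then show "e * w i \<in> lin R {a * b | a b. a \<in> M \<and> b \<in> w ` {..<t}}"
      proof (rule lin_mult_const[OF R_subring])
        fix s :: "'k mpoly" assume "s \<in> Mon 1"
        then have "s * w i \<in> Mon (Suc r)" using wi by (rule mons_mult_1)
        then show "s * w i \<in> lin R {a * b | a b. a \<in> M \<and> b \<in> w ` {..<t}}"
          using red unfolding reduces_def w[symmetric] by blast
      qed
    qed
    then show ?thesis by metis
  qed
  then obtain c where c: "\<And>i j. i < t \<Longrightarrow> j < t \<Longrightarrow> c i j \<in> M" "\<And>i. i < t \<Longrightarrow> e * w i = (\<Sum>j<t. c i j * w j)" by blast
  define A where "A i j = (if i = j then e else 0) - c i j" for i j
  have A0: "(\<Sum>j<t. A i j * w j) = 0" if "i < t" for i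
  proof -
    have "(\<Sum>j<t. A i j * w j) = (\<Sum>j<t. (if j = i then e * w i else 0) - c i j * w j)"
      by (rule sum.cong) (auto simp: A_def left_diff_distrib)
    then show ?thesis using that c(2)[OF that] by (simp add: sum_subtractf)
  qed
  obtain ve where ve: "ve - 1 \<in> q" "specializes 1 e ve" using e_val by blast
  have off: "A i j \<in> D 1" if ij: "i < t" "j < t" "i \<noteq> j" for i j
  proof -
    obtain v where v: "v \<in> q" "specializes 1 (c i j) v" using M_val[OF c(1)[OF ij(1,2)]] by blast
    then show ?thesis using specializes_diff[OF specializes_zero v(2)] ij(3) qD(5)[OF qD(1) v(1)]
      by (auto simp: D_def A_def)
  qed
  have on: "A i i \<in> E 1" if i: "i < t" for i
  proof -
    obtain v where v: "v \<in> q" "specializes 1 (c i i) v" using M_val[OF c(1)[OF i i]] by blast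
    have "(ve - v) - 1 \<in> q" using qD(5)[OF ve(1) v(1)] by (simp add: algebra_simps)
    then show ?thesis using specializes_diff[OF ve(2) v(2)] by (auto simp: E_def A_def)
  qed
  have "\<exists>K z rr. z \<in> E K \<and> (\<forall>l<t. \<forall>i<t. rr l i \<in> UNIV) \<and>
      (\<forall>l<t. \<forall>j<t. (\<Sum>i<t. rr l i * A i j) = (if l = j then z else 0))"
  proof (rule triangular_quasi_inverse[of e E 1 D D UNIV t A 1])
    show "e \<in> E 1" using ve by (auto simp: E_def)
    have mult1: "v * v' - 1 \<in> q" if "v - 1 \<in> q" "v' - 1 \<in> q" for v v'
    proof -
      have "v' * (v - 1) + (v' - 1) \<in> q" using that q1 qD by blast
      then show ?thesis by (simp add: algebra_simps)
    qed
    show "x * y \<in> E (N + M)" if "x \<in> E N" "y \<in> E M" for x y N M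
      using that mult1 specializes_mult unfolding E_def by blast
    show "x * y - g * d \<in> E (N + N)" if xy: "x \<in> E N" "y \<in> E N" "g \<in> D N" "d \<in> D N" for x y g d N
    proof -
      obtain v v' u u' where v: "v - 1 \<in> q" "v' - 1 \<in> q" "u \<in> q" "u' \<in> q" "specializes N x v" "specializes N y v'"
        "specializes N g u" "specializes N d u'" using xy unfolding E_def D_def by blast
      have "specializes (N + N) (x * y - g * d) (v * v' - u * u')"
        by (intro specializes_diff specializes_mult v)
      moreover have "(v * v' - 1) - u * u' \<in> q" by (rule qD(5)[OF mult1[OF v(1,2)] qD(3)[OF qD(4)[OF v(3)] v(4)]])
      then have "(v * v' - u * u') - 1 \<in> q" by (simp add: algebra_simps)
      ultimately show ?thesis unfolding E_def by blast
    qed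
    have DD: "x * y - g * d \<in> D (N + N)" if xy: "x \<in> E N" "y \<in> D N" "g \<in> D N" "d \<in> D N" for x y g d N
    proof -
      obtain v v' u u' where v: "v - 1 \<in> q" "v' \<in> q" "u \<in> q" "u' \<in> q" "specializes N x v" "specializes N y v'"
        "specializes N g u" "specializes N d u'" using xy unfolding E_def D_def by blast
      have "specializes (N + N) (x * y - g * d) (v * v' - u * u')"
        by (intro specializes_diff specializes_mult v)
      moreover have "v * v' - u * u' \<in> q"
        by (rule qD(5)[OF qD(3)[OF q1[OF v(1)] v(2)] qD(3)[OF qD(4)[OF v(3)] v(4)]])
      ultimately show ?thesis unfolding D_def by blast
    qed
    show "x * y - g * d \<in> D (N + N)" if "x \<in> E N" "y \<in> D N" "g \<in> D N" "d \<in> D N" for x y g d N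
      by (rule DD[OF that])
    show "x * y - g * d \<in> D (N + N)" if "x \<in> E N" "y \<in> D N" "g \<in> D N" "d \<in> D N" for x y g d N
      by (rule DD[OF that])
  qed (use on off in auto)
  then obtain K z rr where zr: "z \<in> E K \<and> (\<forall>l<t. \<forall>i<t. rr l i \<in> UNIV) \<and>
      (\<forall>l<t. \<forall>j<t. (\<Sum>i<t. rr l i * A i j) = (if l = j then z else 0))"
    by (elim exE) (rule that)
  have z: "z \<in> E K" and rr: "\<And>l j. l < t \<Longrightarrow> j < t \<Longrightarrow> (\<Sum>i<t. rr l i * A i j) = (if l = j then z else 0)"
    using zr by simp_all
  have "Mon k \<noteq> {}" for k
  proof (induction k)
    case (Suc k)
    have "(1, 1) \<in> shape lam n 1" using n_pos lam_pos[of 1] by (simp add: shape_def Suc_le_eq One_nat_def)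
    then show ?case using Suc mons_SucI by blast
  qed simp
  then have "0 < t" using w[symmetric] by (cases t) auto
  then have w0: "w 0 \<in> Mon r" unfolding w by blast
  have "w 0 * z = (\<Sum>j<t. if j = 0 then z * w 0 else 0)" using \<open>0 < t\<close> by (simp add: mult.commute)
  also have "\<dots> = (\<Sum>j<t. (\<Sum>i<t. rr 0 i * A i j) * w j)" using rr \<open>0 < t\<close> by (intro sum.cong) auto
  also have "\<dots> = (\<Sum>i<t. rr 0 i * (\<Sum>j<t. A i j * w j))"
    unfolding sum_distrib_left sum_distrib_right mult.assoc by (rule sum.swap)
  also have "\<dots> = 0" using A0 by simp
  finally have "w 0 * z = w 0 * 0" by simp
  moreover obtain u where "w 0 = Poly_Mapping.single u 1" using mons_single[OF w0] by blast
  ultimately have "z = 0" using single_one_mult_cancel by metis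
  then obtain v where v: "v - 1 \<in> q" "specializes K 0 v" using z by (auto simp: E_def)
  have "v - (v - 1) \<in> q" by (rule qD(5)[OF specializes_zero_in_q[OF v(2)] v(1)])
  then show False using one_notin by simp
qed

end

abbreviation "diags \<equiv> diag_ideal :: 'k mpoly set"

text \<open>The preimage in \<open>R\<close> of the localization of \<open>S\<close> at \<open>q\<close>.\<close>

definition loc :: "'k mpoly set \<Rightarrow> 'k mpoly set" where
  "loc S = {f \<in> R. \<exists>u\<in>R. u \<notin> q \<and> u * f \<in> S}"

lemma loc_add:
  assumes S: "ideal_in R S" and "f \<in> loc S" "g \<in> loc S"
  shows "f + g \<in> loc S"
proof -
  obtain u v where *: "f \<in> R" "g \<in> R" "u \<in> R" "v \<in> R" "u \<notin> q" "v \<notin> q" "u * f \<in> S" "v * g \<in> S" using assms unfolding loc_def by blast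
  have "v * (u * f) + u * (v * g) \<in> S" using S * unfolding ideal_in_def by blast
  then have "(u * v) * (f + g) \<in> S" by (simp add: algebra_simps)
  moreover have "u * v \<notin> q" using q_prime * by blast
  moreover have "u * v \<in> R" "f + g \<in> R" using * by (simp_all add: subringD[OF R_subring])
  ultimately show ?thesis unfolding loc_def by blast
qed

lemma loc_scale:
  assumes S: "ideal_in R S" and "r \<in> R" "f \<in> loc S"
  shows "r * f \<in> loc S"
proof -
  obtain u where *: "f \<in> R" "u \<in> R" "u \<notin> q" "u * f \<in> S" using assms unfolding loc_def by blast
  have "r * (u * f) \<in> S" using S * assms(2) unfolding ideal_in_def by blast
  then have "u * (r * f) \<in> S" by (simp add: mult.left_commute)
  moreover have "r * f \<in> R" using * assms(2) by (simp add: subringD[OF R_subring])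
  ultimately show ?thesis using * unfolding loc_def by blast
qed

lemma loc_base: "ideal_in R S \<Longrightarrow> f \<in> S \<Longrightarrow> f \<in> loc S"
  unfolding loc_def ideal_in_def using one_notin subringD(1)[OF R_subring] by (auto intro!: bexI[of _ 1])

lemma loc_diff:
  assumes S: "ideal_in R S" and "f \<in> loc S" "g \<in> loc S"
  shows "f - g \<in> loc S"
  using loc_add[OF S assms(2) loc_scale[OF S subringD(5)[OF R_subring subringD(1)[OF R_subring]] assms(3)]] by simp

lemma loc_sum: "ideal_in R S \<Longrightarrow> (\<And>i. i \<in> A \<Longrightarrow> f i \<in> loc S) \<Longrightarrow> sum f A \<in> loc S"
proof (induction A rule: infinite_finite_induct)
  case (insert x F)
  then show ?case by (simp add: loc_add)
qed (auto intro: loc_base simp: ideal_in_def)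

lemma loc_solve:
  fixes A :: "nat \<Rightarrow> nat \<Rightarrow> 'k mpoly" and w :: "nat \<Rightarrow> 'k mpoly"
  assumes S: "ideal_in R S" and A: "\<And>i j. A i j \<in> R" "\<And>i. i < t \<Longrightarrow> A i i \<notin> q" "\<And>i j. j < i \<Longrightarrow> i < t \<Longrightarrow> A i j \<in> q"
    and wR: "\<And>i. i < t \<Longrightarrow> w i \<in> R" and sum: "\<And>i. i < t \<Longrightarrow> (\<Sum>j<t. A i j * w j) \<in> S" and l: "l < t"
  shows "w l \<in> loc S"
proof -
  have "\<exists>K z r. z \<in> (\<lambda>_ :: nat. R - q) K \<and> (\<forall>l<t. \<forall>i<t. r l i \<in> R) \<and>
      (\<forall>l<t. \<forall>j<t. (\<Sum>i<t. r l i * A i j) = (if l = j then z else 0))"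
  proof (rule triangular_quasi_inverse[of 1 "\<lambda>_. R - q" 0 "\<lambda>_. R" "\<lambda>_. q" R t A 0])
    show "1 \<in> R - q" using one_notin subringD(1)[OF R_subring] by simp
    show mult: "e * f \<in> R - q" if "e \<in> R - q" "f \<in> R - q" for e f
      using that q_prime[of e f] by (auto simp: subringD[OF R_subring])
    show "e * f - g * d \<in> R - q" if "e \<in> R - q" "f \<in> R - q" "g \<in> R" "d \<in> q" for e f g d
    proof -
      have gd: "g * d \<in> q" using that qD by blast
      have "e * f - g * d \<notin> q"
      proof
        assume "e * f - g * d \<in> q"
        then have "(e * f - g * d) + g * d \<in> q" using gd by (rule qD(2))
        then show False using mult[OF that(1,2)] by simp
      qed
      moreover have "e * f - g * d \<in> R" using that qD(4) by (simp add: subringD[OF R_subring])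
      ultimately show ?thesis by simp
    qed
    show "e * f - g * d \<in> q" if "e \<in> R - q" "f \<in> q" "g \<in> R" "d \<in> q" for e f g d
      using that by (intro qD(5) qD(3)) auto
    show "e * f - g * d \<in> R" if "e \<in> R - q" "f \<in> R" "g \<in> R" "d \<in> q" for e f g d
      using that qD(4) by (simp add: subringD[OF R_subring])
    show "q \<subseteq> R" using qD(4) by blast
  qed (use A in \<open>auto simp: subringD[OF R_subring]\<close>)
  then obtain K :: nat and z r where zr: "z \<in> (\<lambda>_ :: nat. R - q) K \<and> (\<forall>l<t. \<forall>i<t. r l i \<in> R) \<and>
      (\<forall>l<t. \<forall>j<t. (\<Sum>i<t. r l i * A i j) = (if l = j then z else 0))"
    by (elim exE) (rule that)
  have z: "z \<in> R - q" and rR: "\<And>l i. l < t \<Longrightarrow> i < t \<Longrightarrow> r l i \<in> R"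
    and r: "\<And>l j. l < t \<Longrightarrow> j < t \<Longrightarrow> (\<Sum>i<t. r l i * A i j) = (if l = j then z else 0)"
    using zr by simp_all
  have "z * w l = (\<Sum>j<t. if j = l then z * w l else 0)" using l by simp
  also have "\<dots> = (\<Sum>j<t. (\<Sum>i<t. r l i * A i j) * w j)" using r l by (intro sum.cong) auto
  also have "\<dots> = (\<Sum>i<t. r l i * (\<Sum>j<t. A i j * w j))"
    unfolding sum_distrib_left sum_distrib_right mult.assoc by (rule sum.swap)
  also have "\<dots> \<in> S"
  proof -
    have "(\<Sum>i\<in>I. r l i * (\<Sum>j<t. A i j * w j)) \<in> S" if "I \<subseteq> {..<t}" "finite I" for I
      using that(2,1)
    proof (induction I)
      case (insert i I)
      then show ?case using S rR[OF l, of i] sum[of i] by (simp add: ideal_in_def)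
    qed (use S in \<open>simp add: ideal_in_def\<close>)
    then show ?thesis by blast
  qed
  finally show ?thesis using z wR[OF l] unfolding loc_def by blast
qed

lemma diags_ideal: "ideal_in R diags"
  by (rule diag_ideal_ideal)

lemma diag_in_diags: "diag lam n 1 d \<in> diags"
  by (rule lin_base[OF R_subring]) simp

lemma Y_loc:
  assumes "1 \<le> j" "j \<le> a"
  shows "var (Y j) \<in> loc diags"
proof -
  have i0n: "(i0, j) \<in> shape lam n 1" if "1 \<le> j" "j \<le> a" for j using a_row[OF that] .
  define A where "A k l = (if k < i0 + l \<and> (i0 + l - k, l + 1) \<in> shape lam n 1 then var (X (i0 + l - k)) else 0 :: 'k mpoly)" for k l
  have "var (Y (l + 1)) \<in> loc diags" if "l < a" for l
  proof (rule loc_solve[OF diags_ideal, of A a "\<lambda>l. var (Y (l + 1))" l])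
    show "A k l \<in> R" for k l using shape_vars[of "i0 + l - k" "l + 1" 1] var_R by (auto simp: A_def subringD[OF R_subring])
    show "A k k \<notin> q" if "k < a" for k
      using i0n[of "k + 1"] that X_out i0 by (auto simp: A_def shape_def)
    show "A k l \<in> q" if "l < k" "k < a" for k l
      using that X_in by (auto simp: A_def qD(1))
    show "var (Y (l + 1)) \<in> R" if "l < a" for l
      using shape_vars[OF i0n[of "l + 1"]] that var_R by auto
    show "(\<Sum>l<a. A k l * var (Y (l + 1))) \<in> diags" if k: "k < a" for k
    proof -
      define d where "d = int (k + 1) - int i0"
      define L where "L = {l. l < a \<and> k < i0 + l \<and> (i0 + l - k, l + 1) \<in> shape lam n 1}"
      have "diag lam n 1 d = (\<Sum>l\<in>L. xy (i0 + l - k) (l + 1) :: 'k mpoly)"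
        unfolding diag_def
      proof (rule sum.reindex_bij_witness[of _ "\<lambda>l. (i0 + l - k, l + 1)" "\<lambda>(i, j). j - 1"])
        fix c assume "c \<in> diag_cells lam n 1 d"
        then obtain i j where c: "c = (i, j)" "(i, j) \<in> shape lam n 1" "int j - int i = d" by (auto simp: diag_cells_def)
        have "1 \<le> i" "1 \<le> j" using c(2) by (auto simp: shape_def)
        then have i: "i0 + (j - 1) - k = i" "k < i0 + (j - 1)" "j - 1 + 1 = j" using c(3) by (auto simp: d_def)
        have "j \<le> a"
        proof (cases "i0 \<le> i")
          case True
          then show ?thesis using row_bound c(2) by blast
        next
          case False
          then show ?thesis using c(3) k by (auto simp: d_def)
        qed
        then have ja: "j - 1 < a" using \<open>1 \<le> j\<close> by simp
        show "(i0 + (case c of (i, j) \<Rightarrow> j - 1) - k, (case c of (i, j) \<Rightarrow> j - 1) + 1) = c"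
          using i c(1) by simp
        show "(case c of (i, j) \<Rightarrow> j - 1) \<in> L" using i c ja unfolding L_def by simp
        show "xy (i0 + (case c of (i, j) \<Rightarrow> j - 1) - k) ((case c of (i, j) \<Rightarrow> j - 1) + 1) = (case c of (i, j) \<Rightarrow> (xy i j :: 'k mpoly))"
          using i c(1) by simp
      next
        fix l assume "l \<in> L"
        then have l: "k < i0 + l" "(i0 + l - k, l + 1) \<in> shape lam n 1" by (auto simp: L_def)
        show "(case (i0 + l - k, l + 1) of (i, j) \<Rightarrow> j - 1) = l" by simp
        show "(i0 + l - k, l + 1) \<in> diag_cells lam n 1 d" using l by (auto simp: diag_cells_def d_def)
      qed
      also have "\<dots> = (\<Sum>l\<in>L. A k l * var (Y (l + 1)))"
        by (rule sum.cong) (auto simp: L_def A_def xy_eq_var)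
      also have "\<dots> = (\<Sum>l<a. A k l * var (Y (l + 1)))"
        by (rule sum.mono_neutral_left) (auto simp: L_def A_def)
      finally show ?thesis using diag_in_diags[of d] by simp
    qed
  qed (use that in auto)
  from this[of "j - 1"] show ?thesis using assms by simp
qed

lemma X_loc:
  assumes "1 \<le> i" "i \<le> b"
  shows "var (X i) \<in> loc diags"
proof -
  have j0n: "(i, j0) \<in> shape lam n 1" if "1 \<le> i" "i \<le> b" for i using b_col[OF that] .
  define A where "A k l = (if k < j0 + l \<and> (l + 1, j0 + l - k) \<in> shape lam n 1 then var (Y (j0 + l - k)) else 0 :: 'k mpoly)" for k l
  have "var (X (l + 1)) \<in> loc diags" if "l < b" for l
  proof (rule loc_solve[OF diags_ideal, of A b "\<lambda>l. var (X (l + 1))" l])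
    show "A k l \<in> R" for k l using shape_vars[of "l + 1" "j0 + l - k" 1] var_R by (auto simp: A_def subringD[OF R_subring])
    show "A k k \<notin> q" if "k < b" for k
      using j0n[of "k + 1"] noninc[of 1 "k + 1"] that Y_out j0 by (auto simp: A_def shape_def)
    show "A k l \<in> q" if "l < k" "k < b" for k l
      using that Y_in by (auto simp: A_def qD(1))
    show "var (X (l + 1)) \<in> R" if "l < b" for l
      using shape_vars[OF j0n[of "l + 1"]] that var_R by auto
    show "(\<Sum>l<b. A k l * var (X (l + 1))) \<in> diags" if k: "k < b" for k
    proof -
      define d where "d = int j0 - int (k + 1)"
      define L where "L = {l. l < b \<and> k < j0 + l \<and> (l + 1, j0 + l - k) \<in> shape lam n 1}"
      have "diag lam n 1 d = (\<Sum>l\<in>L. xy (l + 1) (j0 + l - k) :: 'k mpoly)"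
        unfolding diag_def
      proof (rule sum.reindex_bij_witness[of _ "\<lambda>l. (l + 1, j0 + l - k)" "\<lambda>(i, j). i - 1"])
        fix c assume "c \<in> diag_cells lam n 1 d"
        then obtain i j where c: "c = (i, j)" "(i, j) \<in> shape lam n 1" "int j - int i = d" by (auto simp: diag_cells_def)
        have "1 \<le> i" "1 \<le> j" using c(2) by (auto simp: shape_def)
        then have i: "j0 + (i - 1) - k = j" "k < j0 + (i - 1)" "i - 1 + 1 = i" using c(3) by (auto simp: d_def)
        have "i \<le> b"
        proof (cases "j0 \<le> j")
          case True
          then show ?thesis using col_bound c(2) by blast
        next
          case False
          then show ?thesis using c(3) k by (auto simp: d_def)
        qed
        then have ja: "i - 1 < b" using \<open>1 \<le> i\<close> by simp
        show "((case c of (i, j) \<Rightarrow> i - 1) + 1, j0 + (case c of (i, j) \<Rightarrow> i - 1) - k) = c"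
          using i c(1) by simp
        show "(case c of (i, j) \<Rightarrow> i - 1) \<in> L" using i c ja unfolding L_def by simp
        show "xy ((case c of (i, j) \<Rightarrow> i - 1) + 1) (j0 + (case c of (i, j) \<Rightarrow> i - 1) - k) = (case c of (i, j) \<Rightarrow> (xy i j :: 'k mpoly))"
          using i c(1) by simp
      next
        fix l assume "l \<in> L"
        then have l: "k < j0 + l" "(l + 1, j0 + l - k) \<in> shape lam n 1" by (auto simp: L_def)
        show "(case (l + 1, j0 + l - k) of (i, j) \<Rightarrow> i - 1) = l" by simp
        show "(l + 1, j0 + l - k) \<in> diag_cells lam n 1 d" using l by (auto simp: diag_cells_def d_def)
      qed
      also have "\<dots> = (\<Sum>l\<in>L. A k l * var (X (l + 1)))"
        by (rule sum.cong) (auto simp: L_def A_def xy_eq_var mult.commute)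
      also have "\<dots> = (\<Sum>l<b. A k l * var (X (l + 1)))"
        by (rule sum.mono_neutral_left) (auto simp: L_def A_def)
      finally show ?thesis using diag_in_diags[of d] by simp
    qed
  qed (use that in auto)
  from this[of "i - 1"] show ?thesis using assms by simp
qed

lemma outer_cell:
  assumes "(i, j) \<in> diag_cells lam n 1 d - inner_cells d"
  shows "(1 \<le> i \<and> i \<le> b) \<or> (1 \<le> j \<and> j \<le> a)"
proof -
  have sh: "(i, j) \<in> shape lam n 1" and "\<not> (b < i \<and> i < i0 \<and> a < j \<and> j < j0)"
    using assms by (auto simp: diag_cells_def inner_cells_def)
  then show ?thesis using row_bound[OF sh] col_bound[OF sh] by (auto simp: shape_def)
qed

lemma diag_split: "diag lam n 1 d = gen (Inr d) + (\<Sum>(i, j)\<in>diag_cells lam n 1 d - inner_cells d. xy i j)"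
proof -
  have "inner_cells d \<subseteq> diag_cells lam n 1 d" by (auto simp: inner_cells_def)
  then show ?thesis unfolding diag_def gen_def
    by (simp add: sum.subset_diff[OF _ finite_diag_cells] add.commute)
qed

lemma gens_loc: "x \<in> gens \<Longrightarrow> gen x \<in> loc diags"
proof (cases x)
  case (Inl v)
  assume "x \<in> gens"
  then show ?thesis using Inl X_loc Y_loc by (auto simp: gens_def gen_def)
next
  case (Inr d)
  have "(\<Sum>c\<in>diag_cells lam n 1 d - inner_cells d. case c of (i, j) \<Rightarrow> xy i j) \<in> loc diags"
  proof (rule loc_sum[OF diags_ideal])
    fix c assume c: "c \<in> diag_cells lam n 1 d - inner_cells d"
    obtain i j where ij: "c = (i, j)" by (cases c)
    have "(i, j) \<in> shape lam n 1" using c ij by (auto simp: diag_cells_def)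
    then have R: "var (X i) \<in> R" "var (Y j) \<in> R" using shape_vars[of i j 1] var_R by auto
    have "xy i j \<in> loc diags" unfolding xy_eq_var
      using outer_cell[OF c[unfolded ij]]
    proof
      assume "1 \<le> i \<and> i \<le> b"
      then have "var (Y j) * var (X i) \<in> loc diags" by (intro loc_scale[OF diags_ideal R(2)] X_loc) auto
      then show "var (X i) * var (Y j) \<in> loc diags" by (simp add: mult.commute)
    next
      assume "1 \<le> j \<and> j \<le> a"
      then show "var (X i) * var (Y j) \<in> loc diags" by (intro loc_scale[OF diags_ideal R(1)] Y_loc) auto
    qed
    then show "(case c of (i, j) \<Rightarrow> xy i j) \<in> loc diags" using ij by simp
  qed
  from loc_diff[OF diags_ideal loc_base[OF diags_ideal diag_in_diags[of d]] this]
  show ?thesis using Inr diag_split[of d] by simp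
qed

lemma diags_subset_gens: "diags \<subseteq> lin R (gen ` gens)"
proof (rule lin_subset_lin[OF R_subring], rule image_subsetI)
  fix d
  have "gen (Inr d) \<in> lin R (gen ` gens)"
  proof (cases "inner_cells d = {}")
    case True
    then show ?thesis by (simp add: gen_def lin.zero)
  next
    case False
    then show ?thesis by (intro lin_base[OF R_subring] imageI) (simp add: gens_def)
  qed
  moreover have "(\<Sum>c\<in>diag_cells lam n 1 d - inner_cells d. case c of (i, j) \<Rightarrow> xy i j) \<in> lin R (gen ` gens)"
  proof (rule lin_sum)
    fix c assume c: "c \<in> diag_cells lam n 1 d - inner_cells d"
    obtain i j where ij: "c = (i, j)" by (cases c)
    have "(i, j) \<in> shape lam n 1" using c ij by (auto simp: diag_cells_def)
    then have R: "var (X i) \<in> R" "var (Y j) \<in> R" using shape_vars[of i j 1] var_R by auto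
    have g: "var v \<in> lin R (gen ` gens)" if "Inl v \<in> gens" for v
      using that by (intro lin_base[OF R_subring] image_eqI[of _ _ "Inl v"]) (simp_all add: gen_def)
    have "xy i j \<in> lin R (gen ` gens)" unfolding xy_eq_var
      using outer_cell[OF c[unfolded ij]]
    proof
      assume "1 \<le> i \<and> i \<le> b"
      then have "var (Y j) * var (X i) \<in> lin R (gen ` gens)"
        by (intro lin_scale[OF R_subring R(2)] g) (simp add: gens_def)
      then show "var (X i) * var (Y j) \<in> lin R (gen ` gens)" by (simp add: mult.commute)
    next
      assume "1 \<le> j \<and> j \<le> a"
      then show "var (X i) * var (Y j) \<in> lin R (gen ` gens)"
        by (intro lin_scale[OF R_subring R(1)] g) (simp add: gens_def)
    qed
    then show "(case c of (i, j) \<Rightarrow> xy i j) \<in> lin R (gen ` gens)" using ij by simp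
  qed
  ultimately show "diag lam n 1 d \<in> lin R (gen ` gens)" unfolding diag_split[of d] by (rule lin_add)
qed

end

section \<open>Minimality of the diagonal ideal\<close>

lemma maximal_proper_subideal:
  assumes R: "subring R" and S: "finite S" and J: "ideal_in R J" "J \<subset> lin R S"
  shows "\<exists>M. ideal_in R M \<and> J \<subseteq> M \<and> M \<subset> lin R S \<and>
    (\<forall>K. ideal_in R K \<longrightarrow> M \<subseteq> K \<longrightarrow> K \<subseteq> lin R S \<longrightarrow> K = M \<or> K = lin R S)"
proof -
  let ?A = "{K. ideal_in R K \<and> J \<subseteq> K \<and> K \<subset> lin R S}"
  have "\<exists>M\<in>?A. \<forall>K\<in>?A. M \<subseteq> K \<longrightarrow> K = M"
  proof (rule subset_Zorn_nonempty)
    show "?A \<noteq> {}" using J by blast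
    fix C assume C: "C \<noteq> {}" "subset.chain ?A C"
    then have CA: "\<And>K. K \<in> C \<Longrightarrow> ideal_in R K \<and> J \<subseteq> K \<and> K \<subset> lin R S"
      and lin: "\<And>K L. K \<in> C \<Longrightarrow> L \<in> C \<Longrightarrow> K \<subseteq> L \<or> L \<subseteq> K"
      by (auto simp: subset.chain_def)
    have "ideal_in R (\<Union>C)"
      unfolding ideal_in_def
    proof (intro conjI ballI)
      show "\<Union>C \<subseteq> R" using CA unfolding ideal_in_def by blast
      show "0 \<in> \<Union>C" using CA C(1) unfolding ideal_in_def by blast
      show "a + b \<in> \<Union>C" if ab: "a \<in> \<Union>C" "b \<in> \<Union>C" for a b
      proof -
        obtain K L where KL: "K \<in> C" "L \<in> C" "a \<in> K" "b \<in> L" using ab by blast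
        then obtain N where "N \<in> C" "a \<in> N" "b \<in> N" using lin[of K L] by blast
        then show ?thesis using CA unfolding ideal_in_def by blast
      qed
      show "r * a \<in> \<Union>C" if "r \<in> R" "a \<in> \<Union>C" for r a using that CA unfolding ideal_in_def by blast
    qed
    moreover have "J \<subseteq> \<Union>C" using CA C(1) by blast
    moreover have "\<Union>C \<noteq> lin R S"
    proof
      assume eq: "\<Union>C = lin R S"
      then have "S \<subseteq> \<Union>C" using lin_base[OF R] by blast
      then obtain K where K: "K \<in> C" "S \<subseteq> K"
        using finite_subset_Union_chain[OF S _ C] by blast
      then have "lin R S \<subseteq> K" using CA lin_subset_ideal by blast
      then show False using CA[OF K(1)] by blast
    qed
    ultimately show "\<Union>C \<in> ?A" using CA by blast
  qed
  then obtain M where MA: "M \<in> ?A" and max: "\<forall>K\<in>?A. M \<subseteq> K \<longrightarrow> K = M" by (elim bexE)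
  have M: "ideal_in R M" "J \<subseteq> M" "M \<subset> lin R S" using MA by simp_all
  have "K = M \<or> K = lin R S" if K: "ideal_in R K" "M \<subseteq> K" "K \<subseteq> lin R S" for K
  proof (rule disjCI)
    assume "K \<noteq> lin R S"
    then have "K \<in> ?A" using K M(2) by (simp add: psubset_eq)
    then show "K = M" using max K(2) by simp
  qed
  then show ?thesis using M by (intro exI[of _ M]) simp
qed

context ferrers
begin

lemma diag_ideal_subset: "(diag_ideal :: 'k::field mpoly set) \<subseteq> ferrers_ideal n lam"
  unfolding ferrers_ideal_eq
proof (rule lin_subset_lin[OF R_subring], rule image_subsetI)
  fix d
  show "diag lam n 1 d \<in> lin R (Mon 1 :: 'k mpoly set)"
    unfolding ferrers_ring_def
    by (rule span_subset_lin[OF diag_span]) (rule lin_base[OF subring_poly_ring])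
qed

lemma diag_ideal_finite: "(diag_ideal :: 'k::field mpoly set) = lin R (diag_at ` {..<spread})"
proof (intro equalityI lin_subset_lin[OF R_subring] image_subsetI)
  fix d
  show "diag lam n 1 d \<in> lin R (diag_at ` {..<spread} :: 'k mpoly set)"
    using diag_cases[of d, where 'a = 'k]
  proof
    assume "diag lam n 1 d = (0 :: 'k mpoly)"
    then show ?thesis by (simp add: lin.zero)
  next
    assume "\<exists>i<spread. diag lam n 1 d = (diag_at i :: 'k mpoly)"
    then obtain i where "i < spread" "diag lam n 1 d = (diag_at i :: 'k mpoly)" by blast
    then show ?thesis by (intro lin_base[OF R_subring]) simp
  qed
next
  fix i show "diag_at i \<in> (diag_ideal :: 'k mpoly set)"
    unfolding diag_at_def by (rule lin_base[OF R_subring]) simp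
qed

lemma diag_upper_eq: "diag_upper n lam k = diag lam n 1 (int k)"
  unfolding diag_upper_def diag_def
  by (rule sum.reindex_bij_witness[of _ fst "\<lambda>i. (i, k + i)"]) (auto simp: diag_cells_def shape_def)

lemma diag_lower_eq: "diag_lower n lam k = diag lam n 1 (- int k)"
proof -
  have "int b - int a = - int k \<longleftrightarrow> a = k + b" for a b by linarith
  then show ?thesis
    unfolding diag_lower_def diag_def
    by (intro sum.reindex_bij_witness[of _ snd "\<lambda>i. (k + i, i)"]) (auto simp: diag_cells_def shape_def)
qed

lemma diag_reduction_eq: "diag_reduction n lam = (diag_ideal :: 'k::field mpoly set)"
proof -
  let ?S = "{diag_upper n lam k | k. k < lam 1} \<union> {diag_lower n lam k | k. 1 \<le> k \<and> k \<le> n - 1} :: 'k mpoly set"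
  have S: "?S \<subseteq> Set.range (diag lam n 1)" by (auto simp: diag_upper_eq diag_lower_eq)
  have "?S \<subseteq> R" by (rule order_trans[OF S], rule image_subsetI, rule diag_in_R)
  then have "diag_reduction n lam = lin R ?S" unfolding diag_reduction_def by (rule gen_ideal_eq_lin[OF R_subring])
  also have "\<dots> = diag_ideal"
  proof (rule equalityI; rule lin_subset_lin[OF R_subring])
    show "?S \<subseteq> diag_ideal" by (rule order_trans[OF S], rule image_subsetI, rule lin_base[OF R_subring], rule rangeI)
    show "Set.range (diag lam n 1) \<subseteq> lin R ?S"
    proof (rule image_subsetI)
      fix d
      consider "0 \<le> d" "d < int (lam 1)" | "- int (n - 1) \<le> d" "d < 0" | "\<not> (- int (n - 1) \<le> d \<and> d < int (lam 1))" by linarith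
      then show "diag lam n 1 d \<in> lin R ?S"
      proof cases
        case 1
        have "diag lam n 1 d = diag_upper n lam (nat d)" "nat d < lam 1" using 1 by (auto simp: diag_upper_eq)
        then show ?thesis by (intro lin_base[OF R_subring] UnI1 CollectI exI[of _ "nat d"] conjI)
      next
        case 2
        have "diag lam n 1 d = diag_lower n lam (nat (- d))" "1 \<le> nat (- d)" "nat (- d) \<le> n - 1"
          using 2 by (auto simp: diag_lower_eq)
        then show ?thesis by (intro lin_base[OF R_subring] UnI2 CollectI exI[of _ "nat (- d)"] conjI)
      next
        case 3
        then show ?thesis by (simp add: diag_out_of_range lin.zero)
      qed
    qed
  qed
  finally show ?thesis .
qed

lemma reduces_diag_ideal:
  assumes "strict_num lam n 1 (Suc r) = 0"
  shows "reduces (diag_ideal :: 'k::field mpoly set) r"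
proof -
  have "card (strict_mons lam n 1 (Suc r) :: 'k mpoly set) = 0"
    using card_strict_mons_le[of lam n 1 "Suc r", where 'k = 'k] assms by simp
  then have empty: "(strict_mons lam n 1 (Suc r) :: 'k mpoly set) = {}" using finite_strict_mons[of lam n 1 "Suc r", where 'a = 'k] by (simp add: card_eq_0_iff)
  show ?thesis unfolding reduces_def
  proof (rule mons_straighten)
    show "lam j \<le> lam i" if "1 \<le> i" "i \<le> j" "j \<le> n" for i j using noninc that by simp
    show "0 \<in> lin R {a * b | a b. a \<in> diag_ideal \<and> b \<in> (Mon r :: 'k mpoly set)}" by (rule lin.zero)
    show "a - b \<in> lin R {a * b | a b. a \<in> diag_ideal \<and> b \<in> (Mon r :: 'k mpoly set)}"
      if "a \<in> lin R {a * b | a b. a \<in> diag_ideal \<and> b \<in> Mon r}" "b \<in> lin R {a * b | a b. a \<in> diag_ideal \<and> b \<in> Mon r}" for a b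
      using that by (rule lin_diff[OF R_subring])
    show "diag lam n 1 d * m \<in> lin R {a * b | a b. a \<in> diag_ideal \<and> b \<in> (Mon r :: 'k mpoly set)}"
      if "Suc r = Suc k'" "m \<in> Mon k'" for d m k'
      using that lin_base[OF R_subring, of "diag lam n 1 d" "Set.range (diag lam n 1 :: int \<Rightarrow> 'k mpoly)"]
      by (intro lin_base[OF R_subring]) blast
  qed (simp add: empty)
qed

lemma diag_ideal_no_smaller:
  fixes J :: "'k::field mpoly set"
  assumes J: "ideal_in R J" "J \<subseteq> diag_ideal" and redJ: "reduces J r"
  shows "J = diag_ideal"
proof (rule ccontr)
  let ?D = "diag_ideal :: 'k mpoly set"
  assume "J \<noteq> ?D"
  then have "J \<subset> lin R (diag_at ` {..<spread})" using J(2) unfolding diag_ideal_finite by blast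
  then obtain M where M: "ideal_in R M" "J \<subseteq> M" "M \<subset> ?D"
    and max: "\<And>K. ideal_in R K \<Longrightarrow> M \<subseteq> K \<Longrightarrow> K \<subseteq> ?D \<Longrightarrow> K = M \<or> K = ?D"
    using maximal_proper_subideal[OF R_subring _ J(1), of "diag_at ` {..<spread}"] unfolding diag_ideal_finite by auto
  have redM: "reduces M r" unfolding reduces_def
  proof
    fix m :: "'k mpoly" assume "m \<in> Mon (Suc r)"
    then have "m \<in> lin R {a * b | a b. a \<in> J \<and> b \<in> Mon r}" using redJ unfolding reduces_def by blast
    moreover have "{a * b | a b. a \<in> J \<and> b \<in> Mon r} \<subseteq> {a * b | a b. a \<in> M \<and> b \<in> Mon r}" using M(2) by blast
    ultimately show "m \<in> lin R {a * b | a b. a \<in> M \<and> b \<in> Mon r}" using lin_mono by blast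
  qed
  have Rsub: "subring (R :: 'k mpoly set)" by (rule R_subring)
  have MonR: "\<And>m k. m \<in> Mon k \<Longrightarrow> m \<in> (R :: 'k mpoly set)" by (rule mons_R)
  have MD: "0 \<in> M" "\<And>x y. x \<in> M \<Longrightarrow> y \<in> M \<Longrightarrow> x + y \<in> M" "\<And>x y. x \<in> R \<Longrightarrow> y \<in> M \<Longrightarrow> x * y \<in> M" "M \<subseteq> R"
    using M(1) by (auto simp: ideal_in_def)
  have DD: "\<And>x y. x \<in> R \<Longrightarrow> y \<in> ?D \<Longrightarrow> x * y \<in> ?D" "?D \<subseteq> R" "\<And>x y. x \<in> ?D \<Longrightarrow> y \<in> ?D \<Longrightarrow> x + y \<in> ?D"
    using diag_ideal_ideal[where 'k = 'k] by (auto simp: ideal_in_def)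
  have m1: "- 1 \<in> (R :: 'k mpoly set)" using subringD(5)[OF Rsub subringD(1)[OF Rsub]] .
  have Mdiff: "x - y \<in> M" if "x \<in> M" "y \<in> M" for x y using MD(2)[OF that(1) MD(3)[OF m1 that(2)]] by simp
  obtain e where e: "e \<in> ?D" "e \<notin> M" using M(3) by blast
  have eR: "e \<in> R" using e DD(2) by blast
  define q where "q = {x \<in> R. x * e \<in> M}"
  have extend: "\<exists>s\<in>R. f - s * (x * e) \<in> M" if x: "x \<in> R" "x \<notin> q" and f: "f \<in> ?D" for x f
  proof -
    let ?K = "{m + s * (x * e) | m s. m \<in> M \<and> s \<in> R}"
    have xe: "x * e \<in> ?D" using x e DD by blast
    have "ideal_in R ?K" unfolding ideal_in_def
    proof (intro conjI ballI)
      show "?K \<subseteq> R" using MD(4) x(1) eR by (auto intro!: subringD(4,6)[OF Rsub])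
      show "0 \<in> ?K" using MD(1) subringD(2)[OF Rsub] by (intro CollectI exI[of _ 0]) simp
      show "y + z \<in> ?K" if yz: "y \<in> ?K" "z \<in> ?K" for y z
      proof -
        obtain m s m' s' where "y = m + s * (x * e)" "z = m' + s' * (x * e)" "m \<in> M" "m' \<in> M" "s \<in> R" "s' \<in> R" using yz by blast
        then show ?thesis using MD(2) subringD(6)[OF Rsub]
          by (intro CollectI exI[of _ "m + m'"] exI[of _ "s + s'"]) (simp add: algebra_simps)
      qed
      show "c * y \<in> ?K" if c: "c \<in> R" and y: "y \<in> ?K" for c y
      proof -
        obtain m s where "y = m + s * (x * e)" "m \<in> M" "s \<in> R" using y by blast
        then show ?thesis using MD(3) c subringD(4)[OF Rsub]
          by (intro CollectI exI[of _ "c * m"] exI[of _ "c * s"]) (simp add: algebra_simps)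
      qed
    qed
    moreover have "M \<subseteq> ?K"
    proof
      fix m assume "m \<in> M"
      then show "m \<in> ?K" using subringD(2)[OF Rsub] by (intro CollectI exI[of _ m] exI[of _ 0]) simp
    qed
    moreover have "?K \<subseteq> ?D"
    proof clarify
      fix m s assume "m \<in> M" "s \<in> (R :: 'k mpoly set)"
      then show "m + s * (x * e) \<in> ?D" using M(3) by (intro DD(3) DD(1)[OF _ xe]) auto
    qed
    ultimately have alt: "?K = M \<or> ?K = ?D" by (rule max)
    have xeK: "x * e \<in> ?K"
      using MD(1) subringD(1)[OF Rsub] by (intro CollectI exI[of _ 0] exI[of _ 1]) simp
    have "x * e \<notin> M" using x by (simp add: q_def)
    then have "?K \<noteq> M" using xeK by (rule_tac notI) (simp only:)
    then have "?K = ?D" using alt by (simp only: simp_thms)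
    then have "f \<in> ?K" using f by (rule ssubst)
    then obtain m s where "f = m + s * (x * e)" "m \<in> M" "s \<in> R" by blast
    then show ?thesis by (intro bexI[of _ s]) simp_all
  qed
  have one: "1 \<notin> q" using e by (simp add: q_def)
  have inv: "\<exists>y\<in>R. x * y - 1 \<in> q" if x: "x \<in> R" "x \<notin> q" for x
  proof -
    obtain s where s: "s \<in> R" "e - s * (x * e) \<in> M" using extend[OF x e(1)] by blast
    have "(- 1) * (e - s * (x * e)) \<in> M" using MD(3)[OF m1 s(2)] .
    then have "(x * s - 1) * e \<in> M" by (simp add: algebra_simps)
    moreover have "x * s - 1 \<in> R" using x s by (intro subringD(3,4)[OF Rsub] subringD(1)[OF Rsub])
    ultimately show ?thesis using s(1) by (auto simp: q_def)
  qed
  have q_ideal: "ideal_in R q"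
    unfolding ideal_in_def
  proof (intro conjI ballI)
    show "q \<subseteq> R" by (auto simp: q_def)
    show "0 \<in> q" using MD(1) subringD(2)[OF Rsub] by (simp add: q_def)
    show "x + y \<in> q" if "x \<in> q" "y \<in> q" for x y
      using that MD(2) subringD(6)[OF Rsub] by (simp add: q_def distrib_right)
    show "x * y \<in> q" if "x \<in> R" "y \<in> q" for x y
      using that MD(3) subringD(4)[OF Rsub] by (simp add: q_def mult.assoc)
  qed
  have qD: "\<And>x y. x \<in> q \<Longrightarrow> y \<in> q \<Longrightarrow> x + y \<in> q" "\<And>x y. x \<in> R \<Longrightarrow> y \<in> q \<Longrightarrow> x * y \<in> q" "q \<subseteq> R"
    using q_ideal by (auto simp: ideal_in_def)
  have q_prime: "x \<in> q \<or> y \<in> q" if xy: "x \<in> R" "y \<in> R" "x * y \<in> q" for x y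
  proof (rule ccontr)
    assume "\<not> (x \<in> q \<or> y \<in> q)"
    then obtain x' where x': "x' \<in> R" "x * x' - 1 \<in> q" and "y \<notin> q" using inv[OF xy(1)] by blast
    have "x' * (x * y) + (- 1) * (y * (x * x' - 1)) \<in> q"
      by (rule qD(1)[OF qD(2)[OF x'(1) xy(3)] qD(2)[OF m1 qD(2)[OF xy(2) x'(2)]]])
    then have "y \<in> q" by (simp add: algebra_simps)
    then show False using \<open>y \<notin> q\<close> by simp
  qed
  have qM: "x * f \<in> M" if x: "x \<in> q" and f: "f \<in> ?D" for x f
  proof -
    obtain s where s: "s \<in> R" "f - s * (1 * e) \<in> M" using extend[OF subringD(1)[OF Rsub] one f] by blast
    have xR: "x \<in> R" using x by (simp add: q_def)
    have "x * (f - s * (1 * e)) + s * (x * e) \<in> M"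
      using MD(2)[OF MD(3)[OF xR s(2)] MD(3)[OF s(1)]] x by (simp add: q_def)
    then show ?thesis by (simp add: algebra_simps)
  qed
  have cells: "xy i j \<in> q" if sh: "(i, j) \<in> shape lam n 1" for i j
  proof (rule ccontr)
    assume nq: "(xy i j :: 'k mpoly) \<notin> q"
    have xyM: "xy i j \<in> (Mon 1 :: 'k mpoly set)" using sh by (auto simp: mons_1)
    have pow: "(xy i j :: 'k mpoly) ^ k \<in> Mon k \<and> (xy i j :: 'k mpoly) ^ k \<notin> q" for k
    proof (induction k)
      case 0
      then show ?case using one by simp
    next
      case (Suc k)
      then have "(xy i j :: 'k mpoly) * xy i j ^ k \<notin> q" using q_prime[of "xy i j" "xy i j ^ k"] nq MonR xyM by blast
      moreover have "(xy i j :: 'k mpoly) * xy i j ^ k \<in> Mon (Suc k)" using Suc xyM by (intro mons_mult_1) auto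
      ultimately show ?case by simp
    qed
    let ?u = "(xy i j :: 'k mpoly) ^ Suc r"
    have "?u \<in> lin R {a * b | a b. a \<in> M \<and> b \<in> Mon r}" using pow[of "Suc r"] redM unfolding reduces_def by blast
    moreover have "{a * b | a b. a \<in> M \<and> b \<in> (Mon r :: 'k mpoly set)} \<subseteq> M"
    proof clarify
      fix a b assume "a \<in> M" "b \<in> (Mon r :: 'k mpoly set)"
      then show "a * b \<in> M" using MD(3)[OF MonR[of b r]] by (simp add: mult.commute)
    qed
    ultimately have uM: "?u \<in> M" using lin_subset_ideal[OF M(1)] by blast
    have "e * ?u \<in> M" using MD(3)[OF eR uM] .
    then have "?u \<in> q" using uM MD(4) by (auto simp: q_def mult.commute)
    then show False using pow[of "Suc r"] by blast
  qed
  define i0 where "i0 = (LEAST i. 1 \<le> i \<and> (i \<le> n \<longrightarrow> var (X i) \<notin> q))"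
  define j0 where "j0 = (LEAST j. 1 \<le> j \<and> (j \<le> lam 1 \<longrightarrow> var (Y j) \<notin> q))"
  define a where "a = (if i0 \<le> n then lam i0 else 0)"
  define b where "b = (LEAST i. \<not> (i + 1 \<le> n \<and> j0 \<le> lam (i + 1)))"
  have i0: "1 \<le> i0" "i0 \<le> n \<Longrightarrow> var (X i0) \<notin> q"
    using LeastI[of "\<lambda>i. 1 \<le> i \<and> (i \<le> n \<longrightarrow> var (X i) \<notin> q)" "n + 1"] unfolding i0_def[symmetric] by auto
  have j0: "1 \<le> j0" "j0 \<le> lam 1 \<Longrightarrow> var (Y j0) \<notin> q"
    using LeastI[of "\<lambda>j. 1 \<le> j \<and> (j \<le> lam 1 \<longrightarrow> var (Y j) \<notin> q)" "lam 1 + 1"] unfolding j0_def[symmetric] by auto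
  have X_in: "var (X i) \<in> q" if "1 \<le> i" "i < i0" for i
    using not_less_Least[OF that(2)[unfolded i0_def]] that(1) by blast
  have Y_in: "var (Y j) \<in> q" if "1 \<le> j" "j < j0" for j
    using not_less_Least[OF that(2)[unfolded j0_def]] that(1) by blast
  have b0: "\<not> (b + 1 \<le> n \<and> j0 \<le> lam (b + 1))"
    using LeastI[of "\<lambda>i. \<not> (i + 1 \<le> n \<and> j0 \<le> lam (i + 1))" n] unfolding b_def[symmetric] by auto
  have row_bound: "j \<le> a" if "(i, j) \<in> shape lam n 1" "i0 \<le> i" for i j
    using that noninc[of i0 i] i0(1) by (auto simp: shape_def a_def)
  have col_bound: "i \<le> b" if "(i, j) \<in> shape lam n 1" "j0 \<le> j" for i j
  proof (rule ccontr)
    assume "\<not> i \<le> b"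
    then show False using that b0 noninc[of "b + 1" i] by (auto simp: shape_def)
  qed
  have a_row: "(i0, j) \<in> shape lam n 1" if "1 \<le> j" "j \<le> a" for j
    using that i0(1) by (auto simp: shape_def a_def split: if_splits)
  have b_col: "(i, j0) \<in> shape lam n 1" if "1 \<le> i" "i \<le> b" for i
  proof -
    have "i - 1 < b" using that by simp
    then have "i - 1 + 1 \<le> n \<and> j0 \<le> lam (i - 1 + 1)" unfolding b_def using not_less_Least by blast
    then show ?thesis using that(1) j0(1) by (simp add: shape_def)
  qed
  have a_less: "a < j0"
  proof (rule ccontr)
    assume "\<not> a < j0"
    then have j: "(i0, j0) \<in> shape lam n 1" using a_row j0(1) by simp
    then have "i0 \<le> n" "j0 \<le> lam 1" using noninc[of 1 i0] by (auto simp: shape_def)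
    moreover have "var (X i0) * var (Y j0) \<in> q" using cells[OF j] by (simp add: xy_eq_var)
    moreover have "var (X i0) \<in> R" "var (Y j0) \<in> R" using shape_vars[OF j] var_R by auto
    ultimately show False using q_prime i0(2) j0(2) by blast
  qed
  have b_less: "b < i0"
  proof (rule ccontr)
    assume "\<not> b < i0"
    then have "(i0, j0) \<in> shape lam n 1" using b_col i0(1) by simp
    then show False using row_bound[of i0 j0] a_less by simp
  qed
  interpret fp: ferrers_prime n lam q i0 j0 a b
    by unfold_locales
       (fact q_ideal one q_prime X_in Y_in i0 j0 b_less a_less row_bound col_bound a_row b_col)+
  have "\<forall>x\<in>fp.gens. \<exists>t\<in>R. fp.gen x - t * e \<in> fp.loc M"
  proof
    fix x assume x: "x \<in> fp.gens"
    then have "fp.gen x \<in> fp.loc ?D" by (rule fp.gens_loc)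
    then obtain u where u: "fp.gen x \<in> R" "u \<in> R" "u \<notin> q" "u * fp.gen x \<in> ?D" unfolding fp.loc_def by blast
    obtain s where s: "s \<in> R" "u * fp.gen x - s * (1 * e) \<in> M" using extend[OF subringD(1)[OF Rsub] one u(4)] by blast
    obtain v where v: "v \<in> R" "u * v - 1 \<in> q" using inv[OF u(2,3)] by blast
    have "(u * fp.gen x - s * (1 * e)) - (u * v - 1) * (s * e) \<in> M"
      by (rule Mdiff[OF s(2) qM[OF v(2) DD(1)[OF s(1) e(1)]]])
    then have "u * (fp.gen x - (v * s) * e) \<in> M" by (simp add: algebra_simps)
    moreover have "fp.gen x - (v * s) * e \<in> R" using u v s eR by (intro subringD(3,4)[OF Rsub])
    ultimately have "fp.gen x - (v * s) * e \<in> fp.loc M" using u unfolding fp.loc_def by blast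
    then show "\<exists>t\<in>R. fp.gen x - t * e \<in> fp.loc M" using subringD(4)[OF Rsub v(1) s(1)] by blast
  qed
  then obtain \<tau> where \<tau>: "\<And>x. x \<in> fp.gens \<Longrightarrow> \<tau> x \<in> R" "\<And>x. x \<in> fp.gens \<Longrightarrow> fp.gen x - \<tau> x * e \<in> fp.loc M" by metis
  have spec: "\<exists>v. fp.specializes \<tau> 1 f v \<and> v \<in> R \<and> f - v * e \<in> fp.loc M" if f: "f \<in> ?D" for f
  proof -
    have "f \<in> lin R (fp.gen ` fp.gens)" using fp.diags_subset_gens f by blast
    then obtain \<rho> where \<rho>: "\<forall>x\<in>fp.gens. \<rho> x \<in> R" "f = (\<Sum>x\<in>fp.gens. \<rho> x * fp.gen x)"
      using finite_lin_sum[OF Rsub fp.finite_gens] by blast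
    define v where "v = (\<Sum>x\<in>fp.gens. \<rho> x * \<tau> x)"
    have "fp.specializes \<tau> 1 f v" unfolding \<rho>(2) v_def by (rule fp.specializes_lin) (use \<tau> \<rho> in auto)
    moreover have "v \<in> R"
    proof -
      have "sum (\<lambda>x. \<rho> x * \<tau> x) A \<in> R" if "A \<subseteq> fp.gens" for A
        using that \<rho>(1) \<tau>(1)
        by (induction A rule: infinite_finite_induct) (auto intro!: subringD(2,4,6)[OF Rsub])
      then show ?thesis by (simp add: v_def)
    qed
    moreover have "f - v * e \<in> fp.loc M"
    proof -
      have "f - v * e = (\<Sum>x\<in>fp.gens. \<rho> x * (fp.gen x - \<tau> x * e))"
        unfolding \<rho>(2) v_def by (simp add: sum_distrib_right sum_subtractf right_diff_distrib mult.assoc)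
      also have "\<dots> \<in> fp.loc M"
        by (rule fp.loc_sum[OF M(1)], rule fp.loc_scale[OF M(1)]) (use \<rho>(1) \<tau>(2) in auto)
      finally show ?thesis .
    qed
    ultimately show ?thesis by blast
  qed
  have locq: "v \<in> q" if v: "v \<in> R" "v * e \<in> fp.loc M" for v
  proof -
    obtain u where u: "u \<in> R" "u \<notin> q" "u * (v * e) \<in> M" using v(2) unfolding fp.loc_def by blast
    then have "u * v \<in> q" using subringD(4)[OF Rsub u(1) v(1)] by (simp add: q_def mult.assoc)
    then show ?thesis using q_prime u(1,2) v(1) by blast
  qed
  show False
  proof (rule fp.no_reduction[of \<tau> M r e])
    show "\<tau> x \<in> R" if "x \<in> fp.gens" for x using \<tau>(1) that .
    show "ideal_in R M" by (rule M(1))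
    show "reduces M r" by (rule redM)
    show "\<exists>v\<in>q. fp.specializes \<tau> 1 f v" if f: "f \<in> M" for f
    proof -
      obtain v where v: "fp.specializes \<tau> 1 f v" "v \<in> R" "f - v * e \<in> fp.loc M" using spec[of f] f M(3) by blast
      have "f - (f - v * e) \<in> fp.loc M" by (rule fp.loc_diff[OF M(1) fp.loc_base[OF M(1) f] v(3)])
      then show ?thesis using locq[OF v(2)] v(1) by auto
    qed
    show "e \<in> ferrers_ideal n lam" using e(1) diag_ideal_subset by blast
    show "\<exists>v. v - 1 \<in> q \<and> fp.specializes \<tau> 1 e v"
    proof -
      obtain v where v: "fp.specializes \<tau> 1 e v" "v \<in> R" "e - v * e \<in> fp.loc M" using spec[OF e(1)] by blast
      have "(- 1) * (e - v * e) \<in> fp.loc M" by (rule fp.loc_scale[OF M(1) m1 v(3)])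
      then have "(v - 1) * e \<in> fp.loc M" by (simp add: algebra_simps)
      then have "v - 1 \<in> q" by (intro locq subringD(3)[OF Rsub v(2) subringD(1)[OF Rsub]])
      then show ?thesis using v(1) by blast
    qed
  qed
qed

end

theorem theorem6p7:
  fixes n :: nat and lam :: "nat \<Rightarrow> nat"
  assumes K_inf: "infinite (UNIV :: 'k::field set)"
    and n_pos: "1 \<le> n"
    and lam_pos: "\<forall>i. 1 \<le> i \<and> i \<le> n \<longrightarrow> 0 < lam i"
    and lam_noninc: "\<forall>i j. 1 \<le> i \<and> i \<le> j \<and> j \<le> n \<longrightarrow> lam j \<le> lam i"
  shows "reduction_number (ferrers_ring n lam :: 'k mpoly set) (ferrers_ideal n lam)
           = Min (insert (n - 1) {lam i + i - 3 | i. 2 \<le> i \<and> i \<le> n})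
       \<and> minimal_reduction (ferrers_ring n lam :: 'k mpoly set) (diag_reduction n lam) (ferrers_ideal n lam)
       \<and> red_num_wrt (ferrers_ring n lam :: 'k mpoly set) (diag_reduction n lam) (ferrers_ideal n lam)
           = Min (insert (n - 1) {lam i + i - 3 | i. 2 \<le> i \<and> i \<le> n})"
proof -
  interpret ferrers n lam
    by unfold_locales (use n_pos lam_pos lam_noninc in auto)
  let ?R = "ferrers_ring n lam :: 'k mpoly set" and ?I = "ferrers_ideal n lam :: 'k mpoly set"
    and ?J = "diag_reduction n lam :: 'k mpoly set"
  let ?A = "insert (n - 1) {lam i + i - 3 | i. 2 \<le> i \<and> i \<le> n}"
  define s where "s = Min ?A"
  have finA: "finite ?A"
  proof -
    have "{lam i + i - 3 | i. 2 \<le> i \<and> i \<le> n} = (\<lambda>i. lam i + i - 3) ` {2..n}" by auto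
    then show ?thesis by simp
  qed
  have pos_iff: "strict_num lam n 1 k \<noteq> 0 \<longleftrightarrow> (\<forall>x\<in>?A. k \<le> x)" for k
  proof -
    have "strict_num lam n 1 k \<noteq> 0 \<longleftrightarrow> k < n \<and> (\<forall>i. 2 \<le> i \<and> i \<le> n \<longrightarrow> k + 3 \<le> i + max 1 (lam i + 1 - 1))"
      using strict_num_pos_iff[of n lam 1 k] n_pos noninc by simp
    also have "\<dots> \<longleftrightarrow> k \<le> n - 1 \<and> (\<forall>i. 2 \<le> i \<and> i \<le> n \<longrightarrow> k \<le> lam i + i - 3)"
    proof -
      have "k + 3 \<le> i + max 1 (lam i + 1 - 1) \<longleftrightarrow> k \<le> lam i + i - 3" if "2 \<le> i" "i \<le> n" for i
      proof -
        have "0 < lam i" using lam_pos that by simp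
        then show ?thesis using that(1) by (simp add: max_def) arith
      qed
      moreover have "k < n \<longleftrightarrow> k \<le> n - 1" using n_pos by auto
      ultimately show ?thesis by auto
    qed
    also have "\<dots> \<longleftrightarrow> (\<forall>x\<in>?A. k \<le> x)" by auto
    finally show ?thesis .
  qed
  have s_pos: "strict_num lam n 1 s \<noteq> 0" unfolding pos_iff s_def using finA by simp
  have "s \<in> ?A" unfolding s_def by (rule Min_in) (use finA in auto)
  then have s_Suc: "strict_num lam n 1 (Suc s) = 0" using pos_iff[of "Suc s"] by fastforce
  have J: "ideal_in ?R ?J" "?J \<subseteq> ?I" unfolding diag_reduction_eq by (rule diag_ideal_ideal, rule diag_ideal_subset)
  have red_s: "reduces ?J s" unfolding diag_reduction_eq by (rule reduces_diag_ideal[OF s_Suc])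
  have min: "minimal_reduction ?R ?J ?I"
    unfolding minimal_reduction_def
  proof (intro conjI allI impI)
    show "is_reduction ?R ?J ?I" unfolding is_reduction_def using J red_s reduces_iff[OF J] by blast
    fix J' assume "is_reduction ?R J' ?I \<and> J' \<subseteq> ?J"
    then have J': "ideal_in ?R J'" "J' \<subseteq> ?I" "J' \<subseteq> ?J"
      and "\<exists>r. ideal_pow ?R ?I (Suc r) = ideal_prod ?R J' (ideal_pow ?R ?I r)"
      by (auto simp: is_reduction_def)
    then obtain r where "reduces J' r" using reduces_iff[OF J'(1,2)] by blast
    then show "J' = ?J" using diag_ideal_no_smaller[OF J'(1)] J'(3) unfolding diag_reduction_eq by blast
  qed
  have lower: "s \<le> red_num_wrt ?R K ?I" if K: "minimal_reduction ?R K ?I" for K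
  proof -
    have KI: "ideal_in ?R K" "K \<subseteq> ?I" and ex: "\<exists>r. ideal_pow ?R ?I (Suc r) = ideal_prod ?R K (ideal_pow ?R ?I r)"
      using K by (auto simp: minimal_reduction_def is_reduction_def)
    have "ideal_pow ?R ?I (Suc (red_num_wrt ?R K ?I)) = ideal_prod ?R K (ideal_pow ?R ?I (red_num_wrt ?R K ?I))"
      unfolding red_num_wrt_def using ex by (rule LeastI_ex)
    then have "reduces K (red_num_wrt ?R K ?I)" using reduces_iff[OF KI] by blast
    then show ?thesis by (rule minimal_reduction_lower_bound[OF K_inf K _ s_pos])
  qed
  have "red_num_wrt ?R ?J ?I \<le> s"
    unfolding red_num_wrt_def by (rule Least_le) (use red_s reduces_iff[OF J] in blast)
  then have red: "red_num_wrt ?R ?J ?I = s" using lower[OF min] by simp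
  have "reduction_number ?R ?I = s"
    unfolding reduction_number_def
  proof (rule Least_equality)
    show "\<exists>J. minimal_reduction ?R J ?I \<and> red_num_wrt ?R J ?I = s" using min red by blast
    fix r assume "\<exists>J. minimal_reduction ?R J ?I \<and> red_num_wrt ?R J ?I = r"
    then obtain J where "minimal_reduction ?R J ?I" "red_num_wrt ?R J ?I = r" by (elim exE conjE)
    then show "s \<le> r" using lower[of J] by simp
  qed
  then show ?thesis using min red unfolding s_def by blast
qed

end
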